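(* Let $(g,L,U)$ be payoff processes and $\{\mathcal P(t,\omega)\}_{(t,\omega)\in[0,T]\times\Omega}$ a probability class such that the following properties (all defined in the context) hold: payoff regularity, integrability, adaptedness, stability under conditioning, weak stability under pasting, path-continuity of values, and the uniform oscillation bound. Then: (1) For any $n\in\mathbb N\cup\{\infty\}$, all paths of the process $V^n$ are both left-upper-semicontinuous (i.e. $\limsup_{r\nearrow s}V^n_r(\omega)\le V^n_s(\omega)$ for $s\in(0,T]$, $\omega\in\Omega$) and right-lower-semicontinuous (i.e. $V^n_t(\omega)\le\liminf_{r\searrow t}V^n_r(\omega)$ for $t\in[0,T)$, $\omega\in\Omega$). In particular, the process $\overline V$ has all paths continuous. (2) For any $(t,\omega)\in[0,T]\times\Omega$ and $\mathbb P\in\mathcal P(t,\omega)$, $\overline V^{t,\omega}\in\mathbb S(\mathbf F^t,\mathbb P)$.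
   Context: **Canonical spaces.** Fix $d\in\mathbb N$, $T\in(0,\infty)$. A modulus of continuity function is a nondecreasing $\rho:[0,\infty)\to[0,\infty)$ with $\rho(0)=\lim_{x\downarrow0}\rho(x)=0$. For $t\in[0,T]$ let $\Omega^t=\{\omega\in C([t,T];\mathbb R^d):\omega(t)=0\}$, $\|\omega\|_{t,s}=\sup_{r\in[t,s]}|\omega(r)|$, $B^t$ the canonical process on $\Omega^t$, $\mathcal F^t_s=\sigma(B^t_r:r\in[t,s])$, $\mathbf F^t=\{\mathcal F^t_s\}_{s\in[t,T]}$ (raw filtration), $\mathcal T^t$ the set of all $\mathbf F^t$-stopping times (with values in $[t,T]$), $\mathcal T^t_s=\{\tau\in\mathcal T^t:\tau\ge s \text{ everywhere}\}$, and $\mathfrak P_t$ the set of all probabilities on $(\Omega^t,\mathcal F^t_T)$. For $n\in\mathbb N$, $\mathcal T^t(n)$ is the set of $\tau\in\mathcal T^t$ with values in $\{t\vee(i2^{-n}T)\}_{i=0}^{2^n}$, and $\mathcal T^t_s(n)=\mathcal T^t(n)\cap\mathcal T^t_s$; put $\mathcal T^t(\infty)=\mathcal T^t$, $\mathcal T^t_s(\infty)=\mathcal T^t_s$. The superscript $t$ is dropped when $t=0$; $\mathbf 0\in\Omega$ is the null path. For $\omega\in\Omega^t$, $\delta>0$: $O^s_\delta(\omega)=\{\omega'\in\Omega^t:\|\omega'-\omega\|_{t,s}<\delta\}$. $\mathbb S(\mathbf F^t,\mathbb P)$ is the set of real-valued $\mathbf F^t$-adapted processes $X$ on $[t,T]$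 with all paths continuous and $\mathbb E_{\mathbb P}[\sup_{s\in[t,T]}|X_s|]<\infty$. **Shifts.** For $t\le s$, $\omega\in\Omega^t$, $\tilde\omega\in\Omega^s$: $(\omega\otimes_s\tilde\omega)(r)=\omega(r)\mathbf 1_{\{r<s\}}+(\omega(s)+\tilde\omega(r))\mathbf 1_{\{r\ge s\}}$, $r\in[t,T]$. For a random variable $\xi$ (resp. process $X$) on $\Omega^t$: $\xi^{s,\omega}(\tilde\omega)=\xi(\omega\otimes_s\tilde\omega)$, $X^{s,\omega}_r(\tilde\omega)=X_r(\omega\otimes_s\tilde\omega)$, $r\in[s,T]$. For $\mathbb P\in\mathfrak P_t$, $\mathbb P^{s,\omega}\in\mathfrak P_s$ is defined by $\mathbb P^{s,\omega}(A)=\mathbb P^\omega_s(\omega\otimes_sA)$, $A\in\mathcal F^s_T$, where $\{\mathbb P^\omega_s\}_{\omega\in\Omega^t}$ is the regular conditional probability distribution of $\mathbb P$ given $\mathcal F^t_s$ with $\mathbb P^\omega_s(\omega\otimes_s\Omega^s)=1$ for all $\omega$. **Payoff regularity.** $g,L,U$ are real-valued processes on $[0,T]\times\Omega$ with $L\le U$ everywhere, and there is a modulus of continuity function $\rho_0$ such that each $X\in\{g,L,U\}$ satisfies $|X_{t_1}(\omega_1)-X_{t_2}(\omega_2)|\le\rho_0\big(|t_1-t_2|+\|\omega_1(\cdot\wedge t_1)-\omega_2(\cdot\wedge t_2)\|_{0,T}\big)$ for all $(t_i,\omega_i)\in[0,T]\times\Omega$. Put $\Psi_t=(-L_t)\vee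 U_t\vee0$ and, for $\tau,\gamma\in\mathcal T^t$, $R^{t,\omega}(\tau,\gamma)=\int_t^{\tau\wedge\gamma}g^{t,\omega}_s\,ds+\mathbf 1_{\{\tau\le\gamma\}}L^{t,\omega}_\tau+\mathbf 1_{\{\gamma<\tau\}}U^{t,\omega}_\gamma$. **Integrability.** For every $t\in[0,T]$ the set $\widehat{\mathfrak P}_t=\{\mathbb P\in\mathfrak P_t:\Psi^{t,\mathbf 0}\in\mathbb S(\mathbf F^t,\mathbb P),\ \mathbb E_{\mathbb P}\int_t^T|g^{t,\mathbf 0}_s|ds<\infty\}$ is nonempty. **Adaptedness.** For all $(t,\omega)$, $\mathcal P(t,\omega)$ is a nonempty subset of $\widehat{\mathfrak P}_t$, and $\mathcal P(t,\omega_1)=\mathcal P(t,\omega_2)$ if $\omega_1|_{[0,t]}=\omega_2|_{[0,t]}$. **Stability under conditioning.** For all $0\le t<s\le T$, $\omega\in\Omega$, $\mathbb P\in\mathcal P(t,\omega)$ there exist an extension $(\Omega^t,\mathcal F',\mathbb P')$ of $(\Omega^t,\mathcal F^t_T,\mathbb P)$ (i.e. $\mathcal F^t_T\subset\mathcal F'$, $\mathbb P'|_{\mathcal F^t_T}=\mathbb P$) and $\Omega'\in\mathcal F'$ with $\mathbb P'(\Omega')=1$ such that $\mathbb P^{s,\tilde\omega}\in\mathcal P(s,\omega\otimes_t\tilde\omega)$ for all $\tilde\omega\in\Omega'$. **Weak stability under pasting.** There is a modulus of continuity function $\widehat\rho_0$ such that for all $0\le t<s\le T$, $\omega\in\Omega$,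 $\mathbb P\in\mathcal P(t,\omega)$, $\delta\in\mathbb Q_+$ (positive rational), $\lambda\in\mathbb N$, every $\mathcal F^t_s$-measurable partition $\{\mathcal A_j\}_{j=0}^\lambda$ of $\Omega^t$ such that for $j=1,\dots,\lambda$, $\mathcal A_j\subset O^s_{\delta_j}(\tilde\omega_j)$ for some $\delta_j\in((0,\delta]\cap\mathbb Q)\cup\{\delta\}$, $\tilde\omega_j\in\Omega^t$, and all $\mathbb P_j\in\mathcal P(s,\omega\otimes_t\tilde\omega_j)$, $j=1,\dots,\lambda$, there is $\widehat{\mathbb P}\in\mathcal P(t,\omega)$ with: (i) $\widehat{\mathbb P}(A\cap\mathcal A_0)=\mathbb P(A\cap\mathcal A_0)$ for all $A\in\mathcal F^t_T$; (ii) $\widehat{\mathbb P}(A\cap\mathcal A_j)=\mathbb P(A\cap\mathcal A_j)$ for all $j=1,\dots,\lambda$, $A\in\mathcal F^t_s$; (iii) for any $n\in\mathbb N\cup\{\infty\}$ and $\wp\in\mathcal T^s$ there exist $\wp^n_j\in\mathcal T^t_s$, $j=1,\dots,\lambda$, such that for any $A\in\mathcal F^t_s$ and $\tau\in\mathcal T^t_s(n)$, $$\sum_{j=1}^\lambda\mathbb E_{\widehat{\mathbb P}}\big[\mathbf 1_{A\cap\mathcal A_j}R^{t,\omega}(\tau,\wp^n_j)\big]\le\sum_{j=1}^\lambda\mathbb E_{\mathbb P}\Big[\mathbf 1_{\{\tilde\omega\in A\cap\mathcal A_j\}}\Big(\sup_{\varsigma\in\mathcal T^s(n)}\mathbb E_{\mathbb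 P_j}\big[R^{s,\omega\otimes_t\tilde\omega}(\varsigma,\wp)\big]+\int_t^sg^{t,\omega}_r(\tilde\omega)dr\Big)\Big]+\widehat\rho_0(\delta).$$ **Values.** For $n\in\mathbb N\cup\{\infty\}$, $V^n_t(\omega)=\inf_{\mathbb P\in\mathcal P(t,\omega)}\inf_{\gamma\in\mathcal T^t}\sup_{\tau\in\mathcal T^t(n)}\mathbb E_{\mathbb P}[R^{t,\omega}(\tau,\gamma)]$, and $\overline V:=V^\infty$. **Path-continuity of values** (continuity in $\omega$). There is a modulus of continuity function $\rho_1\ge\rho_0$ such that $|V^n_t(\omega_1)-V^n_t(\omega_2)|\le\rho_1(\|\omega_1-\omega_2\|_{0,t})$ for all $n\in\mathbb N\cup\{\infty\}$, $t\in[0,T]$, $\omega_1,\omega_2\in\Omega$. **Uniform oscillation bound.** For every $\alpha>0$ there is a modulus of continuity function $\rho_\alpha$ such that for all $t\in[0,T)$ and $\delta\in(0,T]$, $$\sup_{\omega\in O^t_\alpha(\mathbf 0)}\ \sup_{\mathbb P\in\mathcal P(t,\omega)}\ \sup_{\zeta\in\mathcal T^t}\mathbb E_{\mathbb P}\Big[\rho_1\Big(\delta+\sup_{r\in[\zeta,(\zeta+\delta)\wedge T]}|B^t_r-B^t_\zeta|\Big)\Big]\le\rho_\alpha(\delta),$$ with $\rho_1$ as in the path-continuity of values. *)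

theory Defs
  imports "HOL-Probability.Probability"
begin

type_synonym 'd path = "real \<Rightarrow> real ^ 'd"
type_synonym 'd process = "real \<Rightarrow> 'd path \<Rightarrow> real"

definition modulus :: "(real \<Rightarrow> real) \<Rightarrow> bool" where
  "modulus \<rho> \<longleftrightarrow> (\<forall>x\<ge>0. 0 \<le> \<rho> x) \<and> mono_on {0..} \<rho> \<and> \<rho> 0 = 0 \<and> (\<rho> \<longlongrightarrow> 0) (at_right 0)"

(* The supremum of |w(r)| over t <= r <= s; finite for the continuous paths it is applied to. *)
definition supnorm :: "real \<Rightarrow> real \<Rightarrow> ('d::finite) path \<Rightarrow> real" where
  "supnorm t s \<omega> = (SUP r\<in>{t..s}. norm (\<omega> r))"

text \<open>Everything depends on the horizon \<open>T\<close>, which becomes the first argument of the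
  constants defined in this block.  A path on \<open>[t,T]\<close> is represented by the unique function
  on the reals that is \<open>undefined\<close> outside \<open>[t,T]\<close> (as in \<^const>\<open>extensional\<close>).\<close>

context
  fixes T :: real
begin

subsection \<open>Canonical spaces\<close>

definition Omega :: "real \<Rightarrow> ('d::finite) path set" where
  "Omega t = {\<omega> \<in> extensional {t..T}. continuous_on {t..T} \<omega> \<and> \<omega> t = 0}"

definition null_path :: "('d::finite) path" where
  "null_path = (\<lambda>r\<in>{0..T}. 0)"

definition canon_filt :: "real \<Rightarrow> real \<Rightarrow> ('d::finite) path measure" where
  "canon_filt t s = sigma (Omega t)
     {(\<lambda>\<omega>. \<omega> r) -` S \<inter> Omega t | r S. r \<in> {t..s} \<inter> {t..T} \<and> S \<in> sets borel}"

abbreviation canon_probs :: "real \<Rightarrow> ('d::finite) path measure set" where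
  "canon_probs t \<equiv> space (prob_algebra (canon_filt t T))"

definition path_ball :: "real \<Rightarrow> real \<Rightarrow> real \<Rightarrow> ('d::finite) path \<Rightarrow> 'd path set" where
  "path_ball t s \<delta> \<omega> = {\<omega>' \<in> Omega t. supnorm t s (\<lambda>r. \<omega>' r - \<omega> r) < \<delta>}"

definition stops :: "real \<Rightarrow> (('d::finite) path \<Rightarrow> real) set" where
  "stops t = {\<tau> \<in> Omega t \<rightarrow> {t..T}. stopping_time (canon_filt t) \<tau>}"

definition stops_from :: "real \<Rightarrow> real \<Rightarrow> (('d::finite) path \<Rightarrow> real) set" where
  "stops_from t s = {\<tau> \<in> stops t. \<forall>\<omega>\<in>Omega t. s \<le> \<tau> \<omega>}"

definition dyadic_stops :: "real \<Rightarrow> enat \<Rightarrow> (('d::finite) path \<Rightarrow> real) set" where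
  "dyadic_stops t n = (case n of
     enat m \<Rightarrow> {\<tau> \<in> stops t. \<tau> ` Omega t \<subseteq> (\<lambda>i. max t (real i * T / 2 ^ m)) ` {0..2 ^ m}}
   | \<infinity> \<Rightarrow> stops t)"

definition dyadic_stops_from :: "real \<Rightarrow> real \<Rightarrow> enat \<Rightarrow> (('d::finite) path \<Rightarrow> real) set" where
  "dyadic_stops_from t s n = dyadic_stops t n \<inter> stops_from t s"

definition S_space :: "real \<Rightarrow> ('d::finite) path measure \<Rightarrow> 'd process set" where
  "S_space t P = {X.
     (\<forall>s\<in>{t..T}. X s \<in> borel_measurable (canon_filt t s)) \<and>
     (\<forall>\<omega>\<in>Omega t. continuous_on {t..T} (\<lambda>s. X s \<omega>)) \<and>
     integrable P (\<lambda>\<omega>. SUP s\<in>{t..T}. \<bar>X s \<omega>\<bar>)}"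

subsection \<open>Shifts\<close>

definition paste :: "real \<Rightarrow> real \<Rightarrow> ('d::finite) path \<Rightarrow> 'd path \<Rightarrow> 'd path" where
  "paste t s \<omega> \<omega>' = (\<lambda>r\<in>{t..T}. if r < s then \<omega> r else \<omega> s + \<omega>' r)"

(* The shift to time t of a process on the space of paths starting at time 0. *)
definition shift_proc :: "('d::finite) process \<Rightarrow> real \<Rightarrow> 'd path \<Rightarrow> 'd process" where
  "shift_proc X t \<omega> r \<omega>' = X r (paste 0 t \<omega> \<omega>')"

definition is_rcpd :: "real \<Rightarrow> real \<Rightarrow> ('d::finite) path measure \<Rightarrow> ('d path \<Rightarrow> 'd path measure) \<Rightarrow> bool" where
  "is_rcpd t s P Q \<longleftrightarrow>
     Q \<in> canon_filt t s \<rightarrow>\<^sub>M prob_algebra (canon_filt t T) \<and>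
     (\<forall>A\<in>sets (canon_filt t T).
        AE \<omega> in P. measure (Q \<omega>) A = real_cond_exp P (canon_filt t s) (indicator A) \<omega>) \<and>
     (\<forall>\<omega>\<in>Omega t. measure (Q \<omega>) (paste t s \<omega> ` Omega s) = 1)"

(* For Q an r.c.p.d. of P given the sigma-algebra at time s, this is the measure written
   P^{s,w}: its value at A is the mass that Q w gives to the concatenations of w with A. *)
definition shift_prob :: "real \<Rightarrow> real \<Rightarrow> (('d::finite) path \<Rightarrow> 'd path measure) \<Rightarrow> 'd path \<Rightarrow> 'd path measure" where
  "shift_prob t s Q \<omega> = measure_of (Omega s) (sets (canon_filt s T))
     (\<lambda>A. emeasure (Q \<omega>) (paste t s \<omega> ` A))"

subsection \<open>Payoffs\<close>

definition payoff_regular ::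
  "('d::finite) process \<Rightarrow> 'd process \<Rightarrow> 'd process \<Rightarrow> (real \<Rightarrow> real) \<Rightarrow> bool" where
  "payoff_regular g L U \<rho> \<longleftrightarrow>
     (\<forall>t\<in>{0..T}. \<forall>\<omega>\<in>Omega 0. L t \<omega> \<le> U t \<omega>) \<and> modulus \<rho> \<and>
     (\<forall>X\<in>{g, L, U}. \<forall>t1\<in>{0..T}. \<forall>t2\<in>{0..T}. \<forall>\<omega>1\<in>Omega 0. \<forall>\<omega>2\<in>Omega 0.
        \<bar>X t1 \<omega>1 - X t2 \<omega>2\<bar>
          \<le> \<rho> (\<bar>t1 - t2\<bar> + supnorm 0 T (\<lambda>r. \<omega>1 (min r t1) - \<omega>2 (min r t2))))"

definition Psi :: "('d::finite) process \<Rightarrow> 'd process \<Rightarrow> 'd process" where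
  "Psi L U t \<omega> = max (max (- L t \<omega>) (U t \<omega>)) 0"

definition payoff :: "('d::finite) process \<Rightarrow> 'd process \<Rightarrow> 'd process \<Rightarrow> real \<Rightarrow> 'd path \<Rightarrow>
    ('d path \<Rightarrow> real) \<Rightarrow> ('d path \<Rightarrow> real) \<Rightarrow> 'd path \<Rightarrow> real" where
  "payoff g L U t \<omega> \<tau> \<gamma> \<omega>' =
     (LBINT s:{t..min (\<tau> \<omega>') (\<gamma> \<omega>')}. shift_proc g t \<omega> s \<omega>') +
     (if \<tau> \<omega>' \<le> \<gamma> \<omega>' then shift_proc L t \<omega> (\<tau> \<omega>') \<omega>' else shift_proc U t \<omega> (\<gamma> \<omega>') \<omega>')"

definition hat_probs :: "('d::finite) process \<Rightarrow> 'd process \<Rightarrow> 'd process \<Rightarrow> real \<Rightarrow> 'd path measure set" where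
  "hat_probs g L U t = {P \<in> canon_probs t.
     shift_proc (Psi L U) t null_path \<in> S_space t P \<and>
     (\<integral>\<^sup>+\<omega>. (\<integral>\<^sup>+s\<in>{t..T}. ennreal \<bar>shift_proc g t null_path s \<omega>\<bar> \<partial>lborel) \<partial>P) < \<infinity>}"

(* The extrema are those of the reals. Under payoff regularity and with all laws in hat_probs they
   are extrema of nonempty bounded sets: the expectations exist and are bounded in tau for each
   law; tau = t gives the lower bound L, and gamma = t the upper bound U. *)
definition val :: "('d::finite) process \<Rightarrow> 'd process \<Rightarrow> 'd process \<Rightarrow>
    (real \<Rightarrow> 'd path \<Rightarrow> 'd path measure set) \<Rightarrow> enat \<Rightarrow> 'd process" where
  "val g L U \<P> n t \<omega> = (INF P\<in>\<P> t \<omega>. INF \<gamma>\<in>stops t. SUP \<tau>\<in>dyadic_stops t n.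
     (\<integral>\<omega>'. payoff g L U t \<omega> \<tau> \<gamma> \<omega>' \<partial>P))"

subsection \<open>Conditions on the probability class\<close>

definition integrability :: "('d::finite) process \<Rightarrow> 'd process \<Rightarrow> 'd process \<Rightarrow> bool" where
  "integrability g L U \<longleftrightarrow> (\<forall>t\<in>{0..T}. hat_probs g L U t \<noteq> {})"

definition adapted_class :: "('d::finite) process \<Rightarrow> 'd process \<Rightarrow> 'd process \<Rightarrow>
    (real \<Rightarrow> 'd path \<Rightarrow> 'd path measure set) \<Rightarrow> bool" where
  "adapted_class g L U \<P> \<longleftrightarrow>
     (\<forall>t\<in>{0..T}. \<forall>\<omega>\<in>Omega 0. \<P> t \<omega> \<noteq> {} \<and> \<P> t \<omega> \<subseteq> hat_probs g L U t) \<and>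
     (\<forall>t\<in>{0..T}. \<forall>\<omega>1\<in>Omega 0. \<forall>\<omega>2\<in>Omega 0.
        (\<forall>r\<in>{0..t}. \<omega>1 r = \<omega>2 r) \<longrightarrow> \<P> t \<omega>1 = \<P> t \<omega>2)"

(* An r.c.p.d. is unique only up to a P-null set of the sigma-algebra at time s. Such a set can be
   removed from Omega', so the condition does not depend on the version Q. *)
definition stable_conditioning :: "(real \<Rightarrow> ('d::finite) path \<Rightarrow> 'd path measure set) \<Rightarrow> bool" where
  "stable_conditioning \<P> \<longleftrightarrow>
     (\<forall>t s \<omega> P. 0 \<le> t \<and> t < s \<and> s \<le> T \<and> \<omega> \<in> Omega 0 \<and> P \<in> \<P> t \<omega> \<longrightarrow>
       (\<exists>Q P' \<Omega>'. is_rcpd t s P Q \<and>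
          space P' = Omega t \<and> sets (canon_filt t T) \<subseteq> sets P' \<and> prob_space P' \<and>
          (\<forall>A\<in>sets (canon_filt t T). emeasure P' A = emeasure P A) \<and>
          \<Omega>' \<in> sets P' \<and> emeasure P' \<Omega>' = 1 \<and>
          (\<forall>\<omega>'\<in>\<Omega>'. shift_prob t s Q \<omega>' \<in> \<P> s (paste 0 t \<omega> \<omega>'))))"

definition weakly_stable_pasting :: "('d::finite) process \<Rightarrow> 'd process \<Rightarrow> 'd process \<Rightarrow>
    (real \<Rightarrow> 'd path \<Rightarrow> 'd path measure set) \<Rightarrow> bool" where
  "weakly_stable_pasting g L U \<P> \<longleftrightarrow> (\<exists>\<rho>. modulus \<rho> \<and>
     (\<forall>t s \<omega> P \<delta> (l::nat) \<A> \<delta>' \<omega>' P'.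
        0 \<le> t \<and> t < s \<and> s \<le> T \<and> \<omega> \<in> Omega 0 \<and> P \<in> \<P> t \<omega> \<and> 0 < \<delta> \<and> \<delta> \<in> \<rat> \<and> 1 \<le> l \<and>
        (\<forall>j\<in>{0..l}. \<A> j \<in> sets (canon_filt t s)) \<and>
        disjoint_family_on \<A> {0..l} \<and> (\<Union>j\<in>{0..l}. \<A> j) = Omega t \<and>
        (\<forall>j\<in>{1..l}. \<delta>' j \<in> ({0<..\<delta>} \<inter> \<rat>) \<union> {\<delta>} \<and> \<omega>' j \<in> Omega t \<and>
           \<A> j \<subseteq> path_ball t s (\<delta>' j) (\<omega>' j) \<and> P' j \<in> \<P> s (paste 0 t \<omega> (\<omega>' j))) \<longrightarrow>
        (\<exists>Ph\<in>\<P> t \<omega>.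
           (\<forall>A\<in>sets (canon_filt t T). measure Ph (A \<inter> \<A> 0) = measure P (A \<inter> \<A> 0)) \<and>
           (\<forall>j\<in>{1..l}. \<forall>A\<in>sets (canon_filt t s).
              measure Ph (A \<inter> \<A> j) = measure P (A \<inter> \<A> j)) \<and>
           (\<forall>n::enat. \<forall>\<gamma>\<in>stops s. 1 \<le> n \<longrightarrow>
              (\<exists>\<gamma>'. (\<forall>j\<in>{1..l}. \<gamma>' j \<in> stops_from t s) \<and>
                (\<forall>A\<in>sets (canon_filt t s). \<forall>\<tau>\<in>dyadic_stops_from t s n.
                   (\<Sum>j=1..l. \<integral>x. indicator (A \<inter> \<A> j) x * payoff g L U t \<omega> \<tau> (\<gamma>' j) x \<partial>Ph)
                   \<le> (\<Sum>j=1..l. \<integral>x. indicator (A \<inter> \<A> j) x *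
                          ((SUP \<sigma>\<in>dyadic_stops s n.
                              \<integral>y. payoff g L U s (paste 0 t \<omega> x) \<sigma> \<gamma> y \<partial>P' j)
                           + (LBINT r:{t..s}. shift_proc g t \<omega> r x)) \<partial>P)
                     + \<rho> \<delta>))))))"

definition path_continuous_val :: "('d::finite) process \<Rightarrow> 'd process \<Rightarrow> 'd process \<Rightarrow>
    (real \<Rightarrow> 'd path \<Rightarrow> 'd path measure set) \<Rightarrow> (real \<Rightarrow> real) \<Rightarrow> bool" where
  "path_continuous_val g L U \<P> \<rho> \<longleftrightarrow>
     (\<forall>n::enat. 1 \<le> n \<longrightarrow> (\<forall>t\<in>{0..T}. \<forall>\<omega>1\<in>Omega 0. \<forall>\<omega>2\<in>Omega 0.
        \<bar>val g L U \<P> n t \<omega>1 - val g L U \<P> n t \<omega>2\<bar> \<le> \<rho> (supnorm 0 t (\<lambda>r. \<omega>1 r - \<omega>2 r))))"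

definition oscillation_bound :: "(real \<Rightarrow> ('d::finite) path \<Rightarrow> 'd path measure set) \<Rightarrow> (real \<Rightarrow> real) \<Rightarrow> bool" where
  "oscillation_bound \<P> \<rho> \<longleftrightarrow>
     (\<forall>\<alpha>>0. \<exists>\<rho>\<^sub>\<alpha>. modulus \<rho>\<^sub>\<alpha> \<and> (\<forall>t\<in>{0..<T}. \<forall>\<delta>\<in>{0<..T}.
        (SUP \<omega>\<in>path_ball 0 t \<alpha> null_path. SUP P\<in>\<P> t \<omega>. SUP \<zeta>\<in>stops t.
           \<integral>\<^sup>+x. ennreal (\<rho> (\<delta> + (SUP r\<in>{\<zeta> x..min (\<zeta> x + \<delta>) T}. norm (x r - x (\<zeta> x))))) \<partial>P)
        \<le> ennreal (\<rho>\<^sub>\<alpha> \<delta>)))"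

end

end

(* Both semicontinuity claims follow from one estimate, V_t <= V_s + eps for t < s close together,
   uniformly for a fixed path w.  Given near-optimal (P_1, gamma_1) for V_s(w), weak pasting glues
   P_1 onto any law in P(t,w), on the event that the canonical path stays close to w between t and
   s, and the stopper uses gamma_1 there and stops at s elsewhere.  The oscillation bound makes the
   probability of the remaining event small by Markov's inequality.  This needs the modulus to be
   positive off 0; otherwise g, L, U are constant and V is explicit.
   The reverse estimate V_s <= V_t + eps for n = infinity uses stability under conditioning: for
   given P and gamma, the conditional laws P^{s,w} admit replies worth almost V_s.  A countable
   family of stopping times, dense for all laws simultaneously, replaces a measurable selection of
   these replies.  Adaptedness in (2) holds because path-continuous functionals are limits of
   functions of finitely many coordinates, and |V| <= Psi gives integrability. *)

theory Submission
  imports Defs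
begin

section \<open>Raw filtration, supremum norm and moduli of continuity\<close>

subsection \<open>Path space\<close>

text \<open>The filtration is raw and the laws of the class need not share null sets, so stopping
  times and adapted processes must be right on every path. This shapes the lower estimate: the reply
  is the first good member of a countable family that is fixed before any law. Its least index is
  known at time s, hence constant on the paths charged by a conditional law, and the glued time is a
  genuine stopping time of the raw filtration. The estimates treat n differently. In the upper one
  the maximizer's time \<tau> is confined to the grid of n, but a stop before s can be postponed to
  T, a point of every grid. In the lower one the reply may have to stop at s, which the grid seen
  from t need not contain; this restricts it to n = infinity. In both, the random errors are bounded
  pointwise by multiples of one variable, \<rho>(2 \<eta> + sup norm of the path on [t,s]), whose
  mean the oscillation bound controls under all laws of the class at once. Markov's inequality too
  is used pointwise, which avoids computing probabilities under the unknown pasted law.\<close>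

lemma space_canon_filt [simp]: "space (canon_filt T t s) = Omega T t"
  unfolding canon_filt_def by (rule space_measure_of) auto

lemma sets_canon_filt:
  "sets (canon_filt T t s) = sigma_sets (Omega T t)
     {(\<lambda>\<omega>. \<omega> r) -` S \<inter> Omega T t | r S. r \<in> {t..s} \<inter> {t..T} \<and> S \<in> sets borel}"
  unfolding canon_filt_def by (rule sets_measure_of) auto

lemma sets_canon_filt_T:
  assumes "T \<le> s"
  shows "sets (canon_filt T t s :: ('d::finite) path measure) = sets (canon_filt T t T)"
proof -
  from assms have "{t..s} \<inter> {t..T} = {t..T} \<inter> {t..T}" by auto
  then show ?thesis unfolding sets_canon_filt by (simp only:)
qed

lemma sets_canon_filt_mono:
  assumes "u \<le> s"
  shows "sets (canon_filt T t u) \<subseteq> sets (canon_filt T t s)"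
  unfolding sets_canon_filt
proof (rule sigma_sets_mono', rule subsetI)
  fix A assume "A \<in> {(\<lambda>\<omega>. \<omega> r) -` S \<inter> Omega T t | r S. r \<in> {t..u} \<inter> {t..T} \<and> S \<in> sets borel}"
  then obtain r S where "A = (\<lambda>\<omega>. \<omega> r) -` S \<inter> Omega T t" "r \<in> {t..u} \<inter> {t..T}" "S \<in> sets borel"
    by auto
  moreover from this(2) \<open>u \<le> s\<close> have "r \<in> {t..s} \<inter> {t..T}" by auto
  ultimately show "A \<in> {(\<lambda>\<omega>. \<omega> r) -` S \<inter> Omega T t | r S. r \<in> {t..s} \<inter> {t..T} \<and> S \<in> sets borel}"
    by (intro CollectI exI[of _ r] exI[of _ S] conjI)
qed

lemma sets_canon_filt_le_T: "sets (canon_filt T t u :: ('d::finite) path measure) \<subseteq> sets (canon_filt T t T)"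
proof (cases "u \<le> T")
  case True
  then show ?thesis by (rule sets_canon_filt_mono)
next
  case False
  then show ?thesis by (intro eq_refl[OF sets_canon_filt_T]) simp
qed

lemma measurable_canon_filt_T:
  assumes "f \<in> canon_filt T t u \<rightarrow>\<^sub>M N"
  shows "f \<in> canon_filt T t T \<rightarrow>\<^sub>M N"
  using assms sets_canon_filt_le_T[of T t u]
  by (auto simp: measurable_def)

lemma measurable_coordinate:
  assumes "r \<in> {t..s}" "r \<in> {t..T}"
  shows "(\<lambda>\<omega>::('d::finite) path. \<omega> r) \<in> borel_measurable (canon_filt T t s)"
proof (rule measurableI)
  fix A :: "(real ^ 'd) set" assume "A \<in> sets borel"
  with assms have "(\<lambda>\<omega>::'d path. \<omega> r) -` A \<inter> Omega T t \<in> sets (canon_filt T t s)"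
    unfolding sets_canon_filt by (intro sigma_sets.Basic) auto
  then show "(\<lambda>\<omega>::'d path. \<omega> r) -` A \<inter> space (canon_filt T t s) \<in> sets (canon_filt T t s)" by simp
qed simp

lemma measurable_canon_filtI:
  fixes f :: "'a \<Rightarrow> ('d::finite) path"
  assumes "\<And>x. x \<in> space N \<Longrightarrow> f x \<in> Omega T t"
    and "\<And>r. r \<in> {t..s} \<Longrightarrow> r \<in> {t..T} \<Longrightarrow> (\<lambda>x. f x r) \<in> borel_measurable N"
  shows "f \<in> N \<rightarrow>\<^sub>M canon_filt T t s"
  unfolding canon_filt_def
proof (rule measurable_measure_of)
  fix A assume "A \<in> {(\<lambda>\<omega>::'d path. \<omega> r) -` S \<inter> Omega T t | r S. r \<in> {t..s} \<inter> {t..T} \<and> S \<in> sets borel}"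
  then obtain r S where r: "r \<in> {t..s}" "r \<in> {t..T}" "S \<in> sets borel"
    and A: "A = (\<lambda>\<omega>. \<omega> r) -` S \<inter> Omega T t" by auto
  have "f -` A \<inter> space N = (\<lambda>x. f x r) -` S \<inter> space N"
    using assms(1) A by auto
  then show "f -` A \<inter> space N \<in> sets N"
    using measurable_sets[OF assms(2)[OF r(1,2)] r(3)] by simp
qed (use assms in auto)

text \<open>True for the generators and preserved by complements and countable unions. Galmarino's
  test for stopping times (\<open>stops_cong_before\<close>) and the constancy of the chosen reply
  index under conditional laws rest on it.\<close>

lemma canon_filt_set_cong:
  assumes "A \<in> sets (canon_filt T t s)" "x \<in> Omega T t" "y \<in> Omega T t"
    and "\<And>r. r \<in> {t..s} \<Longrightarrow> r \<in> {t..T} \<Longrightarrow> x r = y r"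
  shows "x \<in> A \<longleftrightarrow> y \<in> A"
  using assms(1) unfolding sets_canon_filt
proof (induction rule: sigma_sets.induct)
  case (Basic a)
  then show ?case using assms(2-4) by auto
next
  case (Compl a)
  then show ?case using assms(2,3) by auto
qed auto

lemma Omega_continuous_on: "\<omega> \<in> Omega T t \<Longrightarrow> {a..b} \<subseteq> {t..T} \<Longrightarrow> continuous_on {a..b} \<omega>"
  by (auto simp: Omega_def intro: continuous_on_subset)

lemma Omega_start: "\<omega> \<in> Omega T t \<Longrightarrow> \<omega> t = 0"
  by (simp add: Omega_def)

lemma bdd_above_norm_path:
  "continuous_on {t..s} f \<Longrightarrow> bdd_above ((\<lambda>r. norm (f r)) ` {t..s::real})"
  by (intro bounded_imp_bdd_above compact_imp_bounded compact_continuous_image continuous_intros) auto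

lemma supnorm_ge:
  "continuous_on {t..s} f \<Longrightarrow> r \<in> {t..s} \<Longrightarrow> norm (f r) \<le> supnorm t s f"
  unfolding supnorm_def by (rule cSUP_upper[OF _ bdd_above_norm_path])

lemma supnorm_le:
  "t \<le> s \<Longrightarrow> (\<And>r. r \<in> {t..s} \<Longrightarrow> norm (f r) \<le> c) \<Longrightarrow> supnorm t s f \<le> c"
  unfolding supnorm_def by (rule cSUP_least) auto

lemma supnorm_nonneg:
  "t \<le> s \<Longrightarrow> continuous_on {t..s} f \<Longrightarrow> 0 \<le> supnorm t s f"
  by (rule order_trans[OF norm_ge_zero supnorm_ge[of t s f t]]) auto

lemma supnorm_cong:
  "(\<And>r. r \<in> {t..s} \<Longrightarrow> f r = f' r) \<Longrightarrow> supnorm t s f = supnorm t s f'"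
  unfolding supnorm_def by (intro SUP_cong) auto

lemma modulus_nonneg: "modulus \<rho> \<Longrightarrow> 0 \<le> x \<Longrightarrow> 0 \<le> \<rho> x"
  by (simp add: modulus_def)

lemma modulus_mono: "modulus \<rho> \<Longrightarrow> 0 \<le> x \<Longrightarrow> x \<le> y \<Longrightarrow> \<rho> x \<le> \<rho> y"
  by (auto simp: modulus_def mono_on_def)

lemma modulus_small:
  assumes "modulus \<rho>" "0 < e"
  obtains d where "0 < d" "\<And>x. 0 \<le> x \<Longrightarrow> x \<le> d \<Longrightarrow> \<rho> x < e"
proof -
  have "\<forall>\<^sub>F x in at_right 0. \<rho> x < e"
    using assms by (intro order_tendstoD(2)[of \<rho> 0]) (auto simp: modulus_def)
  then obtain b where b: "0 < b" "\<And>y. 0 < y \<Longrightarrow> y < b \<Longrightarrow> \<rho> y < e"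
    unfolding eventually_at_right_field by auto
  show ?thesis
  proof (rule that[of "b/2"])
    fix x assume "0 \<le> x" "x \<le> b/2"
    then have "\<rho> x \<le> \<rho> (b/2)" by (intro modulus_mono[OF assms(1)])
    also have "\<dots> < e" using b by auto
    finally show "\<rho> x < e" .
  qed (use b in auto)
qed

lemma modulus_compose_tendsto_0:
  assumes "modulus \<rho>" "f \<longlonglongrightarrow> (0::real)" "\<And>n::nat. 0 \<le> f n"
  shows "(\<lambda>n. \<rho> (f n)) \<longlonglongrightarrow> 0"
proof (rule LIMSEQ_I)
  fix e :: real assume "0 < e"
  then obtain d where d: "0 < d" "\<And>x. 0 \<le> x \<Longrightarrow> x \<le> d \<Longrightarrow> \<rho> x < e"
    using modulus_small[OF assms(1)] by blast
  obtain N where "\<And>n. n \<ge> N \<Longrightarrow> norm (f n - 0) < d"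
    using LIMSEQ_D[OF assms(2) d(1)] by blast
  then have "norm (\<rho> (f n) - 0) < e" if "n \<ge> N" for n
    using d(2)[of "f n"] assms(3)[of n] modulus_nonneg[OF assms(1), of "f n"] that by force
  then show "\<exists>N. \<forall>n\<ge>N. norm (\<rho> (f n) - 0) < e" by blast
qed

subsection \<open>Measurability of uniformly continuous path functionals\<close>

text \<open>A path is approximated by the Bernstein polynomial of its values at the points
  \<open>t + k (s - t) / n\<close>, rounded to multiples of \<open>1 / (n + 1)\<close>; the approximation depends on the
  path only through an element of a countable type.\<close>

definition quantize :: "real \<Rightarrow> real \<Rightarrow> nat \<Rightarrow> ('d::finite) path \<Rightarrow> (int ^ 'd) list" where
  "quantize t s n \<omega> = map (\<lambda>k. \<chi> j. \<lfloor>real (Suc n) * \<omega> (t + (k / n) * (s - t)) $ j\<rfloor>) [0..<Suc n]"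

text \<open>Freezing the polynomial after time s gives a path on all of [t,T] that uses no values
  beyond s.\<close>

definition reconstruct :: "real \<Rightarrow> real \<Rightarrow> real \<Rightarrow> nat \<Rightarrow> (int ^ 'd) list \<Rightarrow> ('d::finite) path" where
  "reconstruct T t s n l = (\<lambda>r\<in>{t..T}. \<chi> j. \<Sum>k\<le>n. of_int (l ! k $ j) / real (Suc n) * Bernstein n k ((min r s - t) / (s - t)))"

lemma measurable_quantize:
  assumes "t \<le> s" "s \<le> T"
  shows "quantize t s n \<in> canon_filt T t s \<rightarrow>\<^sub>M (count_space UNIV :: (int ^ 'd::finite) list measure)"
proof -
  have meas: "(\<lambda>\<omega>::'d path. \<lfloor>real (Suc n) * \<omega> (t + (real k / real n) * (s - t)) $ j\<rfloor>)
      \<in> canon_filt T t s \<rightarrow>\<^sub>M count_space UNIV" if "k < Suc n" for k j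
  proof -
    have 0: "0 \<le> real k / real n * (s - t)" using assms by simp
    \<comment> \<open>For n = 0 the quotient k / n is 0 by convention, so the sample point is t and
      stays in range.\<close>
    have "real k / real n * (s - t) \<le> 1 * (s - t)"
      using that assms by (intro mult_right_mono) (auto simp: divide_le_eq)
    with 0 have r: "t + (real k / real n) * (s - t) \<in> {t..s}" by auto
    have [measurable]: "(\<lambda>\<omega>::'d path. \<omega> (t + (real k / real n) * (s - t))) \<in> borel_measurable (canon_filt T t s)"
      using r assms by (intro measurable_coordinate) auto
    have [measurable]: "(\<lambda>\<omega>::'d path. \<omega> (t + (real k / real n) * (s - t)) $ j) \<in> borel_measurable (canon_filt T t s)"
      by (rule measurable_compose[where g="\<lambda>v. v $ j"])
        (use r assms in \<open>auto intro!: measurable_coordinate borel_measurable_continuous_onI continuous_intros\<close>)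
    show ?thesis by measurable
  qed
  show ?thesis
    unfolding measurable_count_space_eq2_countable
  proof (intro conjI ballI)
    fix l :: "(int ^ 'd) list"
    have "quantize t s n -` {l} \<inter> space (canon_filt T t s) =
      (if length l = Suc n then
        {\<omega>\<in>space (canon_filt T t s). \<forall>k\<in>{..<Suc n}. \<forall>j\<in>UNIV.
           \<lfloor>real (Suc n) * \<omega> (t + (real k / real n) * (s - t)) $ j\<rfloor> = l ! k $ j} else {})"
    proof -
      have "quantize t s n \<omega> = l \<longleftrightarrow> length l = Suc n \<and> (\<forall>k\<in>{..<Suc n}. \<forall>j\<in>UNIV.
           \<lfloor>real (Suc n) * \<omega> (t + (real k / real n) * (s - t)) $ j\<rfloor> = l ! k $ j)" for \<omega> :: "'d path"
        unfolding quantize_def list_eq_iff_nth_eq vec_eq_iff length_map length_upt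
        by (auto simp del: upt_Suc of_nat_Suc)
      then show ?thesis by auto
    qed
    also have "\<dots> \<in> sets (canon_filt T t s)"
    proof -
      have "Measurable.pred (canon_filt T t s) (\<lambda>\<omega>::'d path. \<forall>k\<in>{..<Suc n}. \<forall>j\<in>UNIV.
           \<lfloor>real (Suc n) * \<omega> (t + (real k / real n) * (s - t)) $ j\<rfloor> = l ! k $ j)"
        by (intro pred_intros_finite pred_eq_const1[where N="count_space UNIV"] meas) auto
      then show ?thesis unfolding Measurable.pred_def by (simp split: if_split del: of_nat_Suc)
    qed
    finally show "quantize t s n -` {l} \<inter> space (canon_filt T t s) \<in> sets (canon_filt T t s)" .
  qed auto
qed

lemma reconstruct_quantize_in_Omega:
  fixes x :: "('d::finite) path"
  assumes "t < s" "s \<le> T" "x \<in> Omega T t"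
  shows "reconstruct T t s n (quantize t s n x) \<in> Omega T t"
proof -
  \<comment> \<open>At the left end only k = 0 survives, and its coefficient is the rounded value of
    x at t, which is 0. So the approximation starts exactly at 0, as a canonical path must.\<close>
  have "(\<Sum>k\<le>n. of_int (quantize t s n x ! k $ j) / real (Suc n) * Bernstein n k 0) = 0" for j
  proof (intro sum.neutral ballI)
    fix k assume "k \<in> {..n}"
    then show "of_int (quantize t s n x ! k $ j) / real (Suc n) * Bernstein n k 0 = 0"
      using Omega_start[OF assms(3)]
      by (cases "k = 0") (auto simp: Bernstein_def quantize_def simp del: upt_Suc)
  qed
  then have "(\<chi> j. \<Sum>k\<le>n. of_int (quantize t s n x ! k $ j) / real (Suc n) * Bernstein n k 0) = 0"
    by (simp add: vec_eq_iff)
  moreover have "continuous_on {t..T} (\<lambda>r. \<chi> j. \<Sum>k\<le>n. of_int (quantize t s n x ! k $ j) / real (Suc n) *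
      Bernstein n k ((min r s - t) / (s - t)))"
    unfolding Bernstein_def using assms(1) by (intro continuous_intros) auto
  ultimately show ?thesis
    using assms(1,2) unfolding Omega_def reconstruct_def
    by (simp del: of_nat_Suc cong: continuous_on_cong_simp)
qed

lemma reconstruct_quantize_tendsto:
  fixes x :: "('d::finite) path"
  assumes "t < s" "s \<le> T" "x \<in> Omega T t"
  shows "(\<lambda>n. supnorm t s (\<lambda>r. x r - reconstruct T t s n (quantize t s n x) r)) \<longlonglongrightarrow> 0"
proof (rule LIMSEQ_I)
  fix e :: real assume e: "0 < e"
  let ?d = "real CARD('d)"
  have d: "?d > 0" by simp
  \<comment> \<open>Each coordinate is off by at most e' from the polynomial and e' from rounding.
    The l1 bound on the norm multiplies this by the dimension, which leaves e / 2.\<close>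
  define e' where "e' = e / (4 * ?d)"
  have e': "0 < e'" using e d by (simp add: e'_def)
  have "\<exists>N. \<forall>n u. N \<le> n \<and> u \<in> {0..1} \<longrightarrow>
      \<bar>x (t + u * (s - t)) $ j - (\<Sum>k\<le>n. x (t + (k / n) * (s - t)) $ j * Bernstein n k u)\<bar> < e'" for j
  proof (rule Bernstein_Weierstrass[OF _ e'])
    have "continuous_on {0..1} (\<lambda>u. x (t + u * (s - t)))"
    proof (rule continuous_on_compose2[OF Omega_continuous_on[OF assms(3), of t s]])
      show "(\<lambda>u. t + u * (s - t)) ` {0..1} \<subseteq> {t..s}"
      proof safe
        fix u :: real assume "u \<in> {0..1}"
        then have "u * (s - t) \<le> 1 * (s - t)" "0 \<le> u * (s - t)" using assms by (auto intro!: mult_right_mono)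
        then show "t + u * (s - t) \<in> {t..s}" by auto
      qed
    qed (use assms in \<open>auto intro!: continuous_intros\<close>)
    then show "continuous_on {0..1} (\<lambda>u. x (t + u * (s - t)) $ j)" by (intro continuous_intros)
  qed
  then have "\<exists>N. \<forall>j n u. N j \<le> n \<and> u \<in> {0..1} \<longrightarrow>
      \<bar>x (t + u * (s - t)) $ j - (\<Sum>k\<le>n. x (t + (k / n) * (s - t)) $ j * Bernstein n k u)\<bar> < e'"
    by (intro choice allI)
  then obtain N where N: "\<And>j n u. N j \<le> n \<Longrightarrow> u \<in> {0..1} \<Longrightarrow>
      \<bar>x (t + u * (s - t)) $ j - (\<Sum>k\<le>n. x (t + (k / n) * (s - t)) $ j * Bernstein n k u)\<bar> < e'"
    by blast
  obtain N' where N': "1 / e' < real N'" using reals_Archimedean2 by blast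
  have "norm (supnorm t s (\<lambda>r. x r - reconstruct T t s n (quantize t s n x) r) - 0) < e"
    if n: "n \<ge> max N' (Max (range N))" for n
  proof -
    have Nj: "N j \<le> n" for j using n Max_ge[of "range N" "N j"] by auto
    have n1: "1 / real (Suc n) < e'"
    proof -
      have "1 / e' < real (Suc n)" using N' n by linarith
      then show ?thesis using e' by (simp add: field_simps)
    qed
    have bd: "norm (x r - reconstruct T t s n (quantize t s n x) r) \<le> e / 2" if r: "r \<in> {t..s}" for r
    proof -
      define u where "u = (r - t) / (s - t)"
      have u: "u \<in> {0..1}" and ru: "r = t + u * (s - t)" using r assms by (auto simp: u_def divide_le_eq)
      have "\<bar>(x r - reconstruct T t s n (quantize t s n x) r) $ j\<bar> \<le> 2 * e'" for j
      proof -
        have 1: "reconstruct T t s n (quantize t s n x) r $ j =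
          (\<Sum>k\<le>n. of_int \<lfloor>real (Suc n) * x (t + (k / n) * (s - t)) $ j\<rfloor> / real (Suc n) * Bernstein n k u)"
          using r assms unfolding reconstruct_def quantize_def u_def
          by (auto simp: min_def simp del: upt_Suc intro!: sum.cong)
        have "\<bar>(\<Sum>k\<le>n. x (t + (k / n) * (s - t)) $ j * Bernstein n k u) -
             (\<Sum>k\<le>n. of_int \<lfloor>real (Suc n) * x (t + (k / n) * (s - t)) $ j\<rfloor> / real (Suc n) * Bernstein n k u)\<bar>
           \<le> (\<Sum>k\<le>n. \<bar>x (t + (k / n) * (s - t)) $ j - of_int \<lfloor>real (Suc n) * x (t + (k / n) * (s - t)) $ j\<rfloor> / real (Suc n)\<bar> * Bernstein n k u)"
          unfolding sum_subtractf[symmetric] left_diff_distrib[symmetric]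
          by (rule order_trans[OF sum_abs]) (use u in \<open>auto intro!: sum_mono simp: abs_mult Bernstein_nonneg\<close>)
        also have "\<dots> \<le> (\<Sum>k\<le>n. e' * Bernstein n k u)"
        proof (intro sum_mono mult_right_mono)
          fix k
          define y where "y = x (t + (real k / real n) * (s - t)) $ j"
          have f: "of_int \<lfloor>real (Suc n) * y\<rfloor> \<le> real (Suc n) * y" "real (Suc n) * y < of_int \<lfloor>real (Suc n) * y\<rfloor> + 1"
            by linarith+
          have eq: "y - of_int \<lfloor>real (Suc n) * y\<rfloor> / real (Suc n) = (real (Suc n) * y - of_int \<lfloor>real (Suc n) * y\<rfloor>) / real (Suc n)"
            by (simp add: field_simps)
          have "\<bar>y - of_int \<lfloor>real (Suc n) * y\<rfloor> / real (Suc n)\<bar> \<le> 1 / real (Suc n)"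
          proof -
            have "\<bar>real (Suc n) * y - of_int \<lfloor>real (Suc n) * y\<rfloor>\<bar> \<le> 1" using f by linarith
            then show ?thesis unfolding eq abs_divide abs_of_nat by (rule divide_right_mono) simp
          qed
          then show "\<bar>x (t + (real k / real n) * (s - t)) $ j - of_int \<lfloor>real (Suc n) * x (t + (real k / real n) * (s - t)) $ j\<rfloor> / real (Suc n)\<bar> \<le> e'"
            using n1 unfolding y_def by linarith
        qed (use u in \<open>auto simp: Bernstein_nonneg\<close>)
        also have "\<dots> = e'" by (simp add: sum_distrib_left[symmetric])
        finally show ?thesis
          using N[OF Nj[of j] u] unfolding vector_minus_component 1 ru[symmetric] by linarith
      qed
      then have "(\<Sum>j\<in>UNIV. \<bar>(x r - reconstruct T t s n (quantize t s n x) r) $ j\<bar>) \<le> (\<Sum>j\<in>(UNIV::'d set). 2 * e')"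
        by (intro sum_mono)
      also have "\<dots> = e / 2" using d by (simp add: e'_def)
      finally show ?thesis using norm_le_l1_cart order_trans by blast
    qed
    have "supnorm t s (\<lambda>r. x r - reconstruct T t s n (quantize t s n x) r) \<le> e / 2"
      using assms bd by (intro supnorm_le) auto
    moreover have "0 \<le> supnorm t s (\<lambda>r. x r - reconstruct T t s n (quantize t s n x) r)"
      using assms reconstruct_quantize_in_Omega[OF assms, of n]
      by (intro supnorm_nonneg continuous_intros) (auto intro!: Omega_continuous_on)
    ultimately show ?thesis using e by simp
  qed
  then show "\<exists>no. \<forall>n\<ge>no. norm (supnorm t s (\<lambda>r. x r - reconstruct T t s n (quantize t s n x) r) - 0) < e"
    by blast
qed

text \<open>For t < s the composition with \<open>quantize\<close> is measurable whatever F is,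
  because it factors through a countable discrete type; uniform continuity enters only in the limit.
  The interpolation divides by s - t, so t = s is separate: there all paths vanish at t and F is
  constant.\<close>

lemma path_functional_measurable:
  fixes F :: "('d::finite) path \<Rightarrow> real"
  assumes "t \<le> s" "s \<le> T" "modulus \<rho>"
    and F: "\<And>x y. x \<in> Omega T t \<Longrightarrow> y \<in> Omega T t \<Longrightarrow> \<bar>F x - F y\<bar> \<le> \<rho> (supnorm t s (\<lambda>r. x r - y r))"
  shows "F \<in> borel_measurable (canon_filt T t s)"
proof (cases "t = s")
  case True
  have eq: "F x = F y" if "x \<in> Omega T t" "y \<in> Omega T t" for x y
  proof -
    have "supnorm t s (\<lambda>r. x r - y r) = 0"
      using that unfolding True supnorm_def by (simp add: True Omega_start)
    moreover have "\<rho> 0 = 0" using assms(3) unfolding modulus_def by blast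
    ultimately show ?thesis using F[OF that] by simp
  qed
  have "F \<in> borel_measurable (canon_filt T t s)" if x0: "x0 \<in> Omega T t" for x0 :: "'d path"
  proof (subst measurable_cong)
    show "F x = F x0" if "x \<in> space (canon_filt T t s)" for x
      using that x0 by (intro eq) simp_all
  qed simp
  moreover have "F \<in> borel_measurable (canon_filt T t s)" if "Omega T t = ({} :: 'd path set)"
    using that by (simp add: measurable_def)
  ultimately show ?thesis by blast
next
  case False
  then have ts: "t < s" using assms by simp
  show ?thesis
  proof (rule borel_measurable_LIMSEQ_real)
    show "(\<lambda>x. F (reconstruct T t s n (quantize t s n x))) \<in> borel_measurable (canon_filt T t s)" for n
      by (rule measurable_compose[OF measurable_quantize[OF assms(1,2), of n],
        where g="\<lambda>l. F (reconstruct T t s n l)"]) simp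
    fix x :: "'d path" assume "x \<in> space (canon_filt T t s)"
    then have x: "x \<in> Omega T t" by simp
    have *: "reconstruct T t s n (quantize t s n x) \<in> Omega T t" for n
      by (rule reconstruct_quantize_in_Omega[OF ts assms(2) x])
    have lim: "(\<lambda>n. \<rho> (supnorm t s (\<lambda>r. x r - reconstruct T t s n (quantize t s n x) r))) \<longlonglongrightarrow> 0"
    proof (rule modulus_compose_tendsto_0[OF assms(3) reconstruct_quantize_tendsto[OF ts assms(2) x]])
      show "0 \<le> supnorm t s (\<lambda>r. x r - reconstruct T t s n (quantize t s n x) r)" for n
        using assms x *[of n] by (intro supnorm_nonneg continuous_on_diff) (auto intro!: Omega_continuous_on)
    qed
    have "norm (F (reconstruct T t s n (quantize t s n x)) - F x)
        \<le> \<rho> (supnorm t s (\<lambda>r. x r - reconstruct T t s n (quantize t s n x) r))" for n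
      using F[OF x *[of n]] by (simp add: abs_minus_commute)
    then have "\<forall>\<^sub>F n in sequentially. norm (F (reconstruct T t s n (quantize t s n x)) - F x)
        \<le> \<rho> (supnorm t s (\<lambda>r. x r - reconstruct T t s n (quantize t s n x) r))"
      by (rule always_eventually[OF allI])
    from Lim_null_comparison[OF this lim]
    show "(\<lambda>n. F (reconstruct T t s n (quantize t s n x))) \<longlonglongrightarrow> F x"
      by (rule LIM_zero_cancel)
  qed
qed

subsection \<open>Continuous processes at random times\<close>

text \<open>Rounding down anticipates and so does not produce stopping times. It serves only to
  prove measurability and to supply countable dense sets of times; stopping times are rounded up by
  \<open>grid_above\<close>.\<close>

definition clamp_grid :: "real \<Rightarrow> real \<Rightarrow> nat \<Rightarrow> int \<Rightarrow> real" where
  "clamp_grid t T n i = max t (min T (of_int i / real (Suc n)))"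

lemma clamp_grid_mem: "t \<le> T \<Longrightarrow> clamp_grid t T n i \<in> {t..T}"
  by (auto simp: clamp_grid_def)

lemma clamp_grid_tendsto:
  assumes "a \<in> {t..T}"
  shows "(\<lambda>n. clamp_grid t T n \<lfloor>real (Suc n) * a\<rfloor>) \<longlonglongrightarrow> a"
proof -
  have lim: "(\<lambda>n. of_int \<lfloor>real (Suc n) * a\<rfloor> / real (Suc n)) \<longlonglongrightarrow> a"
  proof (rule LIM_zero_cancel, rule Lim_null_comparison[OF always_eventually LIMSEQ_inverse_real_of_nat], rule allI)
    fix n
    have "\<bar>of_int \<lfloor>real (Suc n) * a\<rfloor> - real (Suc n) * a\<bar> \<le> 1" by linarith
    then have "\<bar>of_int \<lfloor>real (Suc n) * a\<rfloor> - real (Suc n) * a\<bar> / \<bar>real (Suc n)\<bar> \<le> 1 / \<bar>real (Suc n)\<bar>"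
      by (rule divide_right_mono) simp
    then show "norm (of_int \<lfloor>real (Suc n) * a\<rfloor> / real (Suc n) - a) \<le> inverse (real (Suc n))"
      unfolding abs_divide[symmetric] by (simp add: diff_divide_distrib inverse_eq_divide del: of_nat_Suc)
  qed
  have "(\<lambda>n. max t (min T (of_int \<lfloor>real (Suc n) * a\<rfloor> / real (Suc n)))) \<longlonglongrightarrow> max t (min T a)"
    by (intro tendsto_max tendsto_min tendsto_const lim)
  moreover have "max t (min T a) = a" using assms by auto
  ultimately show ?thesis unfolding clamp_grid_def by simp
qed

lemma process_clamp_grid_tendsto:
  fixes f :: "real \<Rightarrow> real"
  assumes "continuous_on {t..T} f" "a \<in> {t..T}"
  shows "(\<lambda>n. f (clamp_grid t T n \<lfloor>real (Suc n) * a\<rfloor>)) \<longlonglongrightarrow> f a"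
proof (rule continuous_on_tendsto_compose[OF assms(1) clamp_grid_tendsto[OF assms(2)] assms(2)])
  have "t \<le> T" using assms(2) by auto
  then show "\<forall>\<^sub>F n in sequentially. clamp_grid t T n \<lfloor>real (Suc n) * a\<rfloor> \<in> {t..T}"
    by (intro always_eventually allI clamp_grid_mem)
qed

lemma measurable_process_at:
  fixes X :: "real \<Rightarrow> 'a \<Rightarrow> real"
  assumes X: "\<And>s. s \<in> {t..T} \<Longrightarrow> X s \<in> borel_measurable M"
    and cont: "\<And>x. x \<in> space M \<Longrightarrow> continuous_on {t..T} (\<lambda>s. X s x)"
    and \<tau>: "\<tau> \<in> borel_measurable M" "\<And>x. x \<in> space M \<Longrightarrow> \<tau> x \<in> {t..T}" and "t \<le> T"
  shows "(\<lambda>x. X (\<tau> x) x) \<in> borel_measurable M"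
proof (rule borel_measurable_LIMSEQ_real)
  show "(\<lambda>x. X (clamp_grid t T n \<lfloor>real (Suc n) * \<tau> x\<rfloor>) x) \<in> borel_measurable M" for n
  proof (rule measurable_compose_countable[where f="\<lambda>i x. X (clamp_grid t T n i) x"])
    show "(\<lambda>x. \<lfloor>real (Suc n) * \<tau> x\<rfloor>) \<in> M \<rightarrow>\<^sub>M count_space UNIV" using \<tau>(1) by measurable
  qed (use X clamp_grid_mem[OF \<open>t \<le> T\<close>] in auto)
  show "(\<lambda>n. X (clamp_grid t T n \<lfloor>real (Suc n) * \<tau> x\<rfloor>) x) \<longlonglongrightarrow> X (\<tau> x) x" if "x \<in> space M" for x
    using process_clamp_grid_tendsto[OF cont[OF that] \<tau>(2)[OF that]] .
qed

lemma measurable_process_integral: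
  fixes X :: "real \<Rightarrow> 'a \<Rightarrow> real"
  assumes X: "\<And>s. s \<in> {t..T} \<Longrightarrow> X s \<in> borel_measurable M"
    and cont: "\<And>x. x \<in> space M \<Longrightarrow> continuous_on {t..T} (\<lambda>s. X s x)"
    and \<tau>: "\<tau> \<in> borel_measurable M" "\<And>x. x \<in> space M \<Longrightarrow> \<tau> x \<in> {t..T}" and "t \<le> T"
  shows "(\<lambda>x. LBINT s:{t..\<tau> x}. X s x) \<in> borel_measurable M"
proof -
  \<comment> \<open>Joint measurability is the preceding lemma on the product with Lebesgue measure:
    the second coordinate acts as the random time, clamped into [t,T].\<close>
  have 1: "(\<lambda>p. X (max t (min T (snd p))) (fst p)) \<in> borel_measurable (M \<Otimes>\<^sub>M lborel)"
  proof (rule measurable_process_at[where X="\<lambda>s p. X s (fst p)"])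
    show "(\<lambda>p. X s (fst p)) \<in> borel_measurable (M \<Otimes>\<^sub>M lborel)" if "s \<in> {t..T}" for s
      using X[OF that] by measurable
  qed (use cont \<open>t \<le> T\<close> in \<open>auto simp: space_pair_measure\<close>)
  have 2: "Measurable.pred (M \<Otimes>\<^sub>M lborel) (\<lambda>p. t \<le> snd p \<and> snd p \<le> \<tau> (fst p))"
    using \<tau>(1) by measurable
  have "(\<lambda>x. \<integral>s. (if t \<le> s \<and> s \<le> \<tau> x then X (max t (min T s)) x else 0) \<partial>lborel) \<in> borel_measurable M"
    by (rule lborel.borel_measurable_lebesgue_integral)
       (use measurable_If[OF 1 borel_measurable_const[of 0] 2[unfolded Measurable.pred_def]] in \<open>simp add: split_beta'\<close>)
  moreover have "(\<integral>s. (if t \<le> s \<and> s \<le> \<tau> x then X (max t (min T s)) x else 0) \<partial>lborel) = (LBINT s:{t..\<tau> x}. X s x)"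
    if "x \<in> space M" for x
    unfolding set_lebesgue_integral_def using \<tau>(2)[OF that]
    by (intro Bochner_Integration.integral_cong) (auto simp: indicator_def)
  ultimately show ?thesis by (simp cong: measurable_cong)
qed

lemma measurable_process_SUP:
  fixes X :: "real \<Rightarrow> 'a \<Rightarrow> real"
  assumes X: "\<And>s. s \<in> {t..T} \<Longrightarrow> X s \<in> borel_measurable M"
    and cont: "\<And>x. x \<in> space M \<Longrightarrow> continuous_on {t..T} (\<lambda>s. X s x)" and "t \<le> T"
  shows "(\<lambda>x. SUP s\<in>{t..T}. X s x) \<in> borel_measurable M"
proof -
  \<comment> \<open>The grid points of all levels are a countable dense set of times, which
    determines the supremum of a continuous path.\<close>
  define D where "D = range (\<lambda>(n, i). clamp_grid t T n i)"
  have D: "countable D" "D \<subseteq> {t..T}" "D \<noteq> {}"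
    using clamp_grid_mem[OF \<open>t \<le> T\<close>] by (auto simp: D_def)
  have bdd: "bdd_above ((\<lambda>s. X s x) ` {t..T})" if "x \<in> space M" for x
    by (intro bounded_imp_bdd_above compact_imp_bounded compact_continuous_image cont that) auto
  have bddD: "bdd_above ((\<lambda>s. X s x) ` D)" if "x \<in> space M" for x
    by (rule bdd_above_mono[OF bdd[OF that]]) (use D in auto)
  have "(SUP s\<in>{t..T}. X s x) = (SUP s\<in>D. X s x)" if x: "x \<in> space M" for x
  proof (rule antisym)
    show "(SUP s\<in>{t..T}. X s x) \<le> (SUP s\<in>D. X s x)"
    proof (rule cSUP_least)
      fix s assume "s \<in> {t..T}"
      then show "X s x \<le> (SUP s\<in>D. X s x)"
        by (intro LIMSEQ_le_const2[OF process_clamp_grid_tendsto[OF cont[OF x]]])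
           (auto simp: D_def simp del: of_nat_Suc intro!: exI[of _ 0] cSUP_upper bddD[OF x, unfolded D_def])
    qed (use \<open>t \<le> T\<close> in auto)
    show "(SUP s\<in>D. X s x) \<le> (SUP s\<in>{t..T}. X s x)"
      by (rule cSUP_subset_mono[OF D(3) bdd[OF x] D(2)]) simp
  qed
  moreover have "(\<lambda>x. SUP s\<in>D. X s x) \<in> borel_measurable M"
    using D X bddD by (intro borel_measurable_cSUP) auto
  ultimately show ?thesis by (simp cong: measurable_cong)
qed

subsection \<open>Pasting and its inverse\<close>

lemma paste_in_Omega:
  assumes "t \<le> s" "s \<le> T" "x \<in> Omega T t" "y \<in> Omega T s"
  shows "paste T t s x y \<in> Omega T t"
proof -
  have "continuous_on ({t..s} \<union> {s..T}) (\<lambda>r. if r \<le> s then x r else x s + y r)"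
  proof (rule continuous_on_cases)
    show "continuous_on {t..s} x" using assms by (intro Omega_continuous_on) auto
    show "continuous_on {s..T} (\<lambda>r. x s + y r)" using assms by (intro continuous_intros Omega_continuous_on) auto
  qed (use assms in \<open>auto simp: Omega_start\<close>)
  moreover have "{t..s} \<union> {s..T} = {t..T}" using assms by auto
  ultimately have "continuous_on {t..T} (\<lambda>r. if r \<le> s then x r else x s + y r)" by simp
  then have "continuous_on {t..T} (paste T t s x y)"
    by (rule continuous_on_cong[THEN iffD1, rotated -1]) (use assms in \<open>auto simp: paste_def Omega_start\<close>)
  moreover have "paste T t s x y t = 0"
    using assms Omega_start[of x T t] Omega_start[of y T s] by (auto simp: paste_def)
  ultimately show ?thesis by (auto simp: Omega_def paste_def)
qed

lemma paste_assoc: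
  assumes "a \<le> t" "t \<le> s" "s \<le> T"
  shows "paste T a s (paste T a t \<omega> x) y = paste T a t \<omega> (paste T t s x y)"
  using assms by (auto simp: paste_def fun_eq_iff)

text \<open>Subtracting the value at s makes this a left inverse of pasting at s, whatever the first
  part was.\<close>

definition tail :: "real \<Rightarrow> real \<Rightarrow> ('d::finite) path \<Rightarrow> 'd path" where
  "tail T s z = (\<lambda>r\<in>{s..T}. z r - z s)"

lemma tail_in_Omega:
  assumes "t \<le> s" "s \<le> T" "z \<in> Omega T t"
  shows "tail T s z \<in> Omega T s"
proof -
  have "continuous_on {s..T} (\<lambda>r. z r - z s)" using assms by (intro continuous_intros Omega_continuous_on) auto
  then have "continuous_on {s..T} (tail T s z)"
    by (rule continuous_on_cong[THEN iffD1, rotated -1]) (auto simp: tail_def)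
  then show ?thesis using assms by (auto simp: Omega_def tail_def)
qed

lemma tail_paste:
  assumes "t \<le> s" "s \<le> T" "y \<in> Omega T s"
  shows "tail T s (paste T t s x y) = y"
  using assms by (auto simp: tail_def paste_def fun_eq_iff Omega_def extensional_def)

lemma paste_tail:
  assumes "t \<le> s" "s \<le> T" "z \<in> Omega T t" "\<And>r. r \<in> {t..s} \<Longrightarrow> z r = x r"
  shows "paste T t s x (tail T s z) = z"
  using assms by (auto simp: tail_def paste_def fun_eq_iff Omega_def extensional_def)

lemma paste_eq_left:
  assumes "t \<le> s" "s \<le> T" "y \<in> Omega T s" "r \<in> {t..s}"
  shows "paste T t s x y r = x r"
  using assms Omega_start[of y T s] by (auto simp: paste_def)

text \<open>These are the paths that no event of time s can tell from x. The identity turns the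
  concentration of an r.c.p.d. on pasted paths into agreement with x up to s.\<close>

lemma paste_image_eq:
  assumes "t \<le> s" "s \<le> T" "x \<in> Omega T t"
  shows "paste T t s x ` Omega T s = {z\<in>Omega T t. \<forall>r\<in>{t..s}. z r = x r}" (is "?A = ?B")
proof
  show "?A \<subseteq> ?B" using assms by (auto simp: paste_in_Omega paste_eq_left)
  show "?B \<subseteq> ?A"
  proof
    fix z assume z: "z \<in> ?B"
    then have "z = paste T t s x (tail T s z)" using assms by (intro paste_tail[symmetric]) auto
    moreover have "tail T s z \<in> Omega T s" using z assms by (intro tail_in_Omega) auto
    ultimately show "z \<in> ?A" by (rule image_eqI)
  qed
qed

lemma measurable_paste:
  assumes "t \<le> s" "s \<le> T" "x \<in> Omega T t"
  shows "paste T t s x \<in> canon_filt T s u \<rightarrow>\<^sub>M canon_filt T t u"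
proof (rule measurable_canon_filtI)
  show "paste T t s x y \<in> Omega T t" if "y \<in> space (canon_filt T s u)" for y
    using assms that by (intro paste_in_Omega) auto
  show "(\<lambda>y. paste T t s x y r) \<in> borel_measurable (canon_filt T s u)" if r: "r \<in> {t..u}" "r \<in> {t..T}" for r
  proof (cases "r < s")
    case False
    then have "(\<lambda>y. x s + y r) \<in> borel_measurable (canon_filt T s u)"
      using r by (intro borel_measurable_add borel_measurable_const measurable_coordinate) auto
    then show ?thesis using False r by (simp add: paste_def)
  qed (use r in \<open>simp add: paste_def\<close>)
qed

lemma measurable_tail:
  assumes "t \<le> s" "s \<le> u" "s \<le> T"
  shows "tail T s \<in> canon_filt T t u \<rightarrow>\<^sub>M canon_filt T s u"
proof (rule measurable_canon_filtI)
  show "tail T s z \<in> Omega T s" if "z \<in> space (canon_filt T t u)" for z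
    using assms that by (intro tail_in_Omega[of t]) auto
  show "(\<lambda>z. tail T s z r) \<in> borel_measurable (canon_filt T t u)" if r: "r \<in> {s..u}" "r \<in> {s..T}" for r
  proof -
    have "(\<lambda>z. z r - z s) \<in> borel_measurable (canon_filt T t u)"
      using r assms by (intro borel_measurable_diff measurable_coordinate) auto
    then show ?thesis using r by (simp add: tail_def)
  qed
qed

subsection \<open>Stopping times\<close>

lemma stops_range: "\<tau> \<in> stops T t \<Longrightarrow> x \<in> Omega T t \<Longrightarrow> \<tau> x \<in> {t..T}"
  by (auto simp: stops_def)

lemma stops_sets: "\<tau> \<in> stops T t \<Longrightarrow> {x\<in>Omega T t. \<tau> x \<le> u} \<in> sets (canon_filt T t u)"
  by (auto simp: stops_def stopping_time_def Measurable.pred_def)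

text \<open>\<open>stopping_time\<close> quantifies over all real u, but below t the event is empty
  and from T on it is the whole space.\<close>

lemma stopsI:
  assumes "\<And>x. x \<in> Omega T t \<Longrightarrow> \<tau> x \<in> {t..T}"
    and "\<And>u. u \<in> {t..<T} \<Longrightarrow> {x\<in>Omega T t. \<tau> x \<le> u} \<in> sets (canon_filt T t u)"
  shows "\<tau> \<in> stops T t"
proof -
  have "{x\<in>Omega T t. \<tau> x \<le> u} \<in> sets (canon_filt T t u)" for u
  proof -
    consider "u < t" | "T \<le> u" | "u \<in> {t..<T}" by fastforce
    then show ?thesis
    proof cases
      case 1
      then have "{x\<in>Omega T t. \<tau> x \<le> u} = {}" using assms(1) by force
      then show ?thesis by (simp only: sets.empty_sets)
    next
      case 2
      then have "{x\<in>Omega T t. \<tau> x \<le> u} = space (canon_filt T t u)" using assms(1) by force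
      then show ?thesis by (metis sets.top)
    qed (rule assms(2))
  qed
  then show ?thesis using assms(1) by (auto simp: stops_def stopping_time_def Measurable.pred_def)
qed

lemma stops_measurable: "\<tau> \<in> stops T t \<Longrightarrow> \<tau> \<in> borel_measurable (canon_filt T t T)"
  unfolding stops_def using sets_canon_filt_le_T
  by (auto intro!: measurable_stopping_time[of "canon_filt T t"])

lemma stops_sets_less:
  assumes "\<tau> \<in> stops T t"
  shows "{x\<in>Omega T t. \<tau> x < u} \<in> sets (canon_filt T t u)"
proof -
  have "{x\<in>Omega T t. \<tau> x \<le> u - 1 / real (Suc n)} \<in> sets (canon_filt T t u)" for n
    using stops_sets[OF assms, of "u - 1 / real (Suc n)"] sets_canon_filt_mono[of "u - 1 / real (Suc n)" u T t]
    by (auto simp del: of_nat_Suc)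
  then have "(\<Union>n. {x\<in>Omega T t. \<tau> x \<le> u - 1 / real (Suc n)}) \<in> sets (canon_filt T t u)" by blast
  moreover have "(\<Union>n. {x\<in>Omega T t. \<tau> x \<le> u - 1 / real (Suc n)}) = {x\<in>Omega T t. \<tau> x < u}"
  proof -
    have "\<exists>n. a \<le> u - 1 / real (Suc n)" if "a < u" for a
    proof -
      from that have "0 < u - a" by simp
      then obtain n where "inverse (real (Suc n)) < u - a" by (rule reals_Archimedean[THEN exE])
      then show ?thesis by (intro exI[of _ n]) (simp add: inverse_eq_divide del: of_nat_Suc)
    qed
    moreover have "a < u" if "a \<le> u - 1 / real (Suc n)" for a n
      using that by (smt (verit) divide_pos_pos of_nat_0_less_iff zero_less_Suc)
    ultimately show ?thesis by blast
  qed
  ultimately show ?thesis by simp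
qed

lemma const_in_stops: "t \<le> c \<Longrightarrow> c \<le> T \<Longrightarrow> (\<lambda>_. c) \<in> stops T t"
  by (auto simp: stops_def stopping_time_const)

text \<open>The points t (i = 0) and T (i = 2^m) belong to every grid. They provide the immediate
  and the latest stop for all n at once.\<close>

lemma const_in_dyadic_stops:
  assumes "0 < T" "t \<in> {0..T}" "c = t \<or> c = T"
  shows "(\<lambda>_. c) \<in> dyadic_stops T t n"
proof (cases n)
  case (enat m)
  have "t = max t (real 0 * T / 2 ^ m)" using assms by simp
  moreover have "T = max t (real (2 ^ m) * T / 2 ^ m)" using assms by simp
  ultimately have "c \<in> (\<lambda>i. max t (real i * T / 2 ^ m)) ` {0..2 ^ m}"
    using assms(3) by (elim disjE, intro image_eqI[of _ _ 0]; simp) (intro image_eqI[of _ _ "2 ^ m"]; simp)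
  then show ?thesis using assms enat const_in_stops[of t c T] by (auto simp: dyadic_stops_def)
qed (use assms const_in_stops[of t c T] in \<open>auto simp: dyadic_stops_def\<close>)

lemma dyadic_stops_subset: "\<tau> \<in> dyadic_stops T t n \<Longrightarrow> \<tau> \<in> stops T t"
  by (auto simp: dyadic_stops_def split: enat.splits)

subsection \<open>Payoffs\<close>

lemma set_integral_abs_le:
  fixes f :: "real \<Rightarrow> real"
  assumes "a \<le> b" "continuous_on {a..b} f" "\<And>s. s \<in> {a..b} \<Longrightarrow> \<bar>f s\<bar> \<le> c"
  shows "\<bar>LBINT s:{a..b}. f s\<bar> \<le> (b - a) * c"
proof -
  have f: "set_integrable lborel {a..b} f" by (rule borel_integrable_atLeastAtMost'[OF assms(2)])
  have c: "set_integrable lborel {a..b} (\<lambda>_. k)" for k :: real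
    by (rule borel_integrable_atLeastAtMost') simp
  have k: "(LBINT s:{a..b}. k) = (b - a) * k" for k :: real
    using assms(1) by (simp add: set_lebesgue_integral_def)
  have "(LBINT s:{a..b}. f s) \<le> (LBINT s:{a..b}. c)"
    by (rule set_integral_mono[OF f c]) (use assms(3) abs_le_iff in blast)
  moreover have "(LBINT s:{a..b}. - c) \<le> (LBINT s:{a..b}. f s)"
    by (rule set_integral_mono[OF c f]) (use assms(3) abs_le_iff in \<open>force simp: abs_le_iff\<close>)
  ultimately show ?thesis unfolding k by (simp add: abs_le_iff)
qed

lemma set_integral_split_Icc:
  fixes f :: "real \<Rightarrow> real"
  assumes "a \<le> b" "b \<le> c" "continuous_on {a..c} f"
  shows "(LBINT s:{a..c}. f s) = (LBINT s:{a..b}. f s) + (LBINT s:{b..c}. f s)"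
proof -
  have f: "set_integrable lborel {a..c} f" by (rule borel_integrable_atLeastAtMost'[OF assms(3)])
  have sub: "set_integrable lborel {a..b} f" "set_integrable lborel {b..c} f"
    using assms by (auto intro!: set_integrable_subset[OF f])
  show ?thesis
    unfolding set_borel_integral_eq_integral(2)[OF f] sub[THEN set_borel_integral_eq_integral(2)]
    by (rule Henstock_Kurzweil_Integration.integral_combine[symmetric, OF assms(1,2)
          set_borel_integral_eq_integral(1)[OF f]])
qed

lemma null_path_in_Omega: "null_path T \<in> Omega T 0" if "0 \<le> T"
proof -
  have "continuous_on {0..T} (null_path T :: ('d::finite) path)"
    by (rule continuous_on_cong[THEN iffD1, OF refl _ continuous_on_const[of _ 0]]) (simp add: null_path_def)
  then show "(null_path T :: ('d::finite) path) \<in> Omega T 0" using that by (auto simp: Omega_def null_path_def)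
qed

section \<open>Regularity, measurability and integrable majorants of the payoffs\<close>

locale payoff_processes =
  fixes T :: real and g L U :: "('d::finite) process" and \<rho>\<^sub>0 :: "real \<Rightarrow> real"
  assumes T_pos: "0 < T" and regular: "payoff_regular T g L U \<rho>\<^sub>0"
begin

lemma L_le_U: "t \<in> {0..T} \<Longrightarrow> \<omega> \<in> Omega T 0 \<Longrightarrow> L t \<omega> \<le> U t \<omega>"
  using regular by (simp add: payoff_regular_def)

lemma modulus0: "modulus \<rho>\<^sub>0"
  using regular by (simp add: payoff_regular_def)

lemma regularity:
  assumes X: "X \<in> {g, L, U, Psi L U}" and t: "t1 \<in> {0..T}" "t2 \<in> {0..T}"
    and w: "\<omega>1 \<in> Omega T 0" "\<omega>2 \<in> Omega T 0" and c: "\<bar>t1 - t2\<bar> + c \<le> c'"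
    and le: "\<And>v. v \<in> {0..T} \<Longrightarrow> norm (\<omega>1 (min v t1) - \<omega>2 (min v t2)) \<le> c"
  shows "\<bar>X t1 \<omega>1 - X t2 \<omega>2\<bar> \<le> \<rho>\<^sub>0 c'"
proof -
  have cont: "continuous_on {0..T} (\<lambda>v. \<omega> (min v t))" if "\<omega> \<in> Omega T 0" "t \<in> {0..T}" for \<omega> :: "'d path" and t
    by (rule continuous_on_compose2[OF Omega_continuous_on[OF that(1) order_refl]])
      (use that T_pos in \<open>auto intro!: continuous_intros\<close>)
  have "supnorm 0 T (\<lambda>r. \<omega>1 (min r t1) - \<omega>2 (min r t2)) \<le> c"
    using T_pos le by (intro supnorm_le) auto
  moreover have "0 \<le> supnorm 0 T (\<lambda>r. \<omega>1 (min r t1) - \<omega>2 (min r t2))"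
    using T_pos t w by (intro supnorm_nonneg continuous_intros cont) auto
  ultimately have *: "\<rho>\<^sub>0 (\<bar>t1 - t2\<bar> + supnorm 0 T (\<lambda>r. \<omega>1 (min r t1) - \<omega>2 (min r t2))) \<le> \<rho>\<^sub>0 c'"
    using c by (intro modulus_mono[OF modulus0]) auto
  have main: "\<bar>X t1 \<omega>1 - X t2 \<omega>2\<bar> \<le> \<rho>\<^sub>0 c'" if "X \<in> {g, L, U}" for X
    using regular that t w * unfolding payoff_regular_def by (blast intro: order_trans)
  show ?thesis
  proof (cases "X \<in> {g, L, U}")
    case False
    then have "X = Psi L U" using X by blast
    \<comment> \<open>The maximum is nonexpansive, so \<open>Psi\<close> inherits the bound from L
      and U.\<close>
    then show ?thesis using main[of L] main[of U] unfolding Psi_def by (simp add: abs_le_iff max_def)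
  qed (rule main)
qed

lemma process_continuous:
  assumes X: "X \<in> {g, L, U, Psi L U}" and w: "\<omega> \<in> Omega T 0"
  shows "continuous_on {0..T} (\<lambda>s. X s \<omega>)"
  unfolding continuous_on_iff
proof (intro ballI allI impI)
  fix s e :: real assume s: "s \<in> {0..T}" and "0 < e"
  then obtain d where d: "0 < d" "\<And>x. 0 \<le> x \<Longrightarrow> x \<le> d \<Longrightarrow> \<rho>\<^sub>0 x < e"
    using modulus_small[OF modulus0] by blast
  have "uniformly_continuous_on {0..T} \<omega>"
    by (intro compact_uniformly_continuous Omega_continuous_on[OF w]) auto
  \<comment> \<open>The argument d of the modulus is shared: half for the displacement in time, half
    for the oscillation of the path.\<close>
  then obtain h where h: "0 < h" "\<And>x x'. x \<in> {0..T} \<Longrightarrow> x' \<in> {0..T} \<Longrightarrow> dist x' x < h \<Longrightarrow> dist (\<omega> x') (\<omega> x) < d / 2"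
    using d(1) unfolding uniformly_continuous_on_def by (meson half_gt_zero)
  have "dist (X s' \<omega>) (X s \<omega>) < e" if s': "s' \<in> {0..T}" "dist s' s < min h (d/2)" for s'
  proof -
    have "\<bar>X s' \<omega> - X s \<omega>\<bar> \<le> \<rho>\<^sub>0 d"
    proof (rule regularity[OF X s'(1) s w w])
      show "\<bar>s' - s\<bar> + d / 2 \<le> d" using s' by (simp add: dist_real_def)
      show "norm (\<omega> (min v s') - \<omega> (min v s)) \<le> d / 2" if "v \<in> {0..T}" for v
      proof -
        have "dist s' s < h" using s' by simp
        then have "dist (min v s') (min v s) < h" using h(1) by (auto simp: dist_real_def min_def)
        then have "dist (\<omega> (min v s')) (\<omega> (min v s)) < d / 2" using that s s' by (intro h(2)) auto
        then show ?thesis by (simp add: dist_norm)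
      qed
    qed
    also have "\<dots> < e" using d by simp
    finally show ?thesis by (simp add: dist_real_def)
  qed
  moreover have "0 < min h (d/2)" using h d by simp
  ultimately show "\<exists>d>0. \<forall>x'\<in>{0..T}. dist x' s < d \<longrightarrow> dist (X x' \<omega>) (X s \<omega>) < e" by blast
qed

text \<open>After t the two pasted paths differ by the constant difference of the prefixes at t, so
  their distance never exceeds that of the prefixes.\<close>

lemma shift_regular:
  assumes X: "X \<in> {g, L, U, Psi L U}" and t: "t \<in> {0..T}" "s \<in> {t..T}"
    and w: "\<omega>1 \<in> Omega T 0" "\<omega>2 \<in> Omega T 0" "x \<in> Omega T t"
  shows "\<bar>shift_proc T X t \<omega>1 s x - shift_proc T X t \<omega>2 s x\<bar> \<le> \<rho>\<^sub>0 (supnorm 0 t (\<lambda>r. \<omega>1 r - \<omega>2 r))"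
  unfolding shift_proc_def
proof (rule regularity[OF X])
  show "norm (paste T 0 t \<omega>1 x (min v s) - paste T 0 t \<omega>2 x (min v s)) \<le> supnorm 0 t (\<lambda>r. \<omega>1 r - \<omega>2 r)"
    if "v \<in> {0..T}" for v
  proof -
    have "norm (\<omega>1 r - \<omega>2 r) \<le> supnorm 0 t (\<lambda>r. \<omega>1 r - \<omega>2 r)" if "r \<in> {0..t}" for r
      using that t w by (intro supnorm_ge[of 0 t "\<lambda>r. \<omega>1 r - \<omega>2 r"] continuous_intros Omega_continuous_on) auto
    from this[of "min v s"] this[of t] show ?thesis using that t by (auto simp: paste_def min_def)
  qed
qed (use t w in \<open>auto intro!: paste_in_Omega\<close>)

lemma shift_regular_path:
  assumes X: "X \<in> {g, L, U, Psi L U}" and t: "t \<in> {0..T}" "s \<in> {t..T}"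
    and w: "\<omega> \<in> Omega T 0" "x \<in> Omega T t" "y \<in> Omega T t"
  shows "\<bar>shift_proc T X t \<omega> s x - shift_proc T X t \<omega> s y\<bar> \<le> \<rho>\<^sub>0 (supnorm t s (\<lambda>r. x r - y r))"
  unfolding shift_proc_def
proof (rule regularity[OF X])
  show "norm (paste T 0 t \<omega> x (min v s) - paste T 0 t \<omega> y (min v s)) \<le> supnorm t s (\<lambda>r. x r - y r)"
    if "v \<in> {0..T}" for v
  proof -
    have "norm (x r - y r) \<le> supnorm t s (\<lambda>r. x r - y r)" if "r \<in> {t..s}" for r
      using that t w by (intro supnorm_ge[of t s "\<lambda>r. x r - y r"] continuous_on_diff Omega_continuous_on[OF w(2)] Omega_continuous_on[OF w(3)]) auto
    from this[of "min v s"] order_trans[OF norm_ge_zero this[of t]] show ?thesis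
      using that t by (auto simp: paste_def min_def)
  qed
qed (use t w in \<open>auto intro!: paste_in_Omega\<close>)

lemma shift_measurable:
  assumes "X \<in> {g, L, U, Psi L U}" "t \<in> {0..T}" "s \<in> {t..T}" "\<omega> \<in> Omega T 0"
  shows "shift_proc T X t \<omega> s \<in> borel_measurable (canon_filt T t s)"
  using assms by (intro path_functional_measurable[OF _ _ modulus0 shift_regular_path]) auto

lemma shift_continuous:
  assumes X: "X \<in> {g, L, U, Psi L U}" and t: "t \<in> {0..T}" and w: "\<omega> \<in> Omega T 0" "x \<in> Omega T t"
    and ab: "{a..b} \<subseteq> {t..T}"
  shows "continuous_on {a..b} (\<lambda>s. shift_proc T X t \<omega> s x)"
  unfolding shift_proc_def using assms
  by (intro continuous_on_subset[OF process_continuous[OF X]] paste_in_Omega) auto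

text \<open>Payoff regularity compares stopped paths and therefore contains non-anticipation: equal
  stopped paths are at distance 0, where the modulus vanishes.\<close>

lemma process_cong:
  assumes X: "X \<in> {g, L, U, Psi L U}" and t: "t \<in> {0..T}"
    and w: "\<omega>1 \<in> Omega T 0" "\<omega>2 \<in> Omega T 0" "\<And>r. r \<in> {0..t} \<Longrightarrow> \<omega>1 r = \<omega>2 r"
  shows "X t \<omega>1 = X t \<omega>2"
proof -
  have "\<bar>X t \<omega>1 - X t \<omega>2\<bar> \<le> \<rho>\<^sub>0 0"
    by (rule regularity[OF X t t w(1,2), of 0]) (use t w(3) in auto)
  then show ?thesis using modulus0 by (simp add: modulus_def)
qed

lemma shift_start:
  assumes X: "X \<in> {g, L, U, Psi L U}" and t: "t \<in> {0..T}" and w: "\<omega> \<in> Omega T 0" "x \<in> Omega T t"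
  shows "shift_proc T X t \<omega> t x = X t \<omega>"
  unfolding shift_proc_def using t w
  by (intro process_cong[OF X]) (auto intro!: paste_in_Omega paste_eq_left)

lemma shift_Psi:
  assumes t: "t \<in> {0..T}" "s \<in> {t..T}" and w: "\<omega> \<in> Omega T 0" "x \<in> Omega T t"
  shows "\<bar>shift_proc T L t \<omega> s x\<bar> \<le> shift_proc T (Psi L U) t \<omega> s x"
    and "\<bar>shift_proc T U t \<omega> s x\<bar> \<le> shift_proc T (Psi L U) t \<omega> s x"
proof -
  have "paste T 0 t \<omega> x \<in> Omega T 0" using t w by (intro paste_in_Omega) auto
  then have "L s (paste T 0 t \<omega> x) \<le> U s (paste T 0 t \<omega> x)" using t by (intro L_le_U) auto
  then show "\<bar>shift_proc T L t \<omega> s x\<bar> \<le> shift_proc T (Psi L U) t \<omega> s x"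
    "\<bar>shift_proc T U t \<omega> s x\<bar> \<le> shift_proc T (Psi L U) t \<omega> s x"
    unfolding shift_proc_def Psi_def by auto
qed

text \<open>One majorant of the payoff for all pairs of stopping times. It also serves later as the
  weight under which stopping times are approximated.\<close>

definition dominator :: "real \<Rightarrow> 'd path \<Rightarrow> 'd path \<Rightarrow> real" where
  "dominator t \<omega> x = (LBINT s:{t..T}. \<bar>shift_proc T g t \<omega> s x\<bar>) + (SUP s\<in>{t..T}. \<bar>shift_proc T (Psi L U) t \<omega> s x\<bar>)"

lemma
  assumes t: "t \<in> {0..T}" and w: "\<omega> \<in> Omega T 0"
  shows measurable_integral_abs_g: "(\<lambda>x. LBINT s:{t..T}. \<bar>shift_proc T g t \<omega> s x\<bar>) \<in> borel_measurable (canon_filt T t T)"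
    and measurable_SUP_Psi: "(\<lambda>x. SUP s\<in>{t..T}. \<bar>shift_proc T (Psi L U) t \<omega> s x\<bar>) \<in> borel_measurable (canon_filt T t T)"
proof -
  have meas: "(\<lambda>x. \<bar>shift_proc T X t \<omega> s x\<bar>) \<in> borel_measurable (canon_filt T t T)"
    if "X \<in> {g, L, U, Psi L U}" "s \<in> {t..T}" for X s
    by (intro borel_measurable_abs measurable_canon_filt_T[OF shift_measurable[OF that(1) t that(2) w]])
  have cont: "continuous_on {t..T} (\<lambda>s. \<bar>shift_proc T X t \<omega> s x\<bar>)"
    if "X \<in> {g, L, U, Psi L U}" "x \<in> space (canon_filt T t T)" for X x
    using that by (intro continuous_on_rabs shift_continuous[OF _ t w]) auto
  show "(\<lambda>x. LBINT s:{t..T}. \<bar>shift_proc T g t \<omega> s x\<bar>) \<in> borel_measurable (canon_filt T t T)"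
    using t by (intro measurable_process_integral[where T=T] meas cont) auto
  show "(\<lambda>x. SUP s\<in>{t..T}. \<bar>shift_proc T (Psi L U) t \<omega> s x\<bar>) \<in> borel_measurable (canon_filt T t T)"
    using t by (intro measurable_process_SUP[where T=T] meas cont) auto
qed

lemma hat_probsD:
  assumes "P \<in> hat_probs T g L U t"
  shows "prob_space P" "sets P = sets (canon_filt T t T)" "space P = Omega T t"
proof -
  have "P \<in> space (prob_algebra (canon_filt T t T))" using assms by (simp add: hat_probs_def)
  then show "prob_space P" "sets P = sets (canon_filt T t T)" by (auto simp: space_prob_algebra)
  then show "space P = Omega T t" by (simp add: sets_eq_imp_space_eq)
qed

lemma SUP_shift_Psi_upper:
  assumes t: "t \<in> {0..T}" and w: "\<omega> \<in> Omega T 0" "x \<in> Omega T t" and s: "s \<in> {t..T}"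
  shows "\<bar>shift_proc T (Psi L U) t \<omega> s x\<bar> \<le> (SUP s\<in>{t..T}. \<bar>shift_proc T (Psi L U) t \<omega> s x\<bar>)"
  using bdd_above_norm_path[OF shift_continuous[OF _ t w order_refl, of "Psi L U"]] s
  by (intro cSUP_upper) auto

text \<open>\<open>hat_probs\<close> speaks of the null prefix only. Another prefix changes the
  process by at most a constant, which a probability integrates.\<close>

lemma integrable_SUP_Psi:
  assumes t: "t \<in> {0..T}" and w: "\<omega> \<in> Omega T 0" and P: "P \<in> hat_probs T g L U t"
  shows "integrable P (\<lambda>x. SUP s\<in>{t..T}. \<bar>shift_proc T (Psi L U) t \<omega> s x\<bar>)"
proof -
  interpret prob_space P by (rule hat_probsD[OF P])
  note [measurable_cong] = hat_probsD(2)[OF P]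
  have n: "null_path T \<in> Omega T 0" using T_pos by (intro null_path_in_Omega) simp
  let ?c = "\<rho>\<^sub>0 (supnorm 0 t (\<lambda>r. \<omega> r - null_path T r))"
  let ?S = "\<lambda>\<omega> x. SUP s\<in>{t..T}. \<bar>shift_proc T (Psi L U) t \<omega> s x\<bar>"
  have "integrable P (?S (null_path T))" using P by (simp add: hat_probs_def S_space_def)
  then have "integrable P (\<lambda>x. ?S (null_path T) x + ?c)" by simp
  then show ?thesis
  proof (rule Bochner_Integration.integrable_bound)
    show "?S \<omega> \<in> borel_measurable P" using measurable_SUP_Psi[OF t w] by simp
    have "?S \<omega> x \<le> ?S (null_path T) x + ?c \<and> 0 \<le> ?S \<omega> x" if x: "x \<in> Omega T t" for x
    proof
      show "?S \<omega> x \<le> ?S (null_path T) x + ?c"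
      proof (rule cSUP_least)
        fix s assume s: "s \<in> {t..T}"
        show "\<bar>shift_proc T (Psi L U) t \<omega> s x\<bar> \<le> ?S (null_path T) x + ?c"
          using SUP_shift_Psi_upper[OF t n x s] shift_regular[OF _ t s w n x, of "Psi L U"] by simp
      qed (use t in auto)
      show "0 \<le> ?S \<omega> x"
        using SUP_shift_Psi_upper[OF t w x, of t] t by (auto intro: order_trans[OF abs_ge_zero])
    qed
    then have "norm (?S \<omega> x) \<le> norm (?S (null_path T) x + ?c)" if "x \<in> space P" for x
      using that hat_probsD(3)[OF P] by fastforce
    then show "AE x in P. norm (?S \<omega> x) \<le> norm (?S (null_path T) x + ?c)" by (rule AE_I2)
  qed
qed

lemma integrable_abs_g:
  assumes t: "t \<in> {0..T}" and w: "\<omega> \<in> Omega T 0" and P: "P \<in> hat_probs T g L U t"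
  shows "integrable P (\<lambda>x. LBINT s:{t..T}. \<bar>shift_proc T g t \<omega> s x\<bar>)"
proof -
  interpret prob_space P by (rule hat_probsD[OF P])
  note [measurable_cong] = hat_probsD(2)[OF P]
  have n: "null_path T \<in> Omega T 0" using T_pos by (intro null_path_in_Omega) simp
  let ?c = "\<rho>\<^sub>0 (supnorm 0 t (\<lambda>r. \<omega> r - null_path T r))"
  let ?G = "\<lambda>\<omega> x. LBINT s:{t..T}. \<bar>shift_proc T g t \<omega> s x\<bar>"
  have si: "set_integrable lborel {t..T} (\<lambda>s. \<bar>shift_proc T g t \<omega> s x\<bar>)"
    if "\<omega> \<in> Omega T 0" "x \<in> Omega T t" for \<omega> x
    using that by (intro borel_integrable_atLeastAtMost' continuous_on_rabs shift_continuous[OF _ t]) auto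
  have nonneg: "0 \<le> ?G \<omega> x" for \<omega> x
    unfolding set_lebesgue_integral_def by (rule Bochner_Integration.integral_nonneg) simp
  have nn: "(\<integral>\<^sup>+s\<in>{t..T}. ennreal \<bar>shift_proc T g t \<omega> s x\<bar> \<partial>lborel) = ennreal (?G \<omega> x)"
    if "\<omega> \<in> Omega T 0" "x \<in> Omega T t" for \<omega> x
    by (subst nn_integral_eq_integral[symmetric, OF si[OF that, unfolded set_integrable_def], folded set_lebesgue_integral_def])
      (auto intro!: nn_integral_cong simp: indicator_def)
  have "(\<integral>\<^sup>+x. ennreal (norm (?G (null_path T) x)) \<partial>P) = (\<integral>\<^sup>+x. (\<integral>\<^sup>+s\<in>{t..T}. ennreal \<bar>shift_proc T g t (null_path T) s x\<bar> \<partial>lborel) \<partial>P)"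
    using nn[OF n] nonneg hat_probsD(3)[OF P] by (intro nn_integral_cong) simp
  also have "\<dots> < \<infinity>" using P by (simp add: hat_probs_def)
  finally have "integrable P (?G (null_path T))"
    using measurable_integral_abs_g[OF t n] by (intro integrableI_bounded) auto
  then have "integrable P (\<lambda>x. ?G (null_path T) x + (T - t) * ?c)" by simp
  then show ?thesis
  proof (rule Bochner_Integration.integrable_bound)
    show "?G \<omega> \<in> borel_measurable P" using measurable_integral_abs_g[OF t w] by simp
    have "?G \<omega> x \<le> ?G (null_path T) x + (T - t) * ?c" if x: "x \<in> Omega T t" for x
    proof -
      have cint: "set_integrable lborel {t..T} (\<lambda>s. ?c)" by (rule borel_integrable_atLeastAtMost') simp
      have "?G \<omega> x \<le> (LBINT s:{t..T}. \<bar>shift_proc T g t (null_path T) s x\<bar> + ?c)"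
      proof (rule set_integral_mono[OF si[OF w x] set_integral_add(1)[OF si[OF n x] cint]])
        fix s assume "s \<in> {t..T}"
        from shift_regular[OF _ t this w n x, of g]
        show "\<bar>shift_proc T g t \<omega> s x\<bar> \<le> \<bar>shift_proc T g t (null_path T) s x\<bar> + ?c" by simp
      qed
      also have "\<dots> = ?G (null_path T) x + (LBINT s:{t..T}. ?c)"
        by (rule set_integral_add(2)[OF si[OF n x] cint])
      also have "(LBINT s:{t..T}. ?c) = (T - t) * ?c"
        using t by (simp add: set_lebesgue_integral_def)
      finally show ?thesis .
    qed
    then have "norm (?G \<omega> x) \<le> norm (?G (null_path T) x + (T - t) * ?c)" if "x \<in> space P" for x
      using that hat_probsD(3)[OF P] nonneg[of \<omega> x] by fastforce
    then show "AE x in P. norm (?G \<omega> x) \<le> norm (?G (null_path T) x + (T - t) * ?c)" by (rule AE_I2)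
  qed
qed

lemma integrable_dominator:
  assumes "t \<in> {0..T}" "\<omega> \<in> Omega T 0" "P \<in> hat_probs T g L U t"
  shows "integrable P (dominator t \<omega>)"
  unfolding dominator_def using assms by (intro Bochner_Integration.integrable_add integrable_SUP_Psi integrable_abs_g)

lemma payoff_measurable:
  assumes t: "t \<in> {0..T}" and w: "\<omega> \<in> Omega T 0" and st: "\<tau> \<in> stops T t" "\<gamma> \<in> stops T t"
  shows "payoff T g L U t \<omega> \<tau> \<gamma> \<in> borel_measurable (canon_filt T t T)"
proof -
  note [measurable] = st[THEN stops_measurable]
  have rng: "\<tau> x \<in> {t..T}" "\<gamma> x \<in> {t..T}" if "x \<in> space (canon_filt T t T)" for x
    using stops_range[OF st(1)] stops_range[OF st(2)] that by auto
  have meas: "shift_proc T X t \<omega> s \<in> borel_measurable (canon_filt T t T)"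
    if "X \<in> {g, L, U, Psi L U}" "s \<in> {t..T}" for X s
    by (rule measurable_canon_filt_T[OF shift_measurable[OF that(1) t that(2) w]])
  have cont: "continuous_on {t..T} (\<lambda>s. shift_proc T X t \<omega> s x)"
    if "X \<in> {g, L, U, Psi L U}" "x \<in> space (canon_filt T t T)" for X x
    using that by (intro shift_continuous[OF _ t w]) auto
  have "(\<lambda>x. LBINT s:{t..min (\<tau> x) (\<gamma> x)}. shift_proc T g t \<omega> s x) \<in> borel_measurable (canon_filt T t T)"
    by (rule measurable_process_integral[where T=T]) (use t meas cont rng in \<open>auto simp: min_def\<close>)
  moreover have "(\<lambda>x. shift_proc T L t \<omega> (\<tau> x) x) \<in> borel_measurable (canon_filt T t T)"
    by (rule measurable_process_at[where T=T and t=t]) (use t meas cont rng in auto)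
  moreover have "(\<lambda>x. shift_proc T U t \<omega> (\<gamma> x) x) \<in> borel_measurable (canon_filt T t T)"
    by (rule measurable_process_at[where T=T and t=t]) (use t meas cont rng in auto)
  ultimately show ?thesis unfolding payoff_def by measurable
qed

lemma payoff_abs_le:
  assumes t: "t \<in> {0..T}" and w: "\<omega> \<in> Omega T 0" "x \<in> Omega T t" and r: "\<tau> x \<in> {t..T}" "\<gamma> x \<in> {t..T}"
  shows "\<bar>payoff T g L U t \<omega> \<tau> \<gamma> x\<bar> \<le> dominator t \<omega> x"
proof -
  have si: "set_integrable lborel {t..T} (\<lambda>s. \<bar>shift_proc T g t \<omega> s x\<bar>)"
    using w by (intro borel_integrable_atLeastAtMost' continuous_on_rabs shift_continuous[OF _ t]) auto
  have si': "set_integrable lborel {t..min (\<tau> x) (\<gamma> x)} (\<lambda>s. shift_proc T g t \<omega> s x)"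
    using w r by (intro borel_integrable_atLeastAtMost' shift_continuous[OF _ t]) auto
  have "\<bar>LBINT s:{t..min (\<tau> x) (\<gamma> x)}. shift_proc T g t \<omega> s x\<bar> \<le> (LBINT s:{t..min (\<tau> x) (\<gamma> x)}. \<bar>shift_proc T g t \<omega> s x\<bar>)"
    using set_integral_norm_bound[OF si'] by simp
  also have "\<dots> \<le> (LBINT s:{t..T}. \<bar>shift_proc T g t \<omega> s x\<bar>)"
    using set_integrable_abs[OF si'] si r unfolding set_lebesgue_integral_def set_integrable_def
    by (intro integral_mono) (auto simp: indicator_def)
  finally have 1: "\<bar>LBINT s:{t..min (\<tau> x) (\<gamma> x)}. shift_proc T g t \<omega> s x\<bar> \<le> (LBINT s:{t..T}. \<bar>shift_proc T g t \<omega> s x\<bar>)" .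
  have "\<bar>shift_proc T L t \<omega> (\<tau> x) x\<bar> \<le> (SUP s\<in>{t..T}. \<bar>shift_proc T (Psi L U) t \<omega> s x\<bar>)"
    using shift_Psi(1)[OF t r(1) w] SUP_shift_Psi_upper[OF t w r(1)] by linarith
  moreover have "\<bar>shift_proc T U t \<omega> (\<gamma> x) x\<bar> \<le> (SUP s\<in>{t..T}. \<bar>shift_proc T (Psi L U) t \<omega> s x\<bar>)"
    using shift_Psi(2)[OF t r(2) w] SUP_shift_Psi_upper[OF t w r(2)] by linarith
  ultimately show ?thesis using 1 unfolding payoff_def dominator_def by (auto split: if_splits)
qed

text \<open>The stopping times do not depend on the prefix, so both payoffs take the same branch.
  The terminal term contributes the 1, the running term at most the horizon T.\<close>

lemma payoff_regular_shift:
  assumes t: "t \<in> {0..T}" and w: "\<omega>1 \<in> Omega T 0" "\<omega>2 \<in> Omega T 0" "x \<in> Omega T t"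
    and r: "\<tau> x \<in> {t..T}" "\<gamma> x \<in> {t..T}"
  shows "\<bar>payoff T g L U t \<omega>1 \<tau> \<gamma> x - payoff T g L U t \<omega>2 \<tau> \<gamma> x\<bar>
    \<le> (1 + T) * \<rho>\<^sub>0 (supnorm 0 t (\<lambda>r. \<omega>1 r - \<omega>2 r))"
proof -
  let ?m = "min (\<tau> x) (\<gamma> x)" and ?c = "\<rho>\<^sub>0 (supnorm 0 t (\<lambda>r. \<omega>1 r - \<omega>2 r))"
  have c: "0 \<le> ?c" using t w
    by (intro modulus_nonneg[OF modulus0] supnorm_nonneg continuous_intros Omega_continuous_on) auto
  have si: "set_integrable lborel {t..?m} (\<lambda>s. shift_proc T g t \<omega> s x)" if "\<omega> \<in> Omega T 0" for \<omega>
    using w r that by (intro borel_integrable_atLeastAtMost' shift_continuous[OF _ t]) auto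
  have "\<bar>LBINT s:{t..?m}. shift_proc T g t \<omega>1 s x - shift_proc T g t \<omega>2 s x\<bar> \<le> (?m - t) * ?c"
  proof (rule set_integral_abs_le)
    show "\<bar>shift_proc T g t \<omega>1 s x - shift_proc T g t \<omega>2 s x\<bar> \<le> ?c" if "s \<in> {t..?m}" for s
      using that r by (intro shift_regular[OF _ t _ w]) auto
  qed (use r w in \<open>auto intro!: continuous_on_diff shift_continuous[OF _ t]\<close>)
  also have "\<dots> \<le> T * ?c" using r t c by (intro mult_right_mono) auto
  also have "(LBINT s:{t..?m}. shift_proc T g t \<omega>1 s x - shift_proc T g t \<omega>2 s x) =
     (LBINT s:{t..?m}. shift_proc T g t \<omega>1 s x) - (LBINT s:{t..?m}. shift_proc T g t \<omega>2 s x)"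
    by (rule set_integral_diff(2)[OF si[OF w(1)] si[OF w(2)]])
  finally have 1: "\<bar>(LBINT s:{t..?m}. shift_proc T g t \<omega>1 s x) - (LBINT s:{t..?m}. shift_proc T g t \<omega>2 s x)\<bar> \<le> T * ?c" .
  have 2: "\<bar>shift_proc T X t \<omega>1 s x - shift_proc T X t \<omega>2 s x\<bar> \<le> ?c" if "X \<in> {g, L, U, Psi L U}" "s \<in> {t..T}" for X s
    by (rule shift_regular[OF that(1) t that(2) w])
  show ?thesis using 1 2[of L "\<tau> x"] 2[of U "\<gamma> x"] r unfolding payoff_def by (simp add: algebra_simps) linarith
qed

lemma integrable_payoff:
  assumes t: "t \<in> {0..T}" and w: "\<omega> \<in> Omega T 0" and P: "P \<in> hat_probs T g L U t"
    and st: "\<tau> \<in> stops T t" "\<gamma> \<in> stops T t"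
  shows "integrable P (payoff T g L U t \<omega> \<tau> \<gamma>)"
    and "\<bar>\<integral>x. payoff T g L U t \<omega> \<tau> \<gamma> x \<partial>P\<bar> \<le> (\<integral>x. dominator t \<omega> x \<partial>P)"
proof -
  note [measurable_cong] = hat_probsD(2)[OF P]
  have le: "\<bar>payoff T g L U t \<omega> \<tau> \<gamma> x\<bar> \<le> dominator t \<omega> x" if "x \<in> space P" for x
    using that hat_probsD(3)[OF P] stops_range[OF st(1)] stops_range[OF st(2)]
    by (intro payoff_abs_le[OF t w]) auto
  show int: "integrable P (payoff T g L U t \<omega> \<tau> \<gamma>)"
  proof (rule Bochner_Integration.integrable_bound[OF integrable_dominator[OF t w P]])
    show "payoff T g L U t \<omega> \<tau> \<gamma> \<in> borel_measurable P" using payoff_measurable[OF t w st] by simp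
    show "AE x in P. norm (payoff T g L U t \<omega> \<tau> \<gamma> x) \<le> norm (dominator t \<omega> x)"
      by (rule AE_I2) (use le in fastforce)
  qed
  have "\<bar>\<integral>x. payoff T g L U t \<omega> \<tau> \<gamma> x \<partial>P\<bar> \<le> (\<integral>x. \<bar>payoff T g L U t \<omega> \<tau> \<gamma> x\<bar> \<partial>P)"
    using integral_norm_bound[of P "payoff T g L U t \<omega> \<tau> \<gamma>"] by simp
  also have "\<dots> \<le> (\<integral>x. dominator t \<omega> x \<partial>P)"
    by (intro integral_mono integrable_abs int integrable_dominator[OF t w P] le)
  finally show "\<bar>\<integral>x. payoff T g L U t \<omega> \<tau> \<gamma> x \<partial>P\<bar> \<le> (\<integral>x. dominator t \<omega> x \<partial>P)" .
qed

end

lemma set_integral_singleton: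
  fixes f :: "real \<Rightarrow> real"
  shows "(LBINT s:{a}. f s) = 0"
  using set_integral_abs_le[of a a f "\<bar>f a\<bar>"] by simp

text \<open>By the triangle inequality the distance to w is 1-Lipschitz for the supremum norm, so
  the criterion for path functionals applies with the identity as modulus.\<close>

lemma measurable_supnorm_diff:
  assumes "t \<le> s" "s \<le> T" and w: "continuous_on {t..s} w"
  shows "(\<lambda>x. supnorm t s (\<lambda>r. x r - w r)) \<in> borel_measurable (canon_filt T t s :: ('d::finite) path measure)"
proof (rule path_functional_measurable[OF assms(1,2), where \<rho>="\<lambda>x. x"])
  show "modulus (\<lambda>x. x)" by (simp add: modulus_def mono_on_def)
  have *: "supnorm t s (\<lambda>r. x r - w r) \<le> supnorm t s (\<lambda>r. y r - w r) + supnorm t s (\<lambda>r. x r - y r)"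
    if "x \<in> Omega T t" "y \<in> Omega T t" for x y :: "'d path"
  proof (rule supnorm_le[OF assms(1)])
    fix r assume r: "r \<in> {t..s}"
    have c: "continuous_on {t..s} x" "continuous_on {t..s} y"
      using assms by (auto intro!: Omega_continuous_on[OF that(1)] Omega_continuous_on[OF that(2)])
    have "norm (x r - w r) \<le> norm (y r - w r) + norm (x r - y r)"
      using norm_triangle_ineq[of "y r - w r" "x r - y r"] by simp
    also have "\<dots> \<le> supnorm t s (\<lambda>r. y r - w r) + supnorm t s (\<lambda>r. x r - y r)"
      using r c w by (intro add_mono supnorm_ge[of t s "\<lambda>r. x r - y r"] supnorm_ge[of t s "\<lambda>r. y r - w r"] continuous_on_diff)
    finally show "norm (x r - w r) \<le> supnorm t s (\<lambda>r. y r - w r) + supnorm t s (\<lambda>r. x r - y r)" .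
  qed
  show "\<bar>supnorm t s (\<lambda>r. x r - w r) - supnorm t s (\<lambda>r. y r - w r)\<bar> \<le> supnorm t s (\<lambda>r. x r - y r)"
    if "x \<in> Omega T t" "y \<in> Omega T t" for x y :: "'d path"
  proof -
    have "supnorm t s (\<lambda>r. y r - x r) = supnorm t s (\<lambda>r. x r - y r)"
      by (simp add: supnorm_def norm_minus_commute)
    then show ?thesis using *[OF that] *[OF that(2,1)] by (simp add: abs_le_iff)
  qed
qed

lemma measurable_supnorm:
  assumes "t \<le> s" "s \<le> T"
  shows "supnorm t s \<in> borel_measurable (canon_filt T t s :: ('d::finite) path measure)"
  using measurable_supnorm_diff[OF assms continuous_on_const[of _ 0]] by simp

lemma path_ball_sets:
  assumes "t \<le> s" "s \<le> T" "w \<in> Omega T t"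
  shows "path_ball T t s \<delta> w \<in> sets (canon_filt T t s)"
proof -
  have "continuous_on {t..s} w" using assms by (intro Omega_continuous_on[OF assms(3)]) auto
  from measurable_sets[OF measurable_supnorm_diff[OF assms(1,2) this], of "{..<\<delta>}"]
  show ?thesis by (simp add: path_ball_def vimage_def Int_def conj_commute)
qed

text \<open>A modulus is monotone on the nonnegative half-line only; composing it with max 0 gives a
  function monotone on all reals, hence Borel.\<close>

lemma measurable_modulus:
  assumes "modulus \<rho>" "f \<in> borel_measurable M" "\<And>x. x \<in> space M \<Longrightarrow> 0 \<le> f x"
  shows "(\<lambda>x. \<rho> (f x)) \<in> borel_measurable M"
proof -
  have "mono (\<lambda>x. \<rho> (max 0 x))"
    by (intro monoI modulus_mono[OF assms(1)]) auto
  then have "(\<lambda>x. \<rho> (max 0 x)) \<in> borel_measurable borel" by (rule borel_measurable_mono)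
  from measurable_compose[OF assms(2) this] have "(\<lambda>x. \<rho> (max 0 (f x))) \<in> borel_measurable M" .
  moreover have "\<rho> (max 0 (f x)) = \<rho> (f x)" if "x \<in> space M" for x
    using assms(3)[OF that] by (simp add: max_def)
  ultimately show ?thesis by (subst (asm) measurable_cong)
qed

lemma measurable_modulus_supnorm:
  assumes "modulus \<rho>" "t \<le> s" "s \<le> T" "0 \<le> c"
  shows "(\<lambda>x. \<rho> (c + supnorm t s x)) \<in> borel_measurable (canon_filt T t s :: ('d::finite) path measure)"
proof (rule measurable_modulus[OF assms(1)])
  show "(\<lambda>x. c + supnorm t s x) \<in> borel_measurable (canon_filt T t s :: 'd path measure)"
    by (intro borel_measurable_add borel_measurable_const measurable_supnorm assms)
  show "0 \<le> c + supnorm t s x" if "x \<in> space (canon_filt T t s)" for x :: "'d path"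
    using assms that by (intro add_nonneg_nonneg supnorm_nonneg Omega_continuous_on[where t=t]) auto
qed

section \<open>Elementary bounds for the values, and comparison of pasted paths with a fixed
  one\<close>

subsection \<open>Values\<close>

locale game_class = payoff_processes T g L U \<rho>\<^sub>0
  for T :: real and g L U :: "('d::finite) process" and \<rho>\<^sub>0 +
  fixes \<P> :: "real \<Rightarrow> 'd path \<Rightarrow> 'd path measure set"
  assumes adapted: "adapted_class T g L U \<P>"
begin

abbreviation expected_payoff ("\<J>") where
  "\<J> t \<omega> P \<tau> \<gamma> \<equiv> \<integral>x. payoff T g L U t \<omega> \<tau> \<gamma> x \<partial>P"

lemma class_hat_probs: "t \<in> {0..T} \<Longrightarrow> \<omega> \<in> Omega T 0 \<Longrightarrow> P \<in> \<P> t \<omega> \<Longrightarrow> P \<in> hat_probs T g L U t"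
  using adapted[unfolded adapted_class_def, THEN conjunct1] by blast

lemma class_nonempty: "t \<in> {0..T} \<Longrightarrow> \<omega> \<in> Omega T 0 \<Longrightarrow> \<P> t \<omega> \<noteq> {}"
  using adapted[unfolded adapted_class_def, THEN conjunct1] by blast

lemma stops_nonempty: "t \<in> {0..T} \<Longrightarrow> stops T t \<noteq> ({} :: ('d path \<Rightarrow> real) set)"
  using const_in_stops[of t t T] by auto

lemma dyadic_stops_nonempty: "t \<in> {0..T} \<Longrightarrow> dyadic_stops T t n \<noteq> ({} :: ('d path \<Rightarrow> real) set)"
  using const_in_dyadic_stops[OF T_pos, of t t n] by auto

lemma bdd_above_payoffs:
  assumes "t \<in> {0..T}" "\<omega> \<in> Omega T 0" "P \<in> hat_probs T g L U t" "\<gamma> \<in> stops T t"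
  shows "bdd_above ((\<lambda>\<tau>. \<J> t \<omega> P \<tau> \<gamma>) ` dyadic_stops T t n)"
  using integrable_payoff(2)[OF assms(1-3) dyadic_stops_subset assms(4)]
  by (intro bdd_aboveI[of _ "\<integral>x. dominator t \<omega> x \<partial>P"]) (auto simp: abs_le_iff)

lemma payoff_stop_at_start:
  assumes "t \<in> {0..T}" "\<omega> \<in> Omega T 0" "x \<in> Omega T t" "t \<le> \<gamma> x"
  shows "payoff T g L U t \<omega> (\<lambda>_. t) \<gamma> x = L t \<omega>"
  using assms shift_start[of L t \<omega> x] by (simp add: payoff_def set_integral_singleton)

lemma expected_payoff_stop_at_start:
  assumes "t \<in> {0..T}" "\<omega> \<in> Omega T 0" "P \<in> hat_probs T g L U t" "\<gamma> \<in> stops T t"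
  shows "\<J> t \<omega> P (\<lambda>_. t) \<gamma> = L t \<omega>"
proof -
  interpret prob_space P by (rule hat_probsD[OF assms(3)])
  have "\<J> t \<omega> P (\<lambda>_. t) \<gamma> = (\<integral>x. L t \<omega> \<partial>P)"
    using stops_range[OF assms(4)] hat_probsD(3)[OF assms(3)]
    by (intro Bochner_Integration.integral_cong payoff_stop_at_start assms) auto
  then show ?thesis by (simp add: prob_space)
qed

text \<open>The maximizer can stop at once. This common lower bound makes the real infima in
  \<open>val\<close> infima of sets bounded below.\<close>

lemma SUP_payoffs_ge:
  assumes "t \<in> {0..T}" "\<omega> \<in> Omega T 0" "P \<in> hat_probs T g L U t" "\<gamma> \<in> stops T t"
  shows "L t \<omega> \<le> (SUP \<tau>\<in>dyadic_stops T t n. \<J> t \<omega> P \<tau> \<gamma>)"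
proof -
  have "(\<lambda>_. t) \<in> dyadic_stops T t n" using const_in_dyadic_stops[OF T_pos assms(1), of t n] by simp
  then show ?thesis using cSUP_upper[OF _ bdd_above_payoffs[OF assms]] expected_payoff_stop_at_start[OF assms] by fastforce
qed

lemma INF_payoffs_le:
  assumes t: "t \<in> {0..T}" and w: "\<omega> \<in> Omega T 0" and P: "P \<in> \<P> t \<omega>" and \<gamma>: "\<gamma> \<in> stops T t"
  shows "val T g L U \<P> n t \<omega> \<le> (SUP \<tau>\<in>dyadic_stops T t n. \<J> t \<omega> P \<tau> \<gamma>)"
proof -
  have bdd: "bdd_below ((\<lambda>\<gamma>. SUP \<tau>\<in>dyadic_stops T t n. \<J> t \<omega> P \<tau> \<gamma>) ` stops T t)" if "P \<in> \<P> t \<omega>" for P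
    using SUP_payoffs_ge[OF t w class_hat_probs[OF t w that]] by (intro bdd_belowI[of _ "L t \<omega>"]) auto
  have "bdd_below ((\<lambda>P. INF \<gamma>\<in>stops T t. SUP \<tau>\<in>dyadic_stops T t n. \<J> t \<omega> P \<tau> \<gamma>) ` \<P> t \<omega>)"
    using SUP_payoffs_ge[OF t w class_hat_probs[OF t w]] stops_nonempty[OF t]
    by (intro bdd_belowI[of _ "L t \<omega>"]) (auto intro!: cINF_greatest)
  then have "val T g L U \<P> n t \<omega> \<le> (INF \<gamma>\<in>stops T t. SUP \<tau>\<in>dyadic_stops T t n. \<J> t \<omega> P \<tau> \<gamma>)"
    unfolding val_def by (intro cINF_lower P)
  also have "\<dots> \<le> (SUP \<tau>\<in>dyadic_stops T t n. \<J> t \<omega> P \<tau> \<gamma>)"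
    by (intro cINF_lower bdd P \<gamma>)
  finally show ?thesis .
qed

lemma val_le:
  assumes "t \<in> {0..T}" "\<omega> \<in> Omega T 0" "P \<in> \<P> t \<omega>" "\<gamma> \<in> stops T t"
    and "\<And>\<tau>. \<tau> \<in> dyadic_stops T t n \<Longrightarrow> \<J> t \<omega> P \<tau> \<gamma> \<le> c"
  shows "val T g L U \<P> n t \<omega> \<le> c"
  by (rule order_trans[OF INF_payoffs_le[OF assms(1-4)] cSUP_least[OF dyadic_stops_nonempty[OF assms(1)] assms(5)]])

lemma val_near_optimal_reply:
  assumes "t \<in> {0..T}" "\<omega> \<in> Omega T 0" "P \<in> \<P> t \<omega>" "\<gamma> \<in> stops T t" "c < val T g L U \<P> n t \<omega>"
  obtains \<tau> where "\<tau> \<in> dyadic_stops T t n" "c < \<J> t \<omega> P \<tau> \<gamma>"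
proof -
  have "c < (SUP \<tau>\<in>dyadic_stops T t n. \<J> t \<omega> P \<tau> \<gamma>)"
    using INF_payoffs_le[OF assms(1-4)] assms(5) by (rule less_le_trans[rotated])
  then show ?thesis
    using less_cSUP_iff[OF dyadic_stops_nonempty[OF assms(1)]
        bdd_above_payoffs[OF assms(1,2) class_hat_probs[OF assms(1-3)] assms(4)]] that by blast
qed

lemma val_greatest:
  assumes t: "t \<in> {0..T}" and w: "\<omega> \<in> Omega T 0"
    and le: "\<And>P \<gamma>. P \<in> \<P> t \<omega> \<Longrightarrow> \<gamma> \<in> stops T t \<Longrightarrow> \<exists>\<tau>\<in>dyadic_stops T t n. c \<le> \<J> t \<omega> P \<tau> \<gamma>"
  shows "c \<le> val T g L U \<P> n t \<omega>"
  unfolding val_def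
proof (intro cINF_greatest class_nonempty[OF t w] stops_nonempty[OF t])
  fix P and \<gamma> :: "'d path \<Rightarrow> real" assume *: "P \<in> \<P> t \<omega>" "\<gamma> \<in> stops T t"
  then obtain \<tau> :: "'d path \<Rightarrow> real" where "\<tau> \<in> dyadic_stops T t n" "c \<le> \<J> t \<omega> P \<tau> \<gamma>" using le by blast
  then show "c \<le> (SUP \<tau>\<in>dyadic_stops T t n. \<J> t \<omega> P \<tau> \<gamma>)"
    using cSUP_upper[OF _ bdd_above_payoffs[OF t w class_hat_probs[OF t w *(1)] *(2)]] order_trans by blast
qed

lemma val_near_optimal:
  assumes t: "t \<in> {0..T}" and w: "\<omega> \<in> Omega T 0" and "0 < e"
  obtains P \<gamma> where "P \<in> \<P> t \<omega>" "\<gamma> \<in> stops T t"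
    "(SUP \<tau>\<in>dyadic_stops T t n. \<J> t \<omega> P \<tau> \<gamma>) \<le> val T g L U \<P> n t \<omega> + e"
proof (rule ccontr)
  assume contr: "\<not> thesis"
  have "val T g L U \<P> n t \<omega> + e \<le> (INF P\<in>\<P> t \<omega>. INF \<gamma>\<in>stops T t. SUP \<tau>\<in>dyadic_stops T t n. \<J> t \<omega> P \<tau> \<gamma>)"
  proof (intro cINF_greatest class_nonempty[OF t w] stops_nonempty[OF t])
    fix P and \<gamma> :: "'d path \<Rightarrow> real" assume "P \<in> \<P> t \<omega>" "\<gamma> \<in> stops T t"
    with that contr show "val T g L U \<P> n t \<omega> + e \<le> (SUP \<tau>\<in>dyadic_stops T t n. \<J> t \<omega> P \<tau> \<gamma>)"
      using linear by blast
  qed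
  also have "\<dots> = val T g L U \<P> n t \<omega>" by (rule val_def[symmetric])
  finally show False using \<open>0 < e\<close> by simp
qed

lemma expected_payoff_le_SUP:
  assumes "t \<in> {0..T}" "\<omega> \<in> Omega T 0" "P \<in> hat_probs T g L U t" "\<gamma> \<in> stops T t" "\<tau> \<in> dyadic_stops T t n"
  shows "\<J> t \<omega> P \<tau> \<gamma> \<le> (SUP \<tau>\<in>dyadic_stops T t n. \<J> t \<omega> P \<tau> \<gamma>)"
  by (rule cSUP_upper[OF assms(5) bdd_above_payoffs[OF assms(1-4)]])

lemma val_ge_L:
  assumes "t \<in> {0..T}" "\<omega> \<in> Omega T 0"
  shows "L t \<omega> \<le> val T g L U \<P> n t \<omega>"
proof (rule val_greatest[OF assms])
  fix P and \<gamma> :: "'d path \<Rightarrow> real" assume "P \<in> \<P> t \<omega>" "\<gamma> \<in> stops T t"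
  then show "\<exists>\<tau>\<in>dyadic_stops T t n. L t \<omega> \<le> \<J> t \<omega> P \<tau> \<gamma>"
    using const_in_dyadic_stops[OF T_pos assms(1), of t n]
    by (intro bexI[of _ "\<lambda>_. t"]) (auto simp: expected_payoff_stop_at_start[OF assms class_hat_probs[OF assms]])
qed

lemma val_le_U:
  assumes t: "t \<in> {0..T}" and w: "\<omega> \<in> Omega T 0"
  shows "val T g L U \<P> n t \<omega> \<le> U t \<omega>"
proof -
  obtain P where P: "P \<in> \<P> t \<omega>" using class_nonempty[OF t w] by blast
  note hP = class_hat_probs[OF t w P]
  interpret prob_space P by (rule hat_probsD[OF hP])
  have c: "(\<lambda>_. t) \<in> stops T t" using t by (intro const_in_stops) auto
  show ?thesis
  proof (rule val_le[OF t w P c])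
    fix \<tau> :: "'d path \<Rightarrow> real" assume \<tau>: "\<tau> \<in> dyadic_stops T t n"
    have "\<J> t \<omega> P \<tau> (\<lambda>_. t) \<le> (\<integral>x. U t \<omega> \<partial>P)"
    proof (rule integral_mono[OF integrable_payoff(1)[OF t w hP dyadic_stops_subset[OF \<tau>] c]])
      fix x assume "x \<in> space P"
      then have x: "x \<in> Omega T t" using hat_probsD(3)[OF hP] by simp
      have "\<tau> x = t \<or> t < \<tau> x" using stops_range[OF dyadic_stops_subset[OF \<tau>] x] by auto
      then show "payoff T g L U t \<omega> \<tau> (\<lambda>_. t) x \<le> U t \<omega>"
        using shift_start[of L t \<omega> x, OF _ t w x] shift_start[of U t \<omega> x, OF _ t w x] L_le_U[OF t w]
        by (auto simp: payoff_def set_integral_singleton)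
    qed simp
    then show "\<J> t \<omega> P \<tau> (\<lambda>_. t) \<le> U t \<omega>" by (simp add: prob_space)
  qed
qed

text \<open>P is only asked to lie in \<open>hat_probs\<close>: the upper estimate evaluates a law
  chosen for one prefix along neighbouring prefixes, whose classes need not contain it.\<close>

lemma SUP_payoffs_regular:
  assumes t: "t \<in> {0..T}" and w: "\<omega>1 \<in> Omega T 0" "\<omega>2 \<in> Omega T 0"
    and P: "P \<in> hat_probs T g L U t" and \<gamma>: "\<gamma> \<in> stops T t"
  shows "\<bar>(SUP \<tau>\<in>dyadic_stops T t n. \<J> t \<omega>1 P \<tau> \<gamma>) - (SUP \<tau>\<in>dyadic_stops T t n. \<J> t \<omega>2 P \<tau> \<gamma>)\<bar>
    \<le> (1 + T) * \<rho>\<^sub>0 (supnorm 0 t (\<lambda>r. \<omega>1 r - \<omega>2 r))"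
proof -
  interpret prob_space P by (rule hat_probsD[OF P])
  have le: "(SUP \<tau>\<in>dyadic_stops T t n. \<J> t \<omega>1 P \<tau> \<gamma>) \<le> (SUP \<tau>\<in>dyadic_stops T t n. \<J> t \<omega>2 P \<tau> \<gamma>)
      + (1 + T) * \<rho>\<^sub>0 (supnorm 0 t (\<lambda>r. \<omega>1 r - \<omega>2 r))"
    if w: "\<omega>1 \<in> Omega T 0" "\<omega>2 \<in> Omega T 0" for \<omega>1 \<omega>2
  proof (rule cSUP_least[OF dyadic_stops_nonempty[OF t]])
    fix \<tau> :: "'d path \<Rightarrow> real" assume \<tau>: "\<tau> \<in> dyadic_stops T t n"
    let ?c = "(1 + T) * \<rho>\<^sub>0 (supnorm 0 t (\<lambda>r. \<omega>1 r - \<omega>2 r))"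
    have int: "integrable P (payoff T g L U t \<omega>2 \<tau> \<gamma>)"
      by (rule integrable_payoff(1)[OF t w(2) P dyadic_stops_subset[OF \<tau>] \<gamma>])
    have "\<J> t \<omega>1 P \<tau> \<gamma> \<le> (\<integral>x. payoff T g L U t \<omega>2 \<tau> \<gamma> x + ?c \<partial>P)"
    proof (rule integral_mono[OF integrable_payoff(1)[OF t w(1) P dyadic_stops_subset[OF \<tau>] \<gamma>]])
      fix x assume "x \<in> space P"
      then have x: "x \<in> Omega T t" using hat_probsD(3)[OF P] by simp
      show "payoff T g L U t \<omega>1 \<tau> \<gamma> x \<le> payoff T g L U t \<omega>2 \<tau> \<gamma> x + ?c"
        using payoff_regular_shift[where \<tau>=\<tau> and \<gamma>=\<gamma>, OF t w x stops_range[OF dyadic_stops_subset[OF \<tau>] x] stops_range[OF \<gamma> x]]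
        unfolding abs_le_iff by linarith
    qed (simp add: int)
    also have "\<dots> = \<J> t \<omega>2 P \<tau> \<gamma> + ?c" using int by (simp add: prob_space)
    also have "\<dots> \<le> (SUP \<tau>\<in>dyadic_stops T t n. \<J> t \<omega>2 P \<tau> \<gamma>) + ?c"
      using expected_payoff_le_SUP[OF t w(2) P \<gamma> \<tau>] by simp
    finally show "\<J> t \<omega>1 P \<tau> \<gamma> \<le> (SUP \<tau>\<in>dyadic_stops T t n. \<J> t \<omega>2 P \<tau> \<gamma>) + ?c" .
  qed
  have "supnorm 0 t (\<lambda>r. \<omega>2 r - \<omega>1 r) = supnorm 0 t (\<lambda>r. \<omega>1 r - \<omega>2 r)"
    by (simp add: supnorm_def norm_minus_commute)
  then show ?thesis using le[OF w] le[OF w(2,1)] by (simp add: abs_le_iff)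
qed

text \<open>Continuing \<omega> after t by x instead of by itself costs the oscillation \<eta> of
  \<omega> plus the size of x. In the second claim the other \<eta> pays for the displacement in
  time.\<close>

lemma
  assumes w: "\<omega> \<in> Omega T 0" and ts: "0 \<le> t" "t \<le> s" "s \<le> T" and x: "x \<in> Omega T t"
    and osc: "\<And>u v. u \<in> {t..s} \<Longrightarrow> v \<in> {t..s} \<Longrightarrow> norm (\<omega> u - \<omega> v) \<le> \<eta>"
  shows paste_near: "supnorm 0 s (\<lambda>r. paste T 0 t \<omega> x r - \<omega> r) \<le> \<eta> + supnorm t s x"
    and shift_near: "X \<in> {g, L, U, Psi L U} \<Longrightarrow> r \<in> {t..s} \<Longrightarrow> s - t \<le> \<eta> \<Longrightarrow>
      \<bar>shift_proc T X t \<omega> r x - X s \<omega>\<bar> \<le> \<rho>\<^sub>0 (2 * \<eta> + supnorm t s x)"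
proof -
  have cx: "continuous_on {t..s} x" using ts by (intro Omega_continuous_on[OF x]) auto
  have S: "norm (x u) \<le> supnorm t s x" if "u \<in> {t..s}" for u by (rule supnorm_ge[OF cx that])
  have "0 \<le> \<eta>" using osc[of t t] ts by simp
  then have S0: "0 \<le> \<eta> + supnorm t s x" using supnorm_nonneg[OF ts(2) cx] by simp
  have near: "norm (paste T 0 t \<omega> x u - \<omega> v) \<le> \<eta> + supnorm t s x" if "u \<in> {t..s}" "v \<in> {t..s}" for u v
  proof -
    have "norm (\<omega> t + x u - \<omega> v) \<le> norm (\<omega> t - \<omega> v) + norm (x u)"
      using norm_triangle_ineq[of "\<omega> t - \<omega> v" "x u"] by (simp add: algebra_simps)
    then show ?thesis using osc[of t v] S[of u] that ts by (auto simp: paste_def)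
  qed
  show "supnorm 0 s (\<lambda>r. paste T 0 t \<omega> x r - \<omega> r) \<le> \<eta> + supnorm t s x"
  proof (rule supnorm_le)
    show "norm (paste T 0 t \<omega> x r - \<omega> r) \<le> \<eta> + supnorm t s x" if "r \<in> {0..s}" for r
      using near[of r r] that ts S0 by (cases "r < t") (auto simp: paste_def)
  qed (use ts in simp)
  show "\<bar>shift_proc T X t \<omega> r x - X s \<omega>\<bar> \<le> \<rho>\<^sub>0 (2 * \<eta> + supnorm t s x)"
    if X: "X \<in> {g, L, U, Psi L U}" and r: "r \<in> {t..s}" and "s - t \<le> \<eta>"
    unfolding shift_proc_def
  proof (rule regularity[OF X])
    show "norm (paste T 0 t \<omega> x (min v r) - \<omega> (min v s)) \<le> \<eta> + supnorm t s x" if "v \<in> {0..T}" for v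
    proof (cases "v < t")
      case True
      then have "min v r = v" "min v s = v" "v < t" using r by auto
      then show ?thesis using that S0 by (simp add: paste_def)
    next
      case False
      then show ?thesis using r by (intro near) (auto simp: min_def)
    qed
  qed (use r ts \<open>s - t \<le> \<eta>\<close> w x in \<open>auto intro!: paste_in_Omega\<close>)
qed

lemma supnorm_paste_diff:
  assumes ts: "0 \<le> t" "t \<le> s" "s \<le> T" and x: "x \<in> Omega T t" and y: "y \<in> Omega T t"
  shows "supnorm 0 s (\<lambda>r. paste T 0 t \<omega> x r - paste T 0 t \<omega> y r) \<le> supnorm t s (\<lambda>r. x r - y r)"
proof (rule supnorm_le)
  have sn: "norm (x r - y r) \<le> supnorm t s (\<lambda>r. x r - y r)" if "r \<in> {t..s}" for r
    using ts that by (intro supnorm_ge[of t s "\<lambda>r. x r - y r"] continuous_on_diff Omega_continuous_on[OF x] Omega_continuous_on[OF y]) auto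
  show "norm (paste T 0 t \<omega> x r - paste T 0 t \<omega> y r) \<le> supnorm t s (\<lambda>r. x r - y r)" if "r \<in> {0..s}" for r
    using sn[of r] order_trans[OF norm_ge_zero sn[of t]] that ts by (cases "r < t") (auto simp: paste_def)
qed (use ts in simp)

text \<open>The short length \<eta> is kept for the deterministic part K. The random part D only
  gets the crude length T, since its mean is made small separately.\<close>

lemma integral_g_near:
  assumes ts: "0 \<le> t" "s \<le> T" "s - t \<le> \<eta>" and u: "u \<in> {t..s}" and w: "\<omega> \<in> Omega T 0" and z: "z \<in> Omega T t"
    and near: "\<And>r. r \<in> {t..s} \<Longrightarrow> \<bar>shift_proc T g t \<omega> r z - g s \<omega>\<bar> \<le> D" and K: "\<bar>g s \<omega>\<bar> \<le> K"
  shows "\<bar>LBINT r:{t..u}. shift_proc T g t \<omega> r z\<bar> \<le> \<eta> * K + T * D"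
proof -
  have t: "t \<in> {0..T}" using ts u by auto
  have D: "0 \<le> D" using near[OF u] by linarith
  have "\<bar>LBINT r:{t..u}. shift_proc T g t \<omega> r z\<bar> \<le> (u - t) * (K + D)"
  proof (rule set_integral_abs_le)
    show "continuous_on {t..u} (\<lambda>r. shift_proc T g t \<omega> r z)"
      using u ts by (intro shift_continuous[OF _ t w z]) auto
    show "\<bar>shift_proc T g t \<omega> r z\<bar> \<le> K + D" if "r \<in> {t..u}" for r
      using near[of r] K that u by auto
  qed (use u in simp)
  also have "\<dots> \<le> \<eta> * K + T * D"
    unfolding distrib_left using u ts K D by (intro add_mono mult_right_mono) auto
  finally show ?thesis .
qed

text \<open>The oscillation bound with \<zeta> = t. A canonical path starts at 0, so its oscillation
  from t on is its norm. The modulus obtained depends on \<omega> but not on t, s or the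
  law.\<close>

lemma oscillation_expectation:
  assumes osc: "oscillation_bound T \<P> \<rho>" and \<rho>: "modulus \<rho>" and w: "\<omega> \<in> Omega T 0"
  obtains \<rho>' where "modulus \<rho>'"
    "\<And>t s c P. 0 \<le> t \<Longrightarrow> t < s \<Longrightarrow> s \<le> T \<Longrightarrow> s - t \<le> c \<Longrightarrow> c \<le> T \<Longrightarrow> P \<in> \<P> t \<omega> \<Longrightarrow>
      integrable P (\<lambda>x. \<rho> (c + supnorm t s x)) \<and> (\<integral>x. \<rho> (c + supnorm t s x) \<partial>P) \<le> \<rho>' c"
proof -
  \<comment> \<open>The norm over the whole horizon makes one \<alpha> serve all t; the added 1
    accounts for the strict inequality in \<open>path_ball\<close> and makes \<alpha>
    positive.\<close>
  define \<alpha> where "\<alpha> = supnorm 0 T \<omega> + 1"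
  have "0 \<le> supnorm 0 T \<omega>" using T_pos w by (intro supnorm_nonneg Omega_continuous_on) auto
  then have "0 < \<alpha>" by (simp add: \<alpha>_def)
  then obtain \<rho>' where \<rho>': "modulus \<rho>'" and bound: "\<And>t \<delta>. t \<in> {0..<T} \<Longrightarrow> \<delta> \<in> {0<..T} \<Longrightarrow>
        (SUP \<omega>\<in>path_ball T 0 t \<alpha> (null_path T). SUP P\<in>\<P> t \<omega>. SUP \<zeta>\<in>stops T t.
           \<integral>\<^sup>+x. ennreal (\<rho> (\<delta> + (SUP r\<in>{\<zeta> x..min (\<zeta> x + \<delta>) T}. norm (x r - x (\<zeta> x))))) \<partial>P)
        \<le> ennreal (\<rho>' \<delta>)"
    using osc unfolding oscillation_bound_def by blast
  show ?thesis
  proof (rule that[OF \<rho>'])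
    fix t s c P assume ts: "0 \<le> t" "t < s" "s \<le> T" "s - t \<le> c" "c \<le> T" and P: "P \<in> \<P> t \<omega>"
    have t: "t \<in> {0..T}" using ts by auto
    note hP = class_hat_probs[OF t w P]
    note [measurable_cong] = hat_probsD(2)[OF hP]
    have "supnorm 0 t (\<lambda>r. \<omega> r - null_path T r) \<le> supnorm 0 T \<omega>"
      using ts w by (intro supnorm_le) (auto simp: null_path_def intro!: supnorm_ge Omega_continuous_on)
    then have ball: "\<omega> \<in> path_ball T 0 t \<alpha> (null_path T)"
      using w by (simp add: path_ball_def \<alpha>_def)
    have c: "(\<lambda>_. t) \<in> stops T t" using ts by (intro const_in_stops) auto
    have nn: "(\<integral>\<^sup>+x. ennreal (\<rho> (c + (SUP r\<in>{t..min (t + c) T}. norm (x r - x t)))) \<partial>P) \<le> ennreal (\<rho>' c)"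
    proof -
      let ?I = "\<lambda>P \<zeta>. \<integral>\<^sup>+x. ennreal (\<rho> (c + (SUP r\<in>{\<zeta> x..min (\<zeta> x + c) T}. norm (x r - x (\<zeta> x))))) \<partial>P"
      have "?I P (\<lambda>_. t) \<le> (SUP \<zeta>\<in>stops T t. ?I P \<zeta>)" by (rule SUP_upper[OF c])
      also have "\<dots> \<le> (SUP P\<in>\<P> t \<omega>. SUP \<zeta>\<in>stops T t. ?I P \<zeta>)" by (rule SUP_upper[OF P])
      also have "\<dots> \<le> (SUP \<omega>\<in>path_ball T 0 t \<alpha> (null_path T). SUP P\<in>\<P> t \<omega>. SUP \<zeta>\<in>stops T t. ?I P \<zeta>)"
        by (rule SUP_upper[OF ball])
      also have "\<dots> \<le> ennreal (\<rho>' c)" using ts by (intro bound) auto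
      finally show ?thesis .
    qed
    have pos: "0 \<le> supnorm t s x" if "x \<in> Omega T t" for x :: "'d path"
      using ts by (intro supnorm_nonneg Omega_continuous_on[OF that]) auto
    have "(\<integral>\<^sup>+x. ennreal (\<rho> (c + supnorm t s x)) \<partial>P) \<le> (\<integral>\<^sup>+x. ennreal (\<rho> (c + (SUP r\<in>{t..min (t + c) T}. norm (x r - x t)))) \<partial>P)"
    proof (intro nn_integral_mono ennreal_leI modulus_mono[OF \<rho>])
      fix x assume "x \<in> space P"
      then have x: "x \<in> Omega T t" using hat_probsD(3)[OF hP] by simp
      show "0 \<le> c + supnorm t s x" using pos[OF x] ts by simp
      have "continuous_on {t..min (t + c) T} x" by (intro Omega_continuous_on[OF x]) auto
      \<comment> \<open>Since s - t is at most c and s at most T, [t,s] lies in the window of the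
        oscillation bound.\<close>
      then show "c + supnorm t s x \<le> c + (SUP r\<in>{t..min (t + c) T}. norm (x r - x t))"
        using bdd_above_norm_path ts unfolding Omega_start[OF x] supnorm_def
        by (intro add_left_mono) (auto intro!: cSUP_subset_mono)
    qed
    also note nn
    finally have fin: "(\<integral>\<^sup>+x. ennreal (\<rho> (c + supnorm t s x)) \<partial>P) \<le> ennreal (\<rho>' c)" .
    have meas: "(\<lambda>x. \<rho> (c + supnorm t s x)) \<in> borel_measurable P"
      unfolding measurable_cong_sets[OF hat_probsD(2)[OF hP] refl]
      using ts by (intro measurable_canon_filt_T[OF measurable_modulus_supnorm[OF \<rho>]]) auto
    have nonneg: "AE x in P. 0 \<le> \<rho> (c + supnorm t s x)"
      using pos hat_probsD(3)[OF hP] ts by (intro AE_I2 modulus_nonneg[OF \<rho>]) auto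
    have int: "integrable P (\<lambda>x. \<rho> (c + supnorm t s x))"
      using fin by (intro integrableI_nonneg meas nonneg) (auto intro: le_less_trans)
    have "ennreal (\<integral>x. \<rho> (c + supnorm t s x) \<partial>P) \<le> ennreal (\<rho>' c)"
      using nn_integral_eq_integral[OF int nonneg] fin by simp
    then have "(\<integral>x. \<rho> (c + supnorm t s x) \<partial>P) \<le> \<rho>' c"
      using modulus_nonneg[OF \<rho>', of c] ts by (simp add: ennreal_le_iff)
    with int show "integrable P (\<lambda>x. \<rho> (c + supnorm t s x)) \<and> (\<integral>x. \<rho> (c + supnorm t s x) \<partial>P) \<le> \<rho>' c" by simp
  qed
qed

end

section \<open>Upper estimate: pasting one law onto a ball around the fixed path\<close>

subsection \<open>The upper estimate\<close>

context game_class
begin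

text \<open>Weak stability for the partition into one ball and its complement. The centre is the
  tail of \<omega>, because pasting it after the prefix returns \<omega> itself, which makes every
  law in \<open>\<P> s \<omega>\<close> eligible.\<close>

lemma single_pasting:
  assumes "weakly_stable_pasting T g L U \<P>"
  obtains \<rho> where "modulus \<rho>"
    "\<And>t s \<omega> P \<delta> P1 n \<gamma>. 0 \<le> t \<Longrightarrow> t < s \<Longrightarrow> s \<le> T \<Longrightarrow> \<omega> \<in> Omega T 0 \<Longrightarrow> P \<in> \<P> t \<omega> \<Longrightarrow> P1 \<in> \<P> s \<omega> \<Longrightarrow>
      0 < \<delta> \<Longrightarrow> \<delta> \<in> \<rat> \<Longrightarrow> \<gamma> \<in> stops T s \<Longrightarrow> 1 \<le> n \<Longrightarrow>
      \<exists>Ph\<in>\<P> t \<omega>. \<exists>\<gamma>'\<in>stops_from T t s. \<forall>A\<in>sets (canon_filt T t s).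
        measure Ph (A \<inter> path_ball T t s \<delta> (tail T t \<omega>)) = measure P (A \<inter> path_ball T t s \<delta> (tail T t \<omega>)) \<and>
        (\<forall>\<tau>\<in>dyadic_stops_from T t s n.
          (\<integral>x. indicator (A \<inter> path_ball T t s \<delta> (tail T t \<omega>)) x * payoff T g L U t \<omega> \<tau> \<gamma>' x \<partial>Ph)
          \<le> (\<integral>x. indicator (A \<inter> path_ball T t s \<delta> (tail T t \<omega>)) x *
               ((SUP \<sigma>\<in>dyadic_stops T s n. \<J> s (paste T 0 t \<omega> x) P1 \<sigma> \<gamma>)
                + (LBINT r:{t..s}. shift_proc T g t \<omega> r x)) \<partial>P) + \<rho> \<delta>)"
proof -
  obtain \<rho> where \<rho>: "modulus \<rho>" and paste: "\<forall>t s \<omega> P \<delta> (l::nat) \<A> \<delta>' \<omega>' P'.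
        0 \<le> t \<and> t < s \<and> s \<le> T \<and> \<omega> \<in> Omega T 0 \<and> P \<in> \<P> t \<omega> \<and> 0 < \<delta> \<and> \<delta> \<in> \<rat> \<and> 1 \<le> l \<and>
        (\<forall>j\<in>{0..l}. \<A> j \<in> sets (canon_filt T t s)) \<and>
        disjoint_family_on \<A> {0..l} \<and> (\<Union>j\<in>{0..l}. \<A> j) = Omega T t \<and>
        (\<forall>j\<in>{1..l}. \<delta>' j \<in> ({0<..\<delta>} \<inter> \<rat>) \<union> {\<delta>} \<and> \<omega>' j \<in> Omega T t \<and>
           \<A> j \<subseteq> path_ball T t s (\<delta>' j) (\<omega>' j) \<and> P' j \<in> \<P> s (paste T 0 t \<omega> (\<omega>' j))) \<longrightarrow>
        (\<exists>Ph\<in>\<P> t \<omega>.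
           (\<forall>A\<in>sets (canon_filt T t T). measure Ph (A \<inter> \<A> 0) = measure P (A \<inter> \<A> 0)) \<and>
           (\<forall>j\<in>{1..l}. \<forall>A\<in>sets (canon_filt T t s).
              measure Ph (A \<inter> \<A> j) = measure P (A \<inter> \<A> j)) \<and>
           (\<forall>n::enat. \<forall>\<gamma>\<in>stops T s. 1 \<le> n \<longrightarrow>
              (\<exists>\<gamma>'. (\<forall>j\<in>{1..l}. \<gamma>' j \<in> stops_from T t s) \<and>
                (\<forall>A\<in>sets (canon_filt T t s). \<forall>\<tau>\<in>dyadic_stops_from T t s n.
                   (\<Sum>j=1..l. \<integral>x. indicator (A \<inter> \<A> j) x * payoff T g L U t \<omega> \<tau> (\<gamma>' j) x \<partial>Ph)
                   \<le> (\<Sum>j=1..l. \<integral>x. indicator (A \<inter> \<A> j) x *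
                          ((SUP \<sigma>\<in>dyadic_stops T s n.
                              \<integral>y. payoff T g L U s (paste T 0 t \<omega> x) \<sigma> \<gamma> y \<partial>P' j)
                           + (LBINT r:{t..s}. shift_proc T g t \<omega> r x)) \<partial>P)
                     + \<rho> \<delta>))))"
    using assms unfolding weakly_stable_pasting_def by (elim exE conjE)
  show ?thesis
  proof (rule that[OF \<rho>])
    fix t s \<delta> :: real and \<omega> P P1 and n :: enat and \<gamma> :: "'d path \<Rightarrow> real"
    assume ts: "0 \<le> t" "t < s" "s \<le> T" and w: "\<omega> \<in> Omega T 0" and P: "P \<in> \<P> t \<omega>" "P1 \<in> \<P> s \<omega>"
      and d: "0 < \<delta>" "\<delta> \<in> \<rat>" and \<gamma>: "\<gamma> \<in> stops T s" and n: "1 \<le> n"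
    let ?w = "tail T t \<omega>" and ?B = "path_ball T t s \<delta> (tail T t \<omega>)"
    define \<A> :: "nat \<Rightarrow> 'd path set" where "\<A> = (\<lambda>j. if j = 0 then Omega T t - ?B else ?B)"
    have w': "?w \<in> Omega T t" using ts w by (intro tail_in_Omega[of 0]) auto
    have B: "?B \<in> sets (canon_filt T t s)" using ts w' by (intro path_ball_sets) auto
    have B': "Omega T t - ?B \<in> sets (canon_filt T t s)"
      using sets.Diff[OF sets.top[of "canon_filt T t s"] B] by simp
    have sub: "?B \<subseteq> Omega T t" by (auto simp: path_ball_def)
    have two: "{0..1::nat} = {0, 1}" by auto
    have "paste T 0 t \<omega> ?w = \<omega>" using ts w by (intro paste_tail) auto
    then have "0 \<le> t \<and> t < s \<and> s \<le> T \<and> \<omega> \<in> Omega T 0 \<and> P \<in> \<P> t \<omega> \<and> 0 < \<delta> \<and> \<delta> \<in> \<rat> \<and> 1 \<le> (1::nat) \<and>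
        (\<forall>j\<in>{0..1}. \<A> j \<in> sets (canon_filt T t s)) \<and>
        disjoint_family_on \<A> {0..1} \<and> (\<Union>j\<in>{0..1}. \<A> j) = Omega T t \<and>
        (\<forall>j\<in>{1..1}. (\<lambda>_. \<delta>) j \<in> ({0<..\<delta>} \<inter> \<rat>) \<union> {\<delta>} \<and> (\<lambda>_. ?w) j \<in> Omega T t \<and>
           \<A> j \<subseteq> path_ball T t s ((\<lambda>_. \<delta>) j) ((\<lambda>_. ?w) j) \<and> (\<lambda>_. P1) j \<in> \<P> s (paste T 0 t \<omega> ((\<lambda>_. ?w) j)))"
      using ts w P d w' B B' sub unfolding two by (auto simp: \<A>_def disjoint_family_on_def)
    note hyp = paste[rule_format, OF this]
    then obtain Ph where Ph: "Ph \<in> \<P> t \<omega>"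
      and meas: "\<forall>j\<in>{1..1::nat}. \<forall>A\<in>sets (canon_filt T t s). measure Ph (A \<inter> \<A> j) = measure P (A \<inter> \<A> j)"
      and pay: "\<forall>n::enat. \<forall>\<gamma>\<in>stops T s. 1 \<le> n \<longrightarrow>
              (\<exists>\<gamma>'. (\<forall>j\<in>{1..1::nat}. \<gamma>' j \<in> stops_from T t s) \<and>
                (\<forall>A\<in>sets (canon_filt T t s). \<forall>\<tau>\<in>dyadic_stops_from T t s n.
                   (\<Sum>j=1..1. \<integral>x. indicator (A \<inter> \<A> j) x * payoff T g L U t \<omega> \<tau> (\<gamma>' j) x \<partial>Ph)
                   \<le> (\<Sum>j=1..1. \<integral>x. indicator (A \<inter> \<A> j) x *
                          ((SUP \<sigma>\<in>dyadic_stops T s n.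
                              \<integral>y. payoff T g L U s (paste T 0 t \<omega> x) \<sigma> \<gamma> y \<partial>(\<lambda>_. P1) j)
                           + (LBINT r:{t..s}. shift_proc T g t \<omega> r x)) \<partial>P)
                     + \<rho> \<delta>))"
      by (elim bexE conjE)
    obtain \<gamma>' where \<gamma>': "\<forall>j\<in>{1..1::nat}. \<gamma>' j \<in> stops_from T t s"
       and le: "\<forall>A\<in>sets (canon_filt T t s). \<forall>\<tau>\<in>dyadic_stops_from T t s n.
                   (\<Sum>j=1..1. \<integral>x. indicator (A \<inter> \<A> j) x * payoff T g L U t \<omega> \<tau> (\<gamma>' j) x \<partial>Ph)
                   \<le> (\<Sum>j=1..1. \<integral>x. indicator (A \<inter> \<A> j) x *
                          ((SUP \<sigma>\<in>dyadic_stops T s n.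
                              \<integral>y. payoff T g L U s (paste T 0 t \<omega> x) \<sigma> \<gamma> y \<partial>(\<lambda>_. P1) j)
                           + (LBINT r:{t..s}. shift_proc T g t \<omega> r x)) \<partial>P)
                     + \<rho> \<delta>"
      using pay[rule_format, OF \<gamma> n] by (elim exE conjE)
    show "\<exists>Ph\<in>\<P> t \<omega>. \<exists>\<gamma>'\<in>stops_from T t s. \<forall>A\<in>sets (canon_filt T t s).
        measure Ph (A \<inter> ?B) = measure P (A \<inter> ?B) \<and>
        (\<forall>\<tau>\<in>dyadic_stops_from T t s n.
          (\<integral>x. indicator (A \<inter> ?B) x * payoff T g L U t \<omega> \<tau> \<gamma>' x \<partial>Ph)
          \<le> (\<integral>x. indicator (A \<inter> ?B) x *
               ((SUP \<sigma>\<in>dyadic_stops T s n. \<J> s (paste T 0 t \<omega> x) P1 \<sigma> \<gamma>)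
                + (LBINT r:{t..s}. shift_proc T g t \<omega> r x)) \<partial>P) + \<rho> \<delta>)"
    proof (intro bexI[OF _ Ph] bexI[of _ "\<gamma>' 1"] ballI conjI)
      show "\<gamma>' 1 \<in> stops_from T t s" using \<gamma>' by simp
      show "measure Ph (A \<inter> ?B) = measure P (A \<inter> ?B)" if "A \<in> sets (canon_filt T t s)" for A :: "'d path set"
        using meas that by (simp add: \<A>_def)
      fix A :: "'d path set" and \<tau> :: "'d path \<Rightarrow> real" assume "A \<in> sets (canon_filt T t s)" "\<tau> \<in> dyadic_stops_from T t s n"
      then show "(\<integral>x. indicator (A \<inter> ?B) x * payoff T g L U t \<omega> \<tau> (\<gamma>' 1) x \<partial>Ph)
          \<le> (\<integral>x. indicator (A \<inter> ?B) x *
               ((SUP \<sigma>\<in>dyadic_stops T s n. \<J> s (paste T 0 t \<omega> x) P1 \<sigma> \<gamma>)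
                + (LBINT r:{t..s}. shift_proc T g t \<omega> r x)) \<partial>P) + \<rho> \<delta>"
        using le[rule_format, of A \<tau>] by (simp add: \<A>_def)
    qed
  qed
qed

text \<open>The choice is made by an event of time s, and both alternatives stop no earlier than
  s.\<close>

lemma stop_before_or_paste:
  assumes ts: "0 \<le> t" "t \<le> s" "s \<le> T" and \<gamma>: "\<gamma> \<in> stops_from T t s" and B: "B \<in> sets (canon_filt T t s)"
  shows "(\<lambda>x. if x \<in> B then \<gamma> x else s) \<in> stops T t"
proof (rule stopsI)
  have \<gamma>1: "\<gamma> \<in> stops T t" and \<gamma>2: "\<And>x. x \<in> Omega T t \<Longrightarrow> s \<le> \<gamma> x" using \<gamma> by (auto simp: stops_from_def)
  show "(if x \<in> B then \<gamma> x else s) \<in> {t..T}" if "x \<in> Omega T t" for x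
    using stops_range[OF \<gamma>1 that] ts by auto
  show "{x \<in> Omega T t. (if x \<in> B then \<gamma> x else s) \<le> u} \<in> sets (canon_filt T t u)" if "u \<in> {t..<T}" for u
  proof (cases "s \<le> u")
    case True
    have B': "B \<in> sets (canon_filt T t u)" using B sets_canon_filt_mono[OF True] by blast
    have "{x \<in> Omega T t. (if x \<in> B then \<gamma> x else s) \<le> u} = ({x \<in> Omega T t. \<gamma> x \<le> u} \<inter> B) \<union> (space (canon_filt T t u) - B)"
      using True sets.sets_into_space[OF B] by auto
    then show ?thesis using B' stops_sets[OF \<gamma>1, of u] by (simp only: sets.Int sets.Un sets.compl_sets)
  next
    case False
    then have "\<not> (if x \<in> B then \<gamma> x else s) \<le> u" if "x \<in> Omega T t" for x using \<gamma>2[OF that] by auto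
    then have "{x \<in> Omega T t. (if x \<in> B then \<gamma> x else s) \<le> u} = {}" by blast
    then show ?thesis by (simp only: sets.empty_sets)
  qed
qed

text \<open>The pasting inequality accepts only grid times not before s. Early stops are moved to T
  rather than to s because T lies in every grid; where \<tau> is at least s, nothing
  changes.\<close>

lemma stop_late:
  fixes \<tau> :: "'d path \<Rightarrow> real"
  assumes t: "t \<in> {0..T}" and s: "s \<in> {t..T}" and \<tau>: "\<tau> \<in> dyadic_stops T t n"
  shows "(\<lambda>x. if s \<le> \<tau> x then \<tau> x else T) \<in> dyadic_stops_from T t s n" (is "?\<tau> \<in> _")
proof -
  note \<tau>1 = dyadic_stops_subset[OF \<tau>]
  have st: "?\<tau> \<in> stops T t"
  proof (rule stopsI)
    show "?\<tau> x \<in> {t..T}" if "x \<in> Omega T t" for x using stops_range[OF \<tau>1 that] t by auto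
    show "{x \<in> Omega T t. ?\<tau> x \<le> u} \<in> sets (canon_filt T t u)" if u: "u \<in> {t..<T}" for u
    proof (cases "s \<le> u")
      case True
      have "{x \<in> Omega T t. \<tau> x < s} \<in> sets (canon_filt T t u)"
        using stops_sets_less[OF \<tau>1] sets_canon_filt_mono[OF True] by blast
      moreover have "{x \<in> Omega T t. ?\<tau> x \<le> u} = {x \<in> Omega T t. \<tau> x \<le> u} - {x \<in> Omega T t. \<tau> x < s}"
        using u by auto
      ultimately show ?thesis using stops_sets[OF \<tau>1, of u] by (simp only: sets.Diff)
    next
      case False
      then have "{x \<in> Omega T t. ?\<tau> x \<le> u} = {}" using u by auto
      then show ?thesis by (simp only: sets.empty_sets)
    qed
  qed
  have "?\<tau> \<in> dyadic_stops T t n"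
  proof (cases n)
    case (enat m)
    have "(\<lambda>_::'d path. T) \<in> dyadic_stops T t n" using const_in_dyadic_stops[OF T_pos t, of T n] by simp
    then have T: "T \<in> (\<lambda>i. max t (real i * T / 2 ^ m)) ` {0..2 ^ m}" if "x \<in> Omega T t" for x :: "'d path"
      using that unfolding dyadic_stops_def enat enat.case by blast
    have "?\<tau> x \<in> (\<lambda>i. max t (real i * T / 2 ^ m)) ` {0..2 ^ m}" if "x \<in> Omega T t" for x
      using \<tau> T[OF that] that unfolding dyadic_stops_def enat enat.case by simp blast
    then show ?thesis using st unfolding dyadic_stops_def enat enat.case by blast
  qed (use st in \<open>simp add: dyadic_stops_def\<close>)
  then show ?thesis using st s by (auto simp: dyadic_stops_from_def stops_from_def)
qed

text \<open>The minimizer follows \<gamma>' on the ball B and stops at s off it. Against any \<tau>,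
  the pasting inequality is spent on the event that \<tau> is at least s and the path lies in B;
  elsewhere the payoff is compared pointwise with the value at s. In the error, e and r are the
  defects of optimality and of pasting, the term with \<open>\<rho>\<^sub>0\<close> moves P1 from
  \<omega> to nearby prefixes, \<eta> K is the running payoff, and c bounds the mean of the random
  errors.\<close>

lemma upper_estimate_core:
  fixes \<omega> :: "'d path"
  assumes ts: "0 \<le> t" "t < s" "s \<le> T" and w: "\<omega> \<in> Omega T 0"
    and osc: "\<And>u v. u \<in> {t..s} \<Longrightarrow> v \<in> {t..s} \<Longrightarrow> norm (\<omega> u - \<omega> v) \<le> \<eta>" and eta: "s - t \<le> \<eta>" "\<eta> \<le> \<delta> / 2"
    and K: "\<And>X. X \<in> {g, L, U} \<Longrightarrow> \<bar>X s \<omega>\<bar> \<le> K"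
    and \<rho>: "modulus \<rho>" "\<And>x. 0 \<le> x \<Longrightarrow> \<rho>\<^sub>0 x \<le> \<rho> x" "0 < \<rho> (\<delta> / 2)" and d: "0 < \<delta>"
    and P1: "P1 \<in> \<P> s \<omega>" and \<sigma>: "\<sigma> \<in> stops T s"
    and opt: "(SUP \<tau>\<in>dyadic_stops T s n. \<J> s \<omega> P1 \<tau> \<sigma>) \<le> val T g L U \<P> n s \<omega> + e"
    and P: "P \<in> \<P> t \<omega>" and Ph: "Ph \<in> \<P> t \<omega>" and \<gamma>': "\<gamma>' \<in> stops_from T t s"
    and B: "B = path_ball T t s \<delta> (tail T t \<omega>)"
    and meas: "\<And>A. A \<in> sets (canon_filt T t s) \<Longrightarrow> measure Ph (A \<inter> B) = measure P (A \<inter> B)"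
    and pay: "\<And>A \<tau>. A \<in> sets (canon_filt T t s) \<Longrightarrow> \<tau> \<in> dyadic_stops_from T t s n \<Longrightarrow>
          (\<integral>x. indicator (A \<inter> B) x * payoff T g L U t \<omega> \<tau> \<gamma>' x \<partial>Ph)
          \<le> (\<integral>x. indicator (A \<inter> B) x *
               ((SUP \<tau>\<in>dyadic_stops T s n. \<J> s (paste T 0 t \<omega> x) P1 \<tau> \<sigma>)
                + (LBINT r:{t..s}. shift_proc T g t \<omega> r x)) \<partial>P) + r"
    and intD: "\<And>Q. Q \<in> \<P> t \<omega> \<Longrightarrow> integrable Q (\<lambda>x. \<rho> (2 * \<eta> + supnorm t s x)) \<and>
          (\<integral>x. \<rho> (2 * \<eta> + supnorm t s x) \<partial>Q) \<le> c"
    and e: "0 \<le> e"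
  shows "val T g L U \<P> n t \<omega> \<le> val T g L U \<P> n s \<omega> + (e + (1 + T) * \<rho>\<^sub>0 \<delta> + r + \<eta> * K + (1 + 2 * T + 2 * K / \<rho> (\<delta> / 2)) * c)"
proof -
  define V where "V = val T g L U \<P> n s \<omega>"
  define D where "D x = \<rho> (2 * \<eta> + supnorm t s x)" for x :: "'d path"
  define G where "G x = (LBINT r:{t..s}. shift_proc T g t \<omega> r x)" for x
  define S where "S x = (SUP \<tau>\<in>dyadic_stops T s n. \<J> s (paste T 0 t \<omega> x) P1 \<tau> \<sigma>)" for x
  \<comment> \<open>1 + T collects the terminal and the running deviation; the last term is the
    Markov price of an excess of 2 K off the ball. One more T c arises under P from the running
    payoff on A \<inter> B.\<close>
  define C where "C = 1 + T + 2 * K / \<rho> (\<delta> / 2)"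
  have t: "t \<in> {0..T}" and s: "s \<in> {0..T}" "s \<in> {t..T}" using ts by auto
  note hP = class_hat_probs[OF t w P] and hPh = class_hat_probs[OF t w Ph] and hP1 = class_hat_probs[OF s(1) w P1]
  interpret P: prob_space P by (rule hat_probsD[OF hP])
  interpret Ph: prob_space Ph by (rule hat_probsD[OF hPh])
  note spP = hat_probsD(3)[OF hP] and spPh = hat_probsD(3)[OF hPh]
  note mP = measurable_cong_sets[OF hat_probsD(2)[OF hP] refl]
  have w': "tail T t \<omega> \<in> Omega T t" using ts w by (intro tail_in_Omega[of 0]) auto
  have w'': "paste T 0 t \<omega> (tail T t \<omega>) = \<omega>" using ts w by (intro paste_tail) auto
  have BF: "B \<in> sets (canon_filt T t s)" unfolding B using ts w' by (intro path_ball_sets) auto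
  have K0: "0 \<le> K" using K[of g] by auto
  have eta0: "0 \<le> \<eta>" using ts eta by simp
  have VK: "- K \<le> V" "L s \<omega> \<le> V" using val_ge_L[OF s(1) w, of n] K[of L] by (auto simp: V_def)
  have C: "1 + T \<le> C" using K0 \<rho>(3) T_pos by (simp add: C_def)
  have intD': "integrable P D" "integrable Ph D" "(\<integral>x. D x \<partial>P) \<le> c" "(\<integral>x. D x \<partial>Ph) \<le> c"
    using intD[OF P] intD[OF Ph] by (auto simp: D_def[abs_def])
  have S_nonneg: "0 \<le> supnorm t s x" if x: "x \<in> Omega T t" for x :: "'d path"
    using ts by (intro supnorm_nonneg Omega_continuous_on[OF x]) auto
  have D0: "0 \<le> D x" if "x \<in> Omega T t" for x
    unfolding D_def using S_nonneg[OF that] eta0 by (intro modulus_nonneg[OF \<rho>(1)]) auto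
  have near: "\<bar>shift_proc T X t \<omega> r x - X s \<omega>\<bar> \<le> D x"
    if "X \<in> {g, L, U, Psi L U}" "r \<in> {t..s}" "x \<in> Omega T t" for X r x
  proof -
    have "\<bar>shift_proc T X t \<omega> r x - X s \<omega>\<bar> \<le> \<rho>\<^sub>0 (2 * \<eta> + supnorm t s x)"
      using ts by (intro shift_near[OF w _ _ _ that(3) osc that(1,2) eta(1)]) auto
    also have "\<dots> \<le> D x" unfolding D_def using S_nonneg[OF that(3)] eta0 by (intro \<rho>(2)) auto
    finally show ?thesis .
  qed
  have int_g: "\<bar>LBINT r:{t..u}. shift_proc T g t \<omega> r x\<bar> \<le> \<eta> * K + T * D x"
    if u: "u \<in> {t..s}" and x: "x \<in> Omega T t" for u x
    using near[OF _ _ x] K[of g] by (intro integral_g_near[OF ts(1,3) eta(1) u w x]) auto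
  have S_near: "\<bar>S x - S y\<bar> \<le> (1 + T) * \<rho>\<^sub>0 (supnorm t s (\<lambda>r. x r - y r))"
    if x: "x \<in> Omega T t" and y: "y \<in> Omega T t" for x y
  proof -
    have pi: "paste T 0 t \<omega> x \<in> Omega T 0" "paste T 0 t \<omega> y \<in> Omega T 0"
      using ts w x y by (auto intro!: paste_in_Omega)
    have "supnorm 0 s (\<lambda>r. paste T 0 t \<omega> x r - paste T 0 t \<omega> y r) \<le> supnorm t s (\<lambda>r. x r - y r)"
      using ts by (intro supnorm_paste_diff x y) auto
    then have "(1 + T) * \<rho>\<^sub>0 (supnorm 0 s (\<lambda>r. paste T 0 t \<omega> x r - paste T 0 t \<omega> y r)) \<le> (1 + T) * \<rho>\<^sub>0 (supnorm t s (\<lambda>r. x r - y r))"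
      using T_pos ts
      by (intro mult_left_mono modulus_mono[OF modulus0] supnorm_nonneg continuous_on_diff Omega_continuous_on[OF pi(1)] Omega_continuous_on[OF pi(2)]) auto
    then show ?thesis
      unfolding S_def using SUP_payoffs_regular[OF s(1) pi hP1 \<sigma>, of n] by (rule order_trans[rotated])
  qed
  \<comment> \<open>A supremum over uncountably many stopping times: it is measurable because it is
    uniformly continuous in the path.\<close>
  have S_meas: "S \<in> borel_measurable P"
  proof -
    have "modulus (\<lambda>x. (1 + T) * \<rho>\<^sub>0 x)"
      using modulus0 T_pos tendsto_mult_left[of \<rho>\<^sub>0 0 "at_right 0" "1 + T"]
      by (auto simp: modulus_def mono_on_def intro: mult_left_mono)
    from measurable_canon_filt_T[OF path_functional_measurable[OF _ _ this S_near]] ts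
    show ?thesis unfolding mP by simp
  qed
  have G_meas: "G \<in> borel_measurable P"
    unfolding mP G_def[abs_def]
    by (rule measurable_process_integral[where T=T and \<tau>="\<lambda>_. s"])
      (use ts t in \<open>auto intro!: measurable_canon_filt_T[OF shift_measurable[OF _ t _ w]] shift_continuous[OF _ t w]\<close>)
  have S_ball: "\<bar>S x - S (tail T t \<omega>)\<bar> \<le> (1 + T) * \<rho>\<^sub>0 \<delta>" if "x \<in> B" for x
  proof -
    have x: "x \<in> Omega T t" "supnorm t s (\<lambda>r. x r - tail T t \<omega> r) < \<delta>" using that by (auto simp: B path_ball_def)
    have "(1 + T) * \<rho>\<^sub>0 (supnorm t s (\<lambda>r. x r - tail T t \<omega> r)) \<le> (1 + T) * \<rho>\<^sub>0 \<delta>"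
      using T_pos ts x
      by (intro mult_left_mono modulus_mono[OF modulus0] supnorm_nonneg continuous_on_diff Omega_continuous_on[OF w'] Omega_continuous_on[OF x(1)]) auto
    then show ?thesis using S_near[OF x(1) w'] by linarith
  qed
  have S_opt: "S (tail T t \<omega>) \<le> V + e" unfolding S_def w'' V_def by (rule opt)
  define \<gamma> where "\<gamma> x = (if x \<in> B then \<gamma>' x else s)" for x
  have \<gamma>: "\<gamma> \<in> stops T t" using stop_before_or_paste[OF ts(1) _ ts(3) \<gamma>' BF] ts by (simp add: \<gamma>_def[abs_def])
  have \<gamma>'s: "\<gamma>' \<in> stops T t" "\<And>x. x \<in> Omega T t \<Longrightarrow> s \<le> \<gamma>' x" using \<gamma>' by (auto simp: stops_from_def)
  \<comment> \<open>Markov's inequality in pointwise form: off the ball the path reaches norm at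
    least \<delta> - \<eta> \<ge> \<delta>/2, so D is at least \<rho>(\<delta>/2) there.\<close>
  have off_ball: "2 * K \<le> 2 * K / \<rho> (\<delta> / 2) * D x" if x: "x \<in> Omega T t" "x \<notin> B" for x
  proof -
    have "\<not> supnorm t s (\<lambda>r. x r - tail T t \<omega> r) < \<delta>" using x by (auto simp: B path_ball_def)
    moreover have "supnorm t s (\<lambda>r. x r - tail T t \<omega> r) \<le> supnorm t s x + \<eta>"
    proof (rule supnorm_le)
      fix r assume r: "r \<in> {t..s}"
      have "norm (x r - tail T t \<omega> r) \<le> norm (x r) + norm (tail T t \<omega> r)" by (rule norm_triangle_ineq4)
      also have "\<dots> \<le> supnorm t s x + \<eta>"
        using r ts osc[of r t] by (intro add_mono supnorm_ge Omega_continuous_on[OF x(1)]) (auto simp: tail_def)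
      finally show "norm (x r - tail T t \<omega> r) \<le> supnorm t s x + \<eta>" .
    qed (use ts in simp)
    ultimately have "\<rho> (\<delta> / 2) \<le> D x" unfolding D_def using eta eta0 d by (intro modulus_mono[OF \<rho>(1)]) auto
    then have "2 * K * \<rho> (\<delta> / 2) \<le> 2 * K * D x" using K0 by (intro mult_left_mono) auto
    then show ?thesis using \<rho>(3) by (simp add: field_simps)
  qed
  show ?thesis
  proof (rule val_le[OF t w Ph \<gamma>])
    fix \<tau> :: "'d path \<Rightarrow> real" assume \<tau>: "\<tau> \<in> dyadic_stops T t n"
    note \<tau>1 = dyadic_stops_subset[OF \<tau>]
    define A where "A = {x\<in>Omega T t. s \<le> \<tau> x}"
    define \<tau>' where "\<tau>' x = (if s \<le> \<tau> x then \<tau> x else T)" for x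
    have \<tau>': "\<tau>' \<in> dyadic_stops_from T t s n" using stop_late[OF t s(2) \<tau>] by (simp add: \<tau>'_def[abs_def])
    then have \<tau>'s: "\<tau>' \<in> stops T t" by (auto simp: dyadic_stops_from_def stops_from_def)
    have "A = space (canon_filt T t s) - {x\<in>Omega T t. \<tau> x < s}" by (auto simp: A_def)
    also have "\<dots> \<in> sets (canon_filt T t s)" by (rule sets.compl_sets[OF stops_sets_less[OF \<tau>1]])
    finally have AF: "A \<in> sets (canon_filt T t s)" .
    have ABF: "A \<inter> B \<in> sets (canon_filt T t T)"
      by (rule subsetD[OF sets_canon_filt_mono[OF ts(3)] sets.Int[OF AF BF]])
    have AB[measurable]: "A \<inter> B \<in> sets P" "A \<inter> B \<in> sets Ph"
      using ABF unfolding hat_probsD(2)[OF hP] hat_probsD(2)[OF hPh] by simp_all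
    have AB_sub: "A \<inter> B \<subseteq> Omega T t" by (auto simp: A_def)
    let ?i = "indicat_real (A \<inter> B)"
    have ind: "integrable P ?i" "integrable Ph ?i"
      using AB by (auto intro!: integrable_real_indicator simp: less_top[symmetric])
    have ptw: "payoff T g L U t \<omega> \<tau> \<gamma> x \<le> ?i x * payoff T g L U t \<omega> \<tau>' \<gamma>' x + ((1 - ?i x) * (V + \<eta> * K) + C * D x)"
      if x: "x \<in> Omega T t" for x
    proof (cases "x \<in> A \<inter> B")
      case True
      then have "payoff T g L U t \<omega> \<tau> \<gamma> x = payoff T g L U t \<omega> \<tau>' \<gamma>' x"
        by (simp add: payoff_def \<gamma>_def \<tau>'_def A_def)
      then show ?thesis using True D0[OF x] C T_pos by simp
    next
      case False
      have CD: "(1 + T) * D x \<le> C * D x" using C D0[OF x] by (rule mult_right_mono)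
      have \<tau>r: "\<tau> x \<in> {t..T}" using stops_range[OF \<tau>1 x] .
      have gs: "s \<le> \<gamma> x" using \<gamma>'s(2)[OF x] by (simp add: \<gamma>_def)
      have "payoff T g L U t \<omega> \<tau> \<gamma> x \<le> V + \<eta> * K + C * D x"
      proof (cases "\<tau> x \<le> s")
        \<comment> \<open>Stopping by time s earns L, a tie at s included, and L at (s, \<omega>) is
          at most the value.\<close>
        case True
        then have "payoff T g L U t \<omega> \<tau> \<gamma> x = (LBINT r:{t..\<tau> x}. shift_proc T g t \<omega> r x) + shift_proc T L t \<omega> (\<tau> x) x"
          using gs by (simp add: payoff_def min_def)
        also have "\<dots> \<le> (\<eta> * K + T * D x) + (V + D x)"
          using int_g[of "\<tau> x" x] near[of L "\<tau> x" x] True \<tau>r x VK by (intro add_mono) (auto simp: abs_le_iff)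
        finally show ?thesis using CD by (simp add: algebra_simps)
      next
        \<comment> \<open>Now \<tau> exceeds s, so x is in A and must lie outside B. The minimizer
          stops at s and pays nearly U at (s, \<omega>), which is at most K, while V is at least
          -K.\<close>
        case \<tau>s: False
        then have xB: "x \<notin> B" using False x by (auto simp: A_def)
        then have "payoff T g L U t \<omega> \<tau> \<gamma> x = (LBINT r:{t..s}. shift_proc T g t \<omega> r x) + shift_proc T U t \<omega> s x"
          using \<tau>s by (simp add: payoff_def \<gamma>_def min_def)
        also have "\<dots> \<le> (\<eta> * K + T * D x) + (V + 2 * K + D x)"
          using int_g[of s x] near[of U s x] ts x VK(1) K[of U] by (intro add_mono) (auto simp: abs_le_iff)
        finally show ?thesis using off_ball[OF x xB] by (simp add: C_def algebra_simps)
      qed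
      then show ?thesis using False by simp
    qed
    have int1: "integrable Ph (\<lambda>x. ?i x * payoff T g L U t \<omega> \<tau>' \<gamma>' x)"
      by (intro integrable_real_mult_indicator[OF AB(2), unfolded mult.commute[of _ "indicator _ _"]] integrable_payoff(1)[OF t w hPh \<tau>'s \<gamma>'s(1)])
    have int2: "integrable Ph (\<lambda>x. (1 - ?i x) * (V + \<eta> * K))" "integrable Ph (\<lambda>x. C * D x)"
      using intD'(2) ind by (auto intro!: integrable_mult_left Bochner_Integration.integrable_diff)
    have "\<J> t \<omega> Ph \<tau> \<gamma> \<le> (\<integral>x. ?i x * payoff T g L U t \<omega> \<tau>' \<gamma>' x + ((1 - ?i x) * (V + \<eta> * K) + C * D x) \<partial>Ph)"
      using ptw spPh int1 int2
      by (intro integral_mono integrable_payoff(1)[OF t w hPh \<tau>1 \<gamma>] Bochner_Integration.integrable_add) auto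
    also have "\<dots> = (\<integral>x. ?i x * payoff T g L U t \<omega> \<tau>' \<gamma>' x \<partial>Ph) + ((1 - measure Ph (A \<inter> B)) * (V + \<eta> * K) + C * (\<integral>x. D x \<partial>Ph))"
      using int1 int2 intD'(2) AB ind by (simp add: Ph.prob_space Bochner_Integration.integral_diff)
    also have "(\<integral>x. ?i x * payoff T g L U t \<omega> \<tau>' \<gamma>' x \<partial>Ph) \<le> (\<integral>x. ?i x * (S x + G x) \<partial>P) + r"
      using pay[OF AF \<tau>'] unfolding S_def G_def .
    also have "(\<integral>x. ?i x * (S x + G x) \<partial>P) \<le> (\<integral>x. ?i x * (V + e + (1 + T) * \<rho>\<^sub>0 \<delta> + \<eta> * K) + T * D x \<partial>P)"
    proof (rule integral_mono)
      show "integrable P (\<lambda>x. ?i x * (V + e + (1 + T) * \<rho>\<^sub>0 \<delta> + \<eta> * K) + T * D x)"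
        using intD'(1) ind by (intro Bochner_Integration.integrable_add integrable_mult_left integrable_mult_right) auto
      show "integrable P (\<lambda>x. ?i x * (S x + G x))"
      proof (rule Bochner_Integration.integrable_bound)
        let ?b = "\<bar>S (tail T t \<omega>)\<bar> + (1 + T) * \<rho>\<^sub>0 \<delta> + \<eta> * K"
        show "integrable P (\<lambda>x. ?b + T * D x)" using intD'(1) by simp
        show "(\<lambda>x. ?i x * (S x + G x)) \<in> borel_measurable P" using S_meas G_meas by measurable
        have "norm (?i x * (S x + G x)) \<le> norm (?b + T * D x)" if "x \<in> Omega T t" for x
          using that int_g[of s x] S_ball[of x] ts D0[OF that] T_pos K0 eta0 modulus_nonneg[OF modulus0, of \<delta>] d
          by (cases "x \<in> A \<inter> B") (auto simp: G_def)
        then show "AE x in P. norm (?i x * (S x + G x)) \<le> norm (?b + T * D x)" using spP by (intro AE_I2) auto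
      qed
      show "?i x * (S x + G x) \<le> ?i x * (V + e + (1 + T) * \<rho>\<^sub>0 \<delta> + \<eta> * K) + T * D x" if "x \<in> space P" for x
        using that spP int_g[of s x] S_ball[of x] S_opt ts D0[of x] T_pos
        by (cases "x \<in> A \<inter> B") (auto simp: G_def abs_le_iff)
    qed
    also have "\<dots> = measure P (A \<inter> B) * (V + e + (1 + T) * \<rho>\<^sub>0 \<delta> + \<eta> * K) + T * (\<integral>x. D x \<partial>P)"
      using intD'(1) AB ind by simp
    finally have le: "\<J> t \<omega> Ph \<tau> \<gamma> \<le> measure P (A \<inter> B) * (V + e + (1 + T) * \<rho>\<^sub>0 \<delta> + \<eta> * K) + T * (\<integral>x. D x \<partial>P) + r
        + ((1 - measure Ph (A \<inter> B)) * (V + \<eta> * K) + C * (\<integral>x. D x \<partial>Ph))" by simp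
    have "T * (\<integral>x. D x \<partial>P) \<le> T * c" "C * (\<integral>x. D x \<partial>Ph) \<le> C * c"
      using intD' T_pos C by (auto intro!: mult_left_mono)
    moreover have "measure P (A \<inter> B) * (e + (1 + T) * \<rho>\<^sub>0 \<delta>) \<le> 1 * (e + (1 + T) * \<rho>\<^sub>0 \<delta>)"
      using e T_pos modulus_nonneg[OF modulus0, of \<delta>] d by (intro mult_right_mono) auto
    ultimately show "\<J> t \<omega> Ph \<tau> \<gamma> \<le> val T g L U \<P> n s \<omega> + (e + (1 + T) * \<rho>\<^sub>0 \<delta> + r + \<eta> * K + (1 + 2 * T + 2 * K / \<rho> (\<delta> / 2)) * c)"
      \<comment> \<open>P and Ph give A \<inter> B the same mass, so the two weights of V + \<eta> K
        add up to exactly 1. As V may have either sign, an inequality between the masses would not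
        be enough.\<close>
      using le unfolding meas[OF AF] V_def[symmetric] C_def by (simp add: algebra_simps)
  qed
qed

end

lemma uniformly_small_oscillation:
  assumes w: "\<omega> \<in> Omega T 0" and "0 < \<eta>"
  obtains h where "0 < h"
    "\<And>t s u v. 0 \<le> t \<Longrightarrow> s \<le> T \<Longrightarrow> s - t < h \<Longrightarrow> u \<in> {t..s} \<Longrightarrow> v \<in> {t..s} \<Longrightarrow> norm (\<omega> u - \<omega> v) \<le> \<eta>"
proof -
  have "uniformly_continuous_on {0..T} \<omega>"
    by (intro compact_uniformly_continuous Omega_continuous_on[OF w]) auto
  then obtain h where h: "0 < h" "\<And>x x'. x \<in> {0..T} \<Longrightarrow> x' \<in> {0..T} \<Longrightarrow> dist x' x < h \<Longrightarrow> dist (\<omega> x') (\<omega> x) < \<eta>"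
    using assms(2) unfolding uniformly_continuous_on_def by meson
  show ?thesis
  proof (rule that[OF h(1)])
    fix t s u v assume *: "0 \<le> t" "s \<le> T" "s - t < h" "u \<in> {t..s}" "v \<in> {t..s}"
    then have "dist u v < h" by (auto simp: dist_real_def)
    then have "dist (\<omega> u) (\<omega> v) < \<eta>" using * by (intro h(2)) auto
    then show "norm (\<omega> u - \<omega> v) \<le> \<eta>" by (simp add: dist_norm)
  qed
qed

section \<open>Bounds along a path, and the degenerate case of a modulus vanishing right of
  0\<close>

context payoff_processes
begin

lemma processes_bounded:
  assumes w: "\<omega> \<in> Omega T 0"
  obtains K where "0 \<le> K" "\<And>X s. X \<in> {g, L, U} \<Longrightarrow> s \<in> {0..T} \<Longrightarrow> \<bar>X s \<omega>\<bar> \<le> K"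
proof -
  have "\<exists>k. \<forall>s\<in>{0..T}. \<bar>X s \<omega>\<bar> \<le> k" if "X \<in> {g, L, U}" for X
    using bdd_above_norm_path[OF process_continuous[OF _ w, of X]] that by (auto simp: bdd_above_def)
  then obtain k where k: "\<And>X s. X \<in> {g, L, U} \<Longrightarrow> s \<in> {0..T} \<Longrightarrow> \<bar>X s \<omega>\<bar> \<le> k X" by metis
  have 0: "0 \<le> k X" if "X \<in> {g, L, U}" for X
    using k[OF that, of 0] T_pos by (auto intro: order_trans[OF abs_ge_zero])
  show ?thesis
  proof (rule that[of "k g + k L + k U"])
    show "0 \<le> k g + k L + k U" using 0[of g] 0[of L] 0[of U] by simp
    show "\<bar>X s \<omega>\<bar> \<le> k g + k L + k U" if "X \<in> {g, L, U}" "s \<in> {0..T}" for X s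
      using k[OF that] 0[of g] 0[of L] 0[of U] that(1) by auto
  qed
qed

text \<open>If the modulus vanishes near \<open>0\<close>, the processes are constant: join \<open>(s, \<omega>)\<close> to
  \<open>(s, 0)\<close> by scaling the path, and \<open>(s, 0)\<close> to \<open>(0, 0)\<close> by scaling time.\<close>

lemma processes_constant:
  assumes X: "X \<in> {g, L, U, Psi L U}" and x0: "0 < x0" "\<rho>\<^sub>0 x0 = 0" and w: "\<omega> \<in> Omega T 0" and s: "s \<in> {0..T}"
  shows "X s \<omega> = X 0 (null_path T)"
proof -
  have n: "null_path T \<in> Omega T 0" using T_pos by (intro null_path_in_Omega) simp
  \<comment> \<open>With N steps each scaling moves the path by at most its norm over N, and the
    time by at most T / N. Both stay within x0, where the modulus is 0.\<close>
  obtain N where N: "max (supnorm 0 T \<omega>) T / x0 < real N" using reals_Archimedean2 by blast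
  have "0 < T / x0" using T_pos x0 by simp
  moreover have "T / x0 \<le> max (supnorm 0 T \<omega>) T / x0" using x0 by (intro divide_right_mono) auto
  ultimately have "0 < real N" using N by linarith
  then have small: "supnorm 0 T \<omega> / N \<le> x0" "T / N \<le> x0"
    using N x0 by (auto simp: field_simps max_def split: if_splits)
  define sc where "sc k = (\<lambda>r\<in>{0..T}. (real k / N) *\<^sub>R \<omega> r)" for k
  have sc: "sc k \<in> Omega T 0" for k
  proof -
    have "continuous_on {0..T} (\<lambda>r. (real k / N) *\<^sub>R \<omega> r)"
      by (intro continuous_intros Omega_continuous_on[OF w]) auto
    then have "continuous_on {0..T} (sc k)"
      by (rule continuous_on_cong[THEN iffD1, rotated -1]) (auto simp: sc_def)
    then show ?thesis using T_pos Omega_start[OF w] by (auto simp: Omega_def sc_def)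
  qed
  have zero: "a = b" if "\<bar>a - b\<bar> \<le> \<rho>\<^sub>0 x0" for a b :: real using that x0 by simp
  have path: "X s (sc k) = X s (sc 0)" for k
  proof (induction k)
    case (Suc k)
    have "X s (sc (Suc k)) = X s (sc k)"
    proof (rule zero, rule regularity[OF X s s sc sc])
      show "\<bar>s - s\<bar> + supnorm 0 T \<omega> / N \<le> x0" using small by simp
      show "norm (sc (Suc k) (min v s) - sc k (min v s)) \<le> supnorm 0 T \<omega> / N" if "v \<in> {0..T}" for v
      proof -
        have r: "min v s \<in> {0..T}" using that s by auto
        then have "sc (Suc k) (min v s) - sc k (min v s) = (1 / N) *\<^sub>R \<omega> (min v s)"
          by (simp add: sc_def scaleR_left_diff_distrib[symmetric] diff_divide_distrib[symmetric])
        then show ?thesis using supnorm_ge[OF Omega_continuous_on[OF w order_refl] r] by (simp add: divide_right_mono)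
      qed
    qed
    with Suc show ?case by simp
  qed simp
  have "sc N = \<omega>" using w \<open>0 < real N\<close> by (auto simp: sc_def fun_eq_iff Omega_def extensional_def)
  moreover have "sc 0 = null_path T" by (auto simp: sc_def null_path_def)
  ultimately have 1: "X s \<omega> = X s (null_path T)" using path[of N] by simp
  \<comment> \<open>Capping k at N keeps the times in [0,s], so that the induction can run over all
    k.\<close>
  have time: "X (real (min k N) / N * s) (null_path T) = X 0 (null_path T)" for k
  proof (induction k)
    case (Suc k)
    have in_T: "real (min k N) / N * s \<in> {0..T}" for k
    proof -
      have "real (min k N) / N * s \<le> 1 * s" using s \<open>0 < real N\<close> by (intro mult_right_mono) (auto simp: divide_le_eq)
      then show ?thesis using s by auto
    qed
    have "X (real (min (Suc k) N) / N * s) (null_path T) = X (real (min k N) / N * s) (null_path T)"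
    proof (rule zero, rule regularity[OF X in_T in_T n n])
      have "\<bar>real (min (Suc k) N) / N * s - real (min k N) / N * s\<bar> \<le> 1 / N * T"
        unfolding left_diff_distrib[symmetric] diff_divide_distrib[symmetric] abs_mult
        using s by (intro mult_mono) (auto simp: min_def intro!: divide_right_mono)
      then show "\<bar>real (min (Suc k) N) / N * s - real (min k N) / N * s\<bar> + 0 \<le> x0" using small by simp
      show "norm (null_path T (min v (real (min (Suc k) N) / N * s)) - null_path T (min v (real (min k N) / N * s))) \<le> 0"
        if "v \<in> {0..T}" for v
        using that in_T[of k] in_T[of "Suc k"] by (auto simp: null_path_def min_def)
    qed
    with Suc show ?case by simp
  qed simp
  show ?thesis using 1 time[of N] \<open>0 < real N\<close> by simp
qed

end

context game_class
begin

text \<open>With constant payoffs a few constant strategies decide. \<gamma> = T and \<gamma> = t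
  bound the earlier value by min u (l + max c 0 (T - t)); at s, \<tau> = T for nonnegative c and
  \<tau> = s for negative c secure the same expression with s in place of t. The two differ by at
  most max c 0 (s - t).\<close>

lemma val_upper_constant:
  assumes const: "\<And>s \<omega>. s \<in> {0..T} \<Longrightarrow> \<omega> \<in> Omega T 0 \<Longrightarrow> g s \<omega> = c \<and> L s \<omega> = l \<and> U s \<omega> = u"
    and w: "\<omega> \<in> Omega T 0" and ts: "0 \<le> t" "t \<le> s" "s \<le> T"
  shows "val T g L U \<P> n t \<omega> \<le> val T g L U \<P> n s \<omega> + max c 0 * (s - t)"
proof -
  have payoff_eq: "payoff T g L U t \<omega> \<tau> \<gamma> x = (min (\<tau> x) (\<gamma> x) - t) * c + (if \<tau> x \<le> \<gamma> x then l else u)"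
    if t: "t \<in> {0..T}" and x: "x \<in> Omega T t" and st: "\<tau> x \<in> {t..T}" "\<gamma> x \<in> {t..T}" for t x \<tau> \<gamma>
  proof -
    have pi: "paste T 0 t \<omega> x \<in> Omega T 0" using t w x by (intro paste_in_Omega) auto
    have "(LBINT r:{t..min (\<tau> x) (\<gamma> x)}. shift_proc T g t \<omega> r x) = (LBINT r:{t..min (\<tau> x) (\<gamma> x)}. c)"
      using st t const[OF _ pi] by (intro set_lebesgue_integral_cong) (auto simp: shift_proc_def)
    also have "\<dots> = (min (\<tau> x) (\<gamma> x) - t) * c" using st by (simp add: set_lebesgue_integral_def)
    finally show ?thesis using st t const[OF _ pi] by (simp add: payoff_def shift_proc_def)
  qed
  have t: "t \<in> {0..T}" and s: "s \<in> {0..T}" using ts by auto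
  obtain P where P: "P \<in> \<P> t \<omega>" using class_nonempty[OF t w] by blast
  note hP = class_hat_probs[OF t w P]
  interpret P: prob_space P by (rule hat_probsD[OF hP])
  have cT: "(\<lambda>_. T) \<in> stops T t" using ts by (intro const_in_stops) auto
  have "val T g L U \<P> n t \<omega> \<le> l + max c 0 * (T - t)"
  proof (rule val_le[OF t w P cT])
    fix \<tau> :: "'d path \<Rightarrow> real" assume \<tau>: "\<tau> \<in> dyadic_stops T t n"
    note \<tau>1 = dyadic_stops_subset[OF \<tau>]
    have "\<J> t \<omega> P \<tau> (\<lambda>_. T) \<le> (\<integral>x. l + max c 0 * (T - t) \<partial>P)"
    proof (rule integral_mono[OF integrable_payoff(1)[OF t w hP \<tau>1 cT]])
      fix x assume "x \<in> space P"
      then have x: "x \<in> Omega T t" using hat_probsD(3)[OF hP] by simp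
      have r: "\<tau> x \<in> {t..T}" by (rule stops_range[OF \<tau>1 x])
      have "(\<tau> x - t) * c \<le> (\<tau> x - t) * max c 0" using r by (intro mult_left_mono) auto
      also have "\<dots> \<le> (T - t) * max c 0" using r by (intro mult_right_mono) auto
      finally show "payoff T g L U t \<omega> \<tau> (\<lambda>_. T) x \<le> l + max c 0 * (T - t)"
        using payoff_eq[where \<tau>=\<tau> and \<gamma>="\<lambda>_. T", OF t x r] r ts by (simp add: mult.commute)
    qed simp
    then show "\<J> t \<omega> P \<tau> (\<lambda>_. T) \<le> l + max c 0 * (T - t)" by (simp add: P.prob_space)
  qed
  moreover have "val T g L U \<P> n t \<omega> \<le> u" using val_le_U[OF t w, of n] const[OF t w] by simp
  moreover have "min u (l + max c 0 * (T - s)) \<le> val T g L U \<P> n s \<omega>"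
  proof (rule val_greatest[OF s w])
    fix P and \<gamma> :: "'d path \<Rightarrow> real" assume *: "P \<in> \<P> s \<omega>" and \<gamma>: "\<gamma> \<in> stops T s"
    note hP = class_hat_probs[OF s w *]
    interpret P': prob_space P by (rule hat_probsD[OF hP])
    show "\<exists>\<tau>\<in>dyadic_stops T s n. min u (l + max c 0 * (T - s)) \<le> \<J> s \<omega> P \<tau> \<gamma>"
    \<comment> \<open>For nonnegative c the maximizer waits until T and receives at least u if
      \<gamma> comes first, otherwise l and the full running payoff. For negative c waiting only
      loses, and stopping at once earns l.\<close>
    proof (cases "0 \<le> c")
      case True
      have T: "(\<lambda>_. T) \<in> dyadic_stops T s n" using const_in_dyadic_stops[OF T_pos s, of T n] by simp
      have "(\<integral>x. min u (l + max c 0 * (T - s)) \<partial>P) \<le> \<J> s \<omega> P (\<lambda>_. T) \<gamma>"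
      proof (rule integral_mono[OF _ integrable_payoff(1)[OF s w hP dyadic_stops_subset[OF T] \<gamma>]])
        fix x assume "x \<in> space P"
        then have x: "x \<in> Omega T s" using hat_probsD(3)[OF hP] by simp
        have r: "\<gamma> x \<in> {s..T}" by (rule stops_range[OF \<gamma> x])
        have "0 \<le> c * (\<gamma> x - s)" using r True by simp
        then show "min u (l + max c 0 * (T - s)) \<le> payoff T g L U s \<omega> (\<lambda>_. T) \<gamma> x"
          using payoff_eq[where \<tau>="\<lambda>_. T" and \<gamma>=\<gamma>, OF s x _ r] r s True by (auto simp: mult.commute min_le_iff_disj)
      qed simp
      then show ?thesis by (intro bexI[OF _ T]) (simp add: P'.prob_space)
    next
      case False
      have s': "(\<lambda>_. s) \<in> dyadic_stops T s n" using const_in_dyadic_stops[OF T_pos s, of s n] by simp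
      then show ?thesis using expected_payoff_stop_at_start[OF s w hP \<gamma>] const[OF s w] False
        by (intro bexI[OF _ s']) (simp add: max_def)
    qed
  qed
  moreover have "max c 0 * (T - t) = max c 0 * (T - s) + max c 0 * (s - t)" by (simp add: algebra_simps)
  moreover have "0 \<le> max c 0 * (s - t)" using ts by simp
  ultimately show ?thesis by linarith
qed

text \<open>h is uniform in t, s and n because every bound in the core estimate depends on \<omega>
  and the moduli only. Each of the five error terms there receives \<epsilon> / 5.\<close>

lemma val_upper:
  fixes \<omega> :: "'d path"
  assumes ws: "weakly_stable_pasting T g L U \<P>" and osc: "oscillation_bound T \<P> \<rho>"
    and \<rho>: "modulus \<rho>" "\<And>x. 0 \<le> x \<Longrightarrow> \<rho>\<^sub>0 x \<le> \<rho> x" and w: "\<omega> \<in> Omega T 0" and eps: "0 < \<epsilon>"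
  obtains h where "0 < h" "\<And>t s n. 0 \<le> t \<Longrightarrow> t < s \<Longrightarrow> s \<le> T \<Longrightarrow> s - t < h \<Longrightarrow> 1 \<le> n \<Longrightarrow>
    val T g L U \<P> n t \<omega> \<le> val T g L U \<P> n s \<omega> + \<epsilon>"
proof (cases "\<exists>x>0. \<rho> x = 0")
  \<comment> \<open>The Markov threshold can be 0 here; then \<open>\<rho>\<^sub>0\<close> vanishes
    near 0 too and the payoffs are constant.\<close>
  case True
  then obtain x0 where x0: "0 < x0" "\<rho> x0 = 0" by blast
  have "\<rho>\<^sub>0 x0 = 0" using \<rho>(2)[of x0] modulus_nonneg[OF modulus0, of x0] x0 by simp
  note const = processes_constant[OF _ x0(1) this]
  let ?n = "null_path T" and ?c = "g 0 (null_path T)"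
  have le: "val T g L U \<P> n t \<omega> \<le> val T g L U \<P> n s \<omega> + max ?c 0 * (s - t)"
    if "0 \<le> t" "t \<le> s" "s \<le> T" for t s n
    by (rule val_upper_constant[OF _ w that, where l="L 0 ?n" and u="U 0 ?n"]) (use const in auto)
  \<comment> \<open>The added 1 keeps the divisor positive when the slope max c 0 is 0.\<close>
  have c: "0 < max ?c 0 + 1" by simp
  show ?thesis
  proof (rule that)
    show "0 < \<epsilon> / (max ?c 0 + 1)" using eps c by simp
    fix t s :: real and n :: enat assume *: "0 \<le> t" "t < s" "s \<le> T" "s - t < \<epsilon> / (max ?c 0 + 1)"
    have "max ?c 0 * (s - t) \<le> (max ?c 0 + 1) * (s - t)" using * by (intro mult_right_mono) auto
    also have "\<dots> \<le> \<epsilon>" using *(4) c by (simp add: pos_less_divide_eq mult.commute)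
    finally show "val T g L U \<P> n t \<omega> \<le> val T g L U \<P> n s \<omega> + \<epsilon>" using le[of t s n] * by simp
  qed
next
  case False
  then have \<rho>pos: "0 < \<rho> x" if "0 < x" for x using modulus_nonneg[OF \<rho>(1), of x] that by (metis less_eq_real_def)
  obtain K where K: "0 \<le> K" "\<And>X s. X \<in> {g, L, U} \<Longrightarrow> s \<in> {0..T} \<Longrightarrow> \<bar>X s \<omega>\<bar> \<le> K"
    using processes_bounded[OF w] by blast
  obtain \<rho>p where \<rho>p: "modulus \<rho>p" and pasting: "\<And>t s \<omega> P \<delta> P1 n \<gamma>. 0 \<le> t \<Longrightarrow> t < s \<Longrightarrow> s \<le> T \<Longrightarrow> \<omega> \<in> Omega T 0 \<Longrightarrow> P \<in> \<P> t \<omega> \<Longrightarrow> P1 \<in> \<P> s \<omega> \<Longrightarrow>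
      0 < \<delta> \<Longrightarrow> \<delta> \<in> \<rat> \<Longrightarrow> \<gamma> \<in> stops T s \<Longrightarrow> 1 \<le> n \<Longrightarrow>
      \<exists>Ph\<in>\<P> t \<omega>. \<exists>\<gamma>'\<in>stops_from T t s. \<forall>A\<in>sets (canon_filt T t s).
        measure Ph (A \<inter> path_ball T t s \<delta> (tail T t \<omega>)) = measure P (A \<inter> path_ball T t s \<delta> (tail T t \<omega>)) \<and>
        (\<forall>\<tau>\<in>dyadic_stops_from T t s n.
          (\<integral>x. indicator (A \<inter> path_ball T t s \<delta> (tail T t \<omega>)) x * payoff T g L U t \<omega> \<tau> \<gamma>' x \<partial>Ph)
          \<le> (\<integral>x. indicator (A \<inter> path_ball T t s \<delta> (tail T t \<omega>)) x *
               ((SUP \<sigma>\<in>dyadic_stops T s n. \<J> s (paste T 0 t \<omega> x) P1 \<sigma> \<gamma>)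
                + (LBINT r:{t..s}. shift_proc T g t \<omega> r x)) \<partial>P) + \<rho>p \<delta>)"
    by (rule single_pasting[OF ws]) blast
  obtain \<rho>' where \<rho>': "modulus \<rho>'" and expect: "\<And>t s c P. 0 \<le> t \<Longrightarrow> t < s \<Longrightarrow> s \<le> T \<Longrightarrow> s - t \<le> c \<Longrightarrow> c \<le> T \<Longrightarrow> P \<in> \<P> t \<omega> \<Longrightarrow>
      integrable P (\<lambda>x. \<rho> (c + supnorm t s x)) \<and> (\<integral>x. \<rho> (c + supnorm t s x) \<partial>P) \<le> \<rho>' c"
    by (rule oscillation_expectation[OF osc \<rho>(1) w]) blast
  define e where "e = \<epsilon> / 5"
  have e: "0 < e" using eps by (simp add: e_def)
  obtain d1 where d1: "0 < d1" "\<And>x. 0 \<le> x \<Longrightarrow> x \<le> d1 \<Longrightarrow> \<rho>p x < e" using modulus_small[OF \<rho>p e] by blast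
  have "0 < e / (1 + T)" using e T_pos by simp
  then obtain d2 where d2: "0 < d2" "\<And>x. 0 \<le> x \<Longrightarrow> x \<le> d2 \<Longrightarrow> \<rho>\<^sub>0 x < e / (1 + T)" using modulus_small[OF modulus0] by blast
  \<comment> \<open>\<delta> is fixed before \<eta>: the factor M of the random error may blow up as
    \<delta> shrinks, and \<eta> is then chosen small relative to M. Pasting demands a rational
    radius.\<close>
  obtain \<delta> where \<delta>: "\<delta> \<in> \<rat>" "0 < \<delta>" "\<delta> < min d1 d2" using Rats_dense_in_real[of 0 "min d1 d2"] d1 d2 by auto
  define M where "M = 1 + 2 * T + 2 * K / \<rho> (\<delta> / 2)"
  have M: "0 < M" using T_pos K(1) \<rho>pos[of "\<delta> / 2"] \<delta> by (auto simp: M_def intro!: add_pos_nonneg)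
  then have "0 < e / M" using e by simp
  then obtain d3 where d3: "0 < d3" "\<And>x. 0 \<le> x \<Longrightarrow> x \<le> d3 \<Longrightarrow> \<rho>' x < e / M" using modulus_small[OF \<rho>'] by blast
  \<comment> \<open>The four bounds serve, in order, the Markov step, the mean of the random error
    at 2 \<eta>, the range of the oscillation bound, and the running payoff. K + 1 avoids division
    by 0.\<close>
  define \<eta> where "\<eta> = min (min (\<delta> / 2) (d3 / 2)) (min (T / 2) (e / (K + 1)))"
  have "\<eta> \<le> \<delta> / 2" "\<eta> \<le> d3 / 2" "\<eta> \<le> T / 2" "\<eta> \<le> e / (K + 1)"
    unfolding \<eta>_def by linarith+
  moreover have "0 < \<eta>" using \<delta> d3 T_pos e K(1) by (simp add: \<eta>_def)
  ultimately have \<eta>: "0 < \<eta>" "\<eta> \<le> \<delta> / 2" "2 * \<eta> \<le> d3" "2 * \<eta> \<le> T" "\<eta> \<le> e / (K + 1)"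
    by simp_all
  obtain h where h: "0 < h" "\<And>t s u v. 0 \<le> t \<Longrightarrow> s \<le> T \<Longrightarrow> s - t < h \<Longrightarrow> u \<in> {t..s} \<Longrightarrow> v \<in> {t..s} \<Longrightarrow> norm (\<omega> u - \<omega> v) \<le> \<eta>"
    by (rule uniformly_small_oscillation[OF w \<eta>(1)]) blast
  show ?thesis
  proof (rule that[of "min h \<eta>"])
    show "0 < min h \<eta>" using h \<eta> by simp
    fix t s :: real and n :: enat assume *: "0 \<le> t" "t < s" "s \<le> T" "s - t < min h \<eta>" and n: "1 \<le> n"
    have t: "t \<in> {0..T}" and s: "s \<in> {0..T}" using * by auto
    obtain P1 \<sigma> where P1: "P1 \<in> \<P> s \<omega>" and \<sigma>: "\<sigma> \<in> stops T s"
      and opt: "(SUP \<tau>\<in>dyadic_stops T s n. \<J> s \<omega> P1 \<tau> \<sigma>) \<le> val T g L U \<P> n s \<omega> + e"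
      by (rule val_near_optimal[OF s w e])
    obtain P where P: "P \<in> \<P> t \<omega>" using class_nonempty[OF t w] by blast
    let ?B = "path_ball T t s \<delta> (tail T t \<omega>)"
    obtain Ph \<gamma>' where Ph: "Ph \<in> \<P> t \<omega>" "\<gamma>' \<in> stops_from T t s" and AB: "\<forall>A\<in>sets (canon_filt T t s).
        measure Ph (A \<inter> ?B) = measure P (A \<inter> ?B) \<and>
        (\<forall>\<tau>\<in>dyadic_stops_from T t s n.
          (\<integral>x. indicator (A \<inter> ?B) x * payoff T g L U t \<omega> \<tau> \<gamma>' x \<partial>Ph)
          \<le> (\<integral>x. indicator (A \<inter> ?B) x *
               ((SUP \<tau>\<in>dyadic_stops T s n. \<J> s (paste T 0 t \<omega> x) P1 \<tau> \<sigma>)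
                + (LBINT r:{t..s}. shift_proc T g t \<omega> r x)) \<partial>P) + \<rho>p \<delta>)"
      using pasting[OF *(1-3) w P P1 \<delta>(2,1) \<sigma> n] by (elim bexE)
    have "val T g L U \<P> n t \<omega> \<le> val T g L U \<P> n s \<omega> + (e + (1 + T) * \<rho>\<^sub>0 \<delta> + \<rho>p \<delta> + \<eta> * K + (1 + 2 * T + 2 * K / \<rho> (\<delta> / 2)) * \<rho>' (2 * \<eta>))"
    proof (rule upper_estimate_core[OF *(1-3) w _ _ \<eta>(2) _ \<rho> _ \<delta>(2) P1 \<sigma> opt P Ph refl])
      show "integrable Q (\<lambda>x. \<rho> (2 * \<eta> + supnorm t s x)) \<and> (\<integral>x. \<rho> (2 * \<eta> + supnorm t s x) \<partial>Q) \<le> \<rho>' (2 * \<eta>)"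
        if "Q \<in> \<P> t \<omega>" for Q
        using *(4) \<eta> by (intro expect[OF *(1-3) _ _ that]) auto
    qed (use * h(2)[OF *(1,3)] K(2)[OF _ s] \<rho>pos \<delta> AB e in auto)
    also have "(1 + T) * \<rho>\<^sub>0 \<delta> \<le> e"
      using d2(2)[of \<delta>] \<delta> T_pos by (simp add: less_divide_eq mult.commute)
    also have "\<rho>p \<delta> \<le> e" using d1(2)[of \<delta>] \<delta> by simp
    also have "\<eta> * K \<le> e"
    proof -
      have "\<eta> * K \<le> e / (K + 1) * (K + 1)" using \<eta> K(1) by (intro mult_mono) auto
      then show ?thesis using K(1) by simp
    qed
    also have "(1 + 2 * T + 2 * K / \<rho> (\<delta> / 2)) * \<rho>' (2 * \<eta>) \<le> e"
      using d3(2)[of "2 * \<eta>"] \<eta> M unfolding M_def[symmetric] by (simp add: less_divide_eq mult.commute)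
    finally show "val T g L U \<P> n t \<omega> \<le> val T g L U \<P> n s \<omega> + \<epsilon>" by (simp add: e_def)
  qed
qed

end

subsection \<open>Approximation by a countable algebra\<close>

text \<open>The single operation NOR yields complements (A with itself) and finite unions
  (complement of NOR), so closing under it produces the generated algebra by countable
  stages.\<close>

primrec nor_closure :: "'a set \<Rightarrow> 'a set set \<Rightarrow> nat \<Rightarrow> 'a set set" where
  "nor_closure \<Omega> G 0 = insert {} G"
| "nor_closure \<Omega> G (Suc n) = nor_closure \<Omega> G n \<union>
     (\<lambda>(A, B). \<Omega> - (A \<union> B)) ` (nor_closure \<Omega> G n \<times> nor_closure \<Omega> G n)"

definition generated_algebra :: "'a set \<Rightarrow> 'a set set \<Rightarrow> 'a set set" where
  "generated_algebra \<Omega> G = (\<Union>n. nor_closure \<Omega> G n)"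

lemma countable_generated_algebra:
  assumes "countable G"
  shows "countable (generated_algebra \<Omega> G)"
proof -
  have "countable (nor_closure \<Omega> G n)" for n
    by (induction n) (use assms in auto)
  then show ?thesis by (simp add: generated_algebra_def)
qed

lemma generated_algebra_basic: "A \<in> G \<Longrightarrow> A \<in> generated_algebra \<Omega> G"
  unfolding generated_algebra_def by (intro UN_I[of 0]) auto

lemma generated_algebra_empty: "{} \<in> generated_algebra \<Omega> G"
  unfolding generated_algebra_def by (intro UN_I[of 0]) auto

lemma generated_algebra_nor:
  assumes "A \<in> generated_algebra \<Omega> G" "B \<in> generated_algebra \<Omega> G"
  shows "\<Omega> - (A \<union> B) \<in> generated_algebra \<Omega> G"
proof -
  have mono: "nor_closure \<Omega> G m \<subseteq> nor_closure \<Omega> G n" if "m \<le> n" for m n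
    using that by (induction rule: dec_induct) auto
  obtain m n where "A \<in> nor_closure \<Omega> G m" "B \<in> nor_closure \<Omega> G n"
    using assms by (auto simp: generated_algebra_def)
  then have "A \<in> nor_closure \<Omega> G (max m n)" "B \<in> nor_closure \<Omega> G (max m n)"
    using mono[of m "max m n"] mono[of n "max m n"] by auto
  then have "\<Omega> - (A \<union> B) \<in> nor_closure \<Omega> G (Suc (max m n))" by auto
  then show ?thesis unfolding generated_algebra_def by blast
qed

lemma generated_algebra_compl: "A \<in> generated_algebra \<Omega> G \<Longrightarrow> \<Omega> - A \<in> generated_algebra \<Omega> G"
  using generated_algebra_nor[of A \<Omega> G A] by simp

lemma generated_algebra_sets:
  assumes "G \<subseteq> sets M" "A \<in> generated_algebra (space M) G"
  shows "A \<in> sets M"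
proof -
  have "nor_closure (space M) G n \<subseteq> sets M" for n
    by (induction n) (use assms(1) in auto)
  then show ?thesis using assms(2) by (auto simp: generated_algebra_def)
qed

lemma generated_algebra_UN:
  assumes "G \<subseteq> sets M" "finite I" "\<And>i. i \<in> I \<Longrightarrow> A i \<in> generated_algebra (space M) G"
  shows "(\<Union>i\<in>I. A i) \<in> generated_algebra (space M) G"
  using assms(2,3)
proof (induction I)
  case (insert i I)
  have "A i \<union> (\<Union>i\<in>I. A i) = space M - (space M - (A i \<union> (\<Union>i\<in>I. A i)))"
    using insert generated_algebra_sets[OF assms(1)] sets.sets_into_space[of _ M] by blast
  also have "\<dots> \<in> generated_algebra (space M) G"
    using insert by (intro generated_algebra_compl generated_algebra_nor) auto
  finally show ?case by simp
qed (simp add: generated_algebra_empty)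

text \<open>Induction over \<open>sigma_sets\<close> with e arbitrary; a countable union is cut off
  by continuity from below. G may generate a smaller sigma-algebra than that of M: events of time r
  are thus approximated by events of time r under a measure on paths up to T.\<close>

lemma (in finite_measure) generated_algebra_approx:
  assumes G: "G \<subseteq> sets M" and E: "E \<in> sigma_sets (space M) G" and "0 < e"
  shows "\<exists>A\<in>generated_algebra (space M) G. measure M (sym_diff E A) < e"
  using E \<open>0 < e\<close>
proof (induction arbitrary: e rule: sigma_sets.induct)
  case (Basic A)
  then show ?case by (intro bexI[OF _ generated_algebra_basic[OF Basic(1)]]) simp
next
  case Empty
  then show ?case by (intro bexI[OF _ generated_algebra_empty]) simp
next
  case (Compl E)
  then obtain A where A: "A \<in> generated_algebra (space M) G" "measure M (sym_diff E A) < e" by blast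
  have "E \<subseteq> space M" "A \<subseteq> space M"
    using sigma_sets_into_sp[OF _ Compl(1)] G sets.space_closed generated_algebra_sets[OF G A(1)] sets.sets_into_space by blast+
  then have "sym_diff (space M - E) (space M - A) = sym_diff E A" by auto
  then show ?case using A by (intro bexI[OF _ generated_algebra_compl[OF A(1)]]) simp
next
  case (Union E)
  have sM: "X \<in> sets M" if "X \<in> sigma_sets (space M) G" for X
    using that G sets.sigma_sets_subset by blast
  have En: "E i \<in> sets M" for i using sM[OF Union(1)] .
  let ?F = "\<lambda>n. (\<Union>i\<in>{..<n}. E i)"
  have "(\<lambda>n. measure M (?F n)) \<longlonglongrightarrow> measure M (\<Union>n. ?F n)"
    using En unfolding incseq_def by (intro finite_Lim_measure_incseq[unfolded incseq_def] allI impI UN_mono) auto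
  moreover have "(\<Union>n. ?F n) = (\<Union>i. E i)" by auto
  ultimately have "(\<lambda>n. measure M (?F n)) \<longlonglongrightarrow> measure M (\<Union>i. E i)" by simp
  then obtain n where n: "norm (measure M (?F n) - measure M (\<Union>i. E i)) < e / 2"
    using LIMSEQ_D[of _ _ "e/2"] \<open>0 < e\<close> by fastforce
  \<comment> \<open>Half of e is left after cutting the union at n; dividing by n + 1 rather than n
    covers n = 0.\<close>
  have "0 < e / (2 * (real n + 1))" using \<open>0 < e\<close> by simp
  then have "\<forall>i. \<exists>A\<in>generated_algebra (space M) G. measure M (sym_diff (E i) A) < e / (2 * (real n + 1))"
    using Union.IH by blast
  then obtain A where A: "\<And>i. A i \<in> generated_algebra (space M) G"
    "\<And>i. measure M (sym_diff (E i) (A i)) < e / (2 * (real n + 1))" by metis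
  have AM: "A i \<in> sets M" for i by (rule generated_algebra_sets[OF G A(1)])
  let ?B = "\<Union>i\<in>{..<n}. A i"
  have "measure M (sym_diff (\<Union>i. E i) ?B) \<le> measure M (((\<Union>i. E i) - ?F n) \<union> (\<Union>i\<in>{..<n}. sym_diff (E i) (A i)))"
    using En AM by (intro finite_measure_mono) auto
  also have "\<dots> \<le> measure M ((\<Union>i. E i) - ?F n) + measure M (\<Union>i\<in>{..<n}. sym_diff (E i) (A i))"
    using En AM by (intro measure_Un_le) auto
  also have "measure M ((\<Union>i. E i) - ?F n) = measure M (\<Union>i. E i) - measure M (?F n)"
    using En by (intro finite_measure_Diff) auto
  also have "\<dots> < e / 2" using n unfolding real_norm_def by linarith
  also have "measure M (\<Union>i\<in>{..<n}. sym_diff (E i) (A i)) \<le> (\<Sum>i<n. measure M (sym_diff (E i) (A i)))"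
    using En AM by (intro finite_measure_subadditive_finite) auto
  also have "\<dots> \<le> (\<Sum>i<n. e / (2 * (real n + 1)))" using A(2) by (intro sum_mono less_imp_le)
  also have "\<dots> \<le> e / 2" using \<open>0 < e\<close> by (simp add: field_simps)
  finally show ?case using generated_algebra_UN[OF G _ A(1), of "{..<n}"] by auto
qed

subsection \<open>A countable dense family of stopping times\<close>

text \<open>Path continuity reduces all times in [t,u] to a countable dense set, and a countable
  basis suffices for the states.\<close>

lemma canon_filt_countably_generated:
  assumes "t \<le> u" "u \<le> T"
  obtains G :: "('d::finite) path set set" where "countable G" "G \<subseteq> sets (canon_filt T t u)"
    "sets (canon_filt T t u) = sigma_sets (Omega T t) G"
proof -
  obtain B :: "(real ^ 'd) set set" where B: "countable B" "topological_basis B"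
    using ex_countable_basis by blast
  define R where "R = range (\<lambda>(n, i). clamp_grid t u n i)"
  define G :: "'d path set set" where "G = (\<lambda>(r, S). (\<lambda>\<omega>. \<omega> r) -` S \<inter> Omega T t) ` (R \<times> B)"
  have R: "R \<subseteq> {t..u}" using clamp_grid_mem[OF assms(1)] by (auto simp: R_def)
  have Bb: "S \<in> sets borel" if "S \<in> B" for S using B(2) that by (auto intro!: borel_open topological_basis_open)
  have coord: "(\<lambda>\<omega>::'d path. \<omega> r) \<in> borel_measurable (sigma (Omega T t) G)" if r: "r \<in> R" for r
    unfolding borel_eq_countable_basis[OF B]
  proof (rule measurable_measure_of)
    show "(\<lambda>\<omega>. \<omega> r) -` S \<inter> space (sigma (Omega T t) G) \<in> sets (sigma (Omega T t) G)" if "S \<in> B" for S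
    proof -
      have "(\<lambda>\<omega>. \<omega> r) -` S \<inter> Omega T t \<in> G" using that r by (auto simp: G_def)
      moreover have "G \<subseteq> Pow (Omega T t)" by (auto simp: G_def)
      ultimately show ?thesis by (simp add: space_measure_of sets_measure_of sigma_sets.Basic)
    qed
  qed auto
  have sp: "space (sigma (Omega T t) G) = Omega T t" "sets (sigma (Omega T t) G) = sigma_sets (Omega T t) G"
    by (auto simp: G_def intro!: space_measure_of sets_measure_of)
  have coord': "(\<lambda>\<omega>::'d path. \<omega> r) \<in> borel_measurable (sigma (Omega T t) G)" if r: "r \<in> {t..u}" for r
  proof (rule borel_measurable_LIMSEQ_metric)
    show "(\<lambda>\<omega>::'d path. \<omega> (clamp_grid t u n \<lfloor>real (Suc n) * r\<rfloor>)) \<in> borel_measurable (sigma (Omega T t) G)" for n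
      by (rule coord) (auto simp: R_def)
    fix \<omega> :: "'d path" assume "\<omega> \<in> space (sigma (Omega T t) G)"
    then have "continuous_on {t..u} \<omega>" using assms sp(1) by (auto intro!: Omega_continuous_on[where t=t])
    then show "(\<lambda>n. \<omega> (clamp_grid t u n \<lfloor>real (Suc n) * r\<rfloor>)) \<longlonglongrightarrow> \<omega> r"
      by (rule continuous_on_tendsto_compose[OF _ clamp_grid_tendsto[OF r] r])
         (intro always_eventually allI clamp_grid_mem assms)
  qed
  show ?thesis
  proof (rule that)
    show "countable G" unfolding G_def R_def using B(1) by auto
    show sub: "G \<subseteq> sets (canon_filt T t u)"
    proof
      fix A assume "A \<in> G"
      then obtain r S where r: "r \<in> R" "S \<in> B" "A = (\<lambda>\<omega>. \<omega> r) -` S \<inter> Omega T t" by (auto simp: G_def)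
      have "(\<lambda>\<omega>::'d path. \<omega> r) \<in> borel_measurable (canon_filt T t u)"
        using r R assms by (intro measurable_coordinate) auto
      from measurable_sets[OF this Bb[OF r(2)]] show "A \<in> sets (canon_filt T t u)" using r by simp
    qed
    have "(\<lambda>\<omega>. \<omega>) \<in> sigma (Omega T t) G \<rightarrow>\<^sub>M canon_filt T t u"
      by (rule measurable_canon_filtI) (use sp coord' in auto)
    note id = measurable_sets[OF this, unfolded sp vimage_ident]
    have "sets (canon_filt T t u) \<subseteq> sigma_sets (Omega T t) G"
    proof
      fix A :: "'d path set" assume A: "A \<in> sets (canon_filt T t u)"
      have "A \<subseteq> Omega T t" using sets.sets_into_space[OF A] by simp
      then show "A \<in> sigma_sets (Omega T t) G" using id[OF A] by (simp only: Int_absorb2)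
    qed
    moreover have "sigma_sets (Omega T t) G \<subseteq> sets (canon_filt T t u)"
      using sets.sigma_sets_subset[OF sub] by simp
    ultimately show "sets (canon_filt T t u) = sigma_sets (Omega T t) G" by blast
  qed
qed

text \<open>A finitely valued stopping time coded as a list of times with events. Any list whose
  events are known at their times gives a stopping time, even if the events overlap or leave gaps,
  so the events can be replaced by approximations without spoiling the property.\<close>

definition first_hit :: "real \<Rightarrow> (real \<times> 'a set) list \<Rightarrow> 'a \<Rightarrow> real" where
  "first_hit T ps x = Min (insert T {r. \<exists>A. (r, A) \<in> set ps \<and> x \<in> A})"

lemma finite_hits: "finite {r. \<exists>A. (r, A) \<in> set ps \<and> x \<in> A}"
  by (rule finite_subset[of _ "fst ` set ps"]) force+

lemma first_hit_in_stops_from: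
  assumes ts: "t \<le> s" "s \<le> T"
    and ps: "\<And>r A. (r, A) \<in> set ps \<Longrightarrow> r \<in> {s..T} \<and> A \<in> sets (canon_filt T t r)"
  shows "first_hit T ps \<in> stops_from T t s"
proof -
  have rng: "first_hit T ps x \<in> {s..T}" for x
    unfolding first_hit_def using ps ts finite_hits[of ps x] by (subst atLeastAtMost_iff) (auto simp: Min_le_iff)
  have "first_hit T ps \<in> stops T t"
  proof (rule stopsI)
    show "first_hit T ps x \<in> {t..T}" for x using rng[of x] ts by auto
    show "{x \<in> Omega T t. first_hit T ps x \<le> u} \<in> sets (canon_filt T t u)" if u: "u \<in> {t..<T}" for u
    proof -
      have "A \<subseteq> Omega T t" if "(r, A) \<in> set ps" for r A
        using ps[OF that] sets.sets_into_space[of A "canon_filt T t r"] by simp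
      then have "{x \<in> Omega T t. first_hit T ps x \<le> u} = (\<Union>p\<in>{p\<in>set ps. fst p \<le> u}. snd p)"
        unfolding first_hit_def using u by (force simp: Min_le_iff finite_hits)
      also have "\<dots> \<in> sets (canon_filt T t u)"
      proof (rule sets.finite_UN)
        show "snd p \<in> sets (canon_filt T t u)" if "p \<in> {p \<in> set ps. fst p \<le> u}" for p
          using that ps[of "fst p" "snd p"] sets_canon_filt_mono[of "fst p" u T t] by auto
      qed simp
      finally show ?thesis .
    qed
  qed
  then show ?thesis using rng by (auto simp: stops_from_def)
qed

text \<open>Rounding up does not anticipate, so it preserves stopping times. With h = (T - s) / (k +
  1) both s and T are grid points; for s = T the mesh is 0 and the value is s.\<close>

definition grid_above :: "real \<Rightarrow> real \<Rightarrow> real \<Rightarrow> real" where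
  "grid_above s h a = s + h * of_int \<lceil>(a - s) / h\<rceil>"

lemma grid_above_bounds:
  assumes "a \<in> {s..T}" "h = (T - s) / real (Suc k)"
  shows "a \<le> grid_above s h a" "grid_above s h a \<le> T" "grid_above s h a \<le> a + h"
    and "\<exists>i\<le>Suc k. grid_above s h a = s + h * real i"
proof -
  have "a \<le> grid_above s h a \<and> grid_above s h a \<le> T \<and> grid_above s h a \<le> a + h \<and> (\<exists>i\<le>Suc k. grid_above s h a = s + h * real i)"
  proof (cases "s = T")
    case True
    then show ?thesis using assms by (auto simp: grid_above_def)
  next
    case False
    then have h: "0 < h" using assms by simp
    let ?c = "\<lceil>(a - s) / h\<rceil>"
    have le: "(a - s) / h \<le> of_int ?c" "of_int ?c \<le> (a - s) / h + 1" by linarith+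
    have 1: "a - s \<le> h * of_int ?c" using le(1) unfolding pos_divide_le_eq[OF h] by (simp only: mult.commute)
    have "h * of_int ?c \<le> h * ((a - s) / h + 1)" using le(2) h by (intro mult_left_mono) auto
    also have "\<dots> = (a - s) + h" using h by (simp add: distrib_left)
    finally have 2: "h * of_int ?c \<le> (a - s) + h" .
    have hT: "h * real (Suc k) = T - s" using assms(2) by simp
    then have "a - s \<le> h * real (Suc k)" using assms(1) by auto
    then have "(a - s) / h \<le> real (Suc k)" using h by (simp add: pos_divide_le_eq mult.commute)
    then have "?c \<le> int (Suc k)" by linarith
    moreover have "0 \<le> ?c" using assms(1) h by (simp add: le_ceiling_iff) (smt (verit) divide_nonneg_pos)
    ultimately obtain i where i: "?c = int i" "i \<le> Suc k" by (metis of_nat_le_iff zero_le_imp_eq_int)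
    have "h * real i \<le> h * real (Suc k)" using i(2) h by (intro mult_left_mono) auto
    then show ?thesis using 1 2 hT i unfolding grid_above_def by (auto simp del: of_nat_Suc)
  qed
  then show "a \<le> grid_above s h a" "grid_above s h a \<le> T" "grid_above s h a \<le> a + h"
    "\<exists>i\<le>Suc k. grid_above s h a = s + h * real i" by blast+
qed

lemma grid_above_in_stops_from:
  assumes ts: "t \<le> s" "s \<le> T" and \<tau>: "\<tau> \<in> stops_from T t s" and h: "h = (T - s) / real (Suc k)"
  shows "(\<lambda>x. grid_above s h (\<tau> x)) \<in> stops_from T t s"
proof -
  have \<tau>1: "\<tau> \<in> stops T t" and rng: "\<tau> x \<in> {s..T}" if "x \<in> Omega T t" for x
    using \<tau> stops_range[of \<tau> T t x] that by (auto simp: stops_from_def)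
  have \<tau>0: "\<tau> \<in> stops T t" using \<tau> by (simp add: stops_from_def)
  have ge: "s \<le> grid_above s h (\<tau> x)" if "x \<in> Omega T t" for x
    using grid_above_bounds(1)[OF rng[OF that] h] rng[OF that] by auto
  have "(\<lambda>x. grid_above s h (\<tau> x)) \<in> stops T t"
  proof (rule stopsI)
    show "grid_above s h (\<tau> x) \<in> {t..T}" if "x \<in> Omega T t" for x
      using grid_above_bounds(2)[OF rng[OF that] h] ge[OF that] ts by auto
    show "{x \<in> Omega T t. grid_above s h (\<tau> x) \<le> u} \<in> sets (canon_filt T t u)" if u: "u \<in> {t..<T}" for u
    proof (cases "s \<le> u")
      case False
      then have "{x \<in> Omega T t. grid_above s h (\<tau> x) \<le> u} = {}" using ge by fastforce
      then show ?thesis by (simp only: sets.empty_sets)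
    next
      case True
      then have hp: "0 < h" using u h by simp
      \<comment> \<open>v is the last grid point not after u, and rounding up ends by u exactly if
        the original time is at most v.\<close>
      define v where "v = s + h * of_int \<lfloor>(u - s) / h\<rfloor>"
      have "of_int \<lfloor>(u - s) / h\<rfloor> \<le> (u - s) / h" by linarith
      then have v: "v \<le> u" unfolding pos_le_divide_eq[OF hp] v_def by (simp add: mult.commute)
      have iff: "grid_above s h a \<le> u \<longleftrightarrow> a \<le> v" for a
      proof -
        have "grid_above s h a \<le> u \<longleftrightarrow> of_int \<lceil>(a - s) / h\<rceil> \<le> (u - s) / h"
          unfolding pos_le_divide_eq[OF hp] grid_above_def by (auto simp: mult.commute)
        also have "\<dots> \<longleftrightarrow> (a - s) / h \<le> of_int \<lfloor>(u - s) / h\<rfloor>"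
          by (simp only: le_floor_iff[symmetric] ceiling_le_iff)
        also have "\<dots> \<longleftrightarrow> a \<le> v" unfolding pos_divide_le_eq[OF hp] v_def by (auto simp: mult.commute)
        finally show ?thesis .
      qed
      show ?thesis unfolding iff using stops_sets[OF \<tau>0, of v] sets_canon_filt_mono[OF v, of T t] by blast
    qed
  qed
  then show ?thesis using ge by (simp add: stops_from_def)
qed

context payoff_processes
begin

text \<open>Meant for conditional laws: they are not known to lie in \<open>hat_probs\<close>, but
  almost all of them integrate \<open>dominator\<close>, and this suffices.\<close>

lemma integrable_payoff_dominated:
  assumes t: "t \<in> {0..T}" and w: "\<omega> \<in> Omega T 0" and Q: "sets Q = sets (canon_filt T t T)" "integrable Q (dominator t \<omega>)"
    and st: "\<tau> \<in> stops T t" "\<gamma> \<in> stops T t"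
  shows "integrable Q (payoff T g L U t \<omega> \<tau> \<gamma>)"
proof (rule Bochner_Integration.integrable_bound[OF Q(2)])
  show "payoff T g L U t \<omega> \<tau> \<gamma> \<in> borel_measurable Q"
    unfolding measurable_cong_sets[OF Q(1) refl] by (rule payoff_measurable[OF t w st])
  have "\<bar>payoff T g L U t \<omega> \<tau> \<gamma> x\<bar> \<le> dominator t \<omega> x" if "x \<in> Omega T t" for x
    by (rule payoff_abs_le[where \<tau>=\<tau> and \<gamma>=\<gamma>, OF t w that stops_range[OF st(1) that] stops_range[OF st(2) that]])
  then have "norm (payoff T g L U t \<omega> \<tau> \<gamma> x) \<le> norm (dominator t \<omega> x)" if "x \<in> space Q" for x
    using that sets_eq_imp_space_eq[OF Q(1)] by fastforce
  then show "AE x in Q. norm (payoff T g L U t \<omega> \<tau> \<gamma> x) \<le> norm (dominator t \<omega> x)" by (rule AE_I2)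
qed

lemma running_payoff_continuous:
  assumes t: "t \<in> {0..T}" and w: "\<omega> \<in> Omega T 0" "x \<in> Omega T t"
  shows "continuous_on {t..T} (\<lambda>v. (LBINT s:{t..v}. shift_proc T g t \<omega> s x) + shift_proc T L t \<omega> v x)"
proof (rule continuous_on_add)
  have c: "continuous_on {a..b} (\<lambda>s. shift_proc T g t \<omega> s x)" if "{a..b} \<subseteq> {t..T}" for a b
    using that by (intro shift_continuous[OF _ t w]) auto
  have "continuous_on {t..T} (\<lambda>v. integral {t..v} (\<lambda>s. shift_proc T g t \<omega> s x))"
    by (rule indefinite_integral_continuous_1[OF integrable_continuous_real[OF c[OF order_refl]]])
  then show "continuous_on {t..T} (\<lambda>v. LBINT s:{t..v}. shift_proc T g t \<omega> s x)"
  proof (rule continuous_on_cong[THEN iffD1, OF refl, rotated])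
    show "integral {t..v} (\<lambda>s. shift_proc T g t \<omega> s x) = (LBINT s:{t..v}. shift_proc T g t \<omega> s x)" if "v \<in> {t..T}" for v
      using that by (intro set_borel_integral_eq_integral(2)[symmetric] borel_integrable_atLeastAtMost' c) auto
  qed
  show "continuous_on {t..T} (\<lambda>v. shift_proc T L t \<omega> v x)" by (intro shift_continuous[OF _ t w]) auto
qed

text \<open>Postponing the stop past \<open>\<gamma>\<close> only trades \<open>L\<close> for the larger \<open>U\<close>, so in the limit the payoff
  cannot drop; hence only the negative part of the difference is claimed to vanish.\<close>

lemma payoff_stop_later_tendsto:
  assumes t: "t \<in> {0..T}" and w: "\<omega> \<in> Omega T 0" and x: "x \<in> Omega T t" and r: "\<tau> x \<in> {t..T}" "\<gamma> x \<in> {t..T}"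
    and \<sigma>: "\<And>k. \<sigma> k x \<in> {\<tau> x..T}" "(\<lambda>k. \<sigma> k x) \<longlonglongrightarrow> \<tau> x"
  shows "(\<lambda>k. min (payoff T g L U t \<omega> (\<sigma> k) \<gamma> x - payoff T g L U t \<omega> \<tau> \<gamma> x) 0) \<longlonglongrightarrow> 0"
proof (cases "\<tau> x \<le> \<gamma> x")
  case False
  then have "payoff T g L U t \<omega> (\<sigma> k) \<gamma> x = payoff T g L U t \<omega> \<tau> \<gamma> x" for k
    using \<sigma>(1)[of k] by (simp add: payoff_def min_def)
  then show ?thesis by simp
next
  case True
  define H where "H v = (LBINT s:{t..v}. shift_proc T g t \<omega> s x) + shift_proc T L t \<omega> v x" for v
  have cont: "continuous_on {t..T} H" unfolding H_def[abs_def] by (rule running_payoff_continuous[OF t w x])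
  have eq: "payoff T g L U t \<omega> \<tau> \<gamma> x = H (\<tau> x)" using True by (simp add: payoff_def H_def min_def)
  have ge: "H (min (\<sigma> k x) (\<gamma> x)) \<le> payoff T g L U t \<omega> (\<sigma> k) \<gamma> x" for k
  proof (cases "\<sigma> k x \<le> \<gamma> x")
    case False
    have "paste T 0 t \<omega> x \<in> Omega T 0" using t w x by (intro paste_in_Omega) auto
    then have "shift_proc T L t \<omega> (\<gamma> x) x \<le> shift_proc T U t \<omega> (\<gamma> x) x"
      unfolding shift_proc_def using r t by (intro L_le_U) auto
    then show ?thesis using False by (simp add: payoff_def H_def min_def)
  qed (simp add: payoff_def H_def min_def)
  have "(\<lambda>k. min (\<sigma> k x) (\<gamma> x)) \<longlonglongrightarrow> min (\<tau> x) (\<gamma> x)" by (intro tendsto_min \<sigma>(2) tendsto_const)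
  then have "(\<lambda>k. min (\<sigma> k x) (\<gamma> x)) \<longlonglongrightarrow> \<tau> x" using True by (simp add: min_def)
  then have "(\<lambda>k. H (min (\<sigma> k x) (\<gamma> x))) \<longlonglongrightarrow> H (\<tau> x)"
  proof (rule continuous_on_tendsto_compose[OF cont _ r(1)])
    show "\<forall>\<^sub>F k in sequentially. min (\<sigma> k x) (\<gamma> x) \<in> {t..T}"
    proof (intro always_eventually allI)
      show "min (\<sigma> k x) (\<gamma> x) \<in> {t..T}" for k using \<sigma>(1)[of k] r by auto
    qed
  qed
  then have "(\<lambda>k. min (H (min (\<sigma> k x) (\<gamma> x)) - H (\<tau> x)) 0) \<longlonglongrightarrow> min (H (\<tau> x) - H (\<tau> x)) 0"
    by (intro tendsto_min tendsto_diff tendsto_const)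
  then have lim: "(\<lambda>k. min (H (min (\<sigma> k x) (\<gamma> x)) - H (\<tau> x)) 0) \<longlonglongrightarrow> 0" by simp
  show ?thesis
  proof (rule tendsto_sandwich[OF _ _ lim tendsto_const])
    have "min (H (min (\<sigma> k x) (\<gamma> x)) - H (\<tau> x)) 0 \<le> min (payoff T g L U t \<omega> (\<sigma> k) \<gamma> x - payoff T g L U t \<omega> \<tau> \<gamma> x) 0" for k
      using ge[of k] unfolding eq by (intro min.mono) auto
    then show "\<forall>\<^sub>F k in sequentially. min (H (min (\<sigma> k x) (\<gamma> x)) - H (\<tau> x)) 0
        \<le> min (payoff T g L U t \<omega> (\<sigma> k) \<gamma> x - payoff T g L U t \<omega> \<tau> \<gamma> x) 0"
      by (rule always_eventually[OF allI])
  qed simp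
qed

text \<open>Dominated convergence, with twice the dominator as majorant, for the negative part of
  the payoff difference along ever finer grids. The negative part bounds the difference from below,
  and only that direction is needed.\<close>

lemma grid_near_optimal:
  assumes t: "t \<in> {0..T}" and s: "s \<in> {t..T}" and w: "\<omega> \<in> Omega T 0"
    and Q: "sets Q = sets (canon_filt T t T)" "integrable Q (dominator t \<omega>)"
    and st: "\<tau> \<in> stops_from T t s" "\<gamma> \<in> stops T t" and e: "0 < e"
  obtains k where "(\<integral>x. payoff T g L U t \<omega> \<tau> \<gamma> x \<partial>Q) - e
      < (\<integral>x. payoff T g L U t \<omega> (\<lambda>x. grid_above s ((T - s) / real (Suc k)) (\<tau> x)) \<gamma> x \<partial>Q)"
proof -
  define \<sigma> where "\<sigma> k x = grid_above s ((T - s) / real (Suc k)) (\<tau> x)" for k x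
  have \<tau>: "\<tau> \<in> stops T t" using st(1) by (simp add: stops_from_def)
  have \<sigma>: "\<sigma> k \<in> stops T t" for k
    using grid_above_in_stops_from[OF _ _ st(1) refl, of k] s by (simp add: \<sigma>_def[abs_def] stops_from_def)
  have int: "integrable Q (payoff T g L U t \<omega> \<tau> \<gamma>)" "\<And>k. integrable Q (payoff T g L U t \<omega> (\<sigma> k) \<gamma>)"
    by (intro integrable_payoff_dominated[OF t w Q] \<tau> \<sigma> st(2))+
  have spQ: "space Q = Omega T t" using sets_eq_imp_space_eq[OF Q(1)] by simp
  let ?f = "\<lambda>k x. min (payoff T g L U t \<omega> (\<sigma> k) \<gamma> x - payoff T g L U t \<omega> \<tau> \<gamma> x) 0"
  have "(\<lambda>k. \<integral>x. ?f k x \<partial>Q) \<longlonglongrightarrow> (\<integral>x. 0 \<partial>Q)"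
  proof (rule integral_dominated_convergence[where w="\<lambda>x. 2 * dominator t \<omega> x"])
    show "?f k \<in> borel_measurable Q" for k
      using borel_measurable_integrable[OF int(1)] borel_measurable_integrable[OF int(2)[of k]] by measurable
    show "AE x in Q. (\<lambda>k. ?f k x) \<longlonglongrightarrow> 0"
    proof (rule AE_I2)
      fix x assume "x \<in> space Q"
      then have x: "x \<in> Omega T t" by (simp add: spQ)
      have r: "\<tau> x \<in> {s..T}" using st(1) stops_range[OF \<tau> x] x by (auto simp: stops_from_def)
      have "(\<lambda>k. \<sigma> k x - \<tau> x) \<longlonglongrightarrow> 0"
      proof (rule Lim_null_comparison)
        have "norm (\<sigma> k x - \<tau> x) \<le> (T - s) * inverse (real (Suc k))" for k
          using grid_above_bounds(1,3)[OF r refl, of k] by (simp add: \<sigma>_def divide_inverse)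
        then show "\<forall>\<^sub>F k in sequentially. norm (\<sigma> k x - \<tau> x) \<le> (T - s) * inverse (real (Suc k))"
          by (rule always_eventually[OF allI])
        show "(\<lambda>k. (T - s) * inverse (real (Suc k))) \<longlonglongrightarrow> 0"
          by (rule tendsto_mult_right_zero[OF LIMSEQ_inverse_real_of_nat])
      qed
      then have "(\<lambda>k. \<sigma> k x) \<longlonglongrightarrow> \<tau> x" by (rule LIM_zero_cancel)
      then show "(\<lambda>k. ?f k x) \<longlonglongrightarrow> 0"
        using grid_above_bounds(1,2)[OF r refl] stops_range[OF \<tau> x] stops_range[OF st(2) x]
        by (intro payoff_stop_later_tendsto[OF t w x]) (auto simp: \<sigma>_def)
    qed
    show "AE x in Q. norm (?f k x) \<le> 2 * dominator t \<omega> x" for k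
    proof (rule AE_I2)
      fix x assume "x \<in> space Q"
      then have x: "x \<in> Omega T t" by (simp add: spQ)
      show "norm (?f k x) \<le> 2 * dominator t \<omega> x"
        using payoff_abs_le[where \<tau>=\<tau> and \<gamma>=\<gamma>, OF t w x stops_range[OF \<tau> x] stops_range[OF st(2) x]]
          payoff_abs_le[where \<tau>="\<sigma> k" and \<gamma>=\<gamma>, OF t w x stops_range[OF \<sigma>[of k] x] stops_range[OF st(2) x]]
        by (auto simp: min_def abs_le_iff)
    qed
  qed (use Q(2) in auto)
  then obtain k where "norm ((\<integral>x. ?f k x \<partial>Q) - 0) < e"
    using LIMSEQ_D[of "\<lambda>k. \<integral>x. ?f k x \<partial>Q" 0 e] e by auto
  moreover have "(\<integral>x. ?f k x \<partial>Q) \<le> (\<integral>x. payoff T g L U t \<omega> (\<sigma> k) \<gamma> x - payoff T g L U t \<omega> \<tau> \<gamma> x \<partial>Q)"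
    using int by (intro integral_mono) auto
  ultimately show ?thesis
    using int by (intro that[of k]) (simp add: \<sigma>_def[abs_def])
qed

text \<open>The family is fixed before the law Q, the prefix and \<gamma>. It is coded by finite
  lists of grid times with sets from countable algebras that generate the filtration at those times.
  An arbitrary time is first rounded up to a grid; then its level sets are replaced by nearby
  algebra sets.\<close>

lemma countable_dense_stops:
  assumes t: "t \<in> {0..T}" and s: "s \<in> {t..T}"
  obtains C :: "nat \<Rightarrow> 'd path \<Rightarrow> real" where "\<And>k. C k \<in> stops_from T t s"
    "\<And>\<omega> Q \<tau> \<gamma> e. \<omega> \<in> Omega T 0 \<Longrightarrow> sets Q = sets (canon_filt T t T) \<Longrightarrow> integrable Q (dominator t \<omega>) \<Longrightarrow>
      \<tau> \<in> stops_from T t s \<Longrightarrow> \<gamma> \<in> stops T t \<Longrightarrow> 0 < e \<Longrightarrow>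
      \<exists>k. (\<integral>x. payoff T g L U t \<omega> \<tau> \<gamma> x \<partial>Q) - e < (\<integral>x. payoff T g L U t \<omega> (C k) \<gamma> x \<partial>Q)"
proof -
  define r where "r k i = s + (T - s) / real (Suc k) * real i" for k i
  define R where "R = (\<lambda>(k, i). r k i) ` (SIGMA k:UNIV. {..Suc k})"
  have r: "r k i \<in> {s..T}" if "i \<le> Suc k" for k i
  proof -
    have "(T - s) / real (Suc k) * real i \<le> (T - s) / real (Suc k) * real (Suc k)"
      using that s by (intro mult_left_mono) auto
    then show ?thesis using s by (simp add: r_def del: of_nat_Suc)
  qed
  have R: "R \<subseteq> {s..T}" "countable R" using r by (auto simp: R_def)
  have "\<exists>G :: 'd path set set. countable G \<and> G \<subseteq> sets (canon_filt T t u) \<and> sets (canon_filt T t u) = sigma_sets (Omega T t) G"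
    if "u \<in> R" for u
  proof -
    have "t \<le> u" "u \<le> T" using R(1) that s by auto
    from canon_filt_countably_generated[OF this] show ?thesis by metis
  qed
  then obtain G :: "real \<Rightarrow> 'd path set set" where G: "\<And>u. u \<in> R \<Longrightarrow> countable (G u)"
    "\<And>u. u \<in> R \<Longrightarrow> G u \<subseteq> sets (canon_filt T t u)" "\<And>u. u \<in> R \<Longrightarrow> sets (canon_filt T t u) = sigma_sets (Omega T t) (G u)"
    by metis
  define PS where "PS = lists (SIGMA u:R. generated_algebra (Omega T t) (G u))"
  have cPS: "countable PS" unfolding PS_def
    using R(2) G(1) by (intro countable_lists countable_SIGMA countable_generated_algebra)
  have nePS: "PS \<noteq> {}" by (auto simp: PS_def)
  define C where "C k = first_hit T (from_nat_into PS k)" for k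
  have PS_stops: "first_hit T ps \<in> stops_from T t s" if "ps \<in> PS" for ps
  proof (rule first_hit_in_stops_from)
    fix u A assume "(u, A) \<in> set ps"
    then have u: "u \<in> R" "A \<in> generated_algebra (space (canon_filt T t u)) (G u)"
      using that by (auto simp: PS_def in_lists_conv_set)
    then show "u \<in> {s..T} \<and> A \<in> sets (canon_filt T t u)"
      using R(1) generated_algebra_sets[OF G(2)[OF u(1)] u(2)] by auto
  qed (use s in auto)
  show ?thesis
  proof (rule that[of C])
    show "C k \<in> stops_from T t s" for k unfolding C_def by (intro PS_stops from_nat_into nePS)
    fix \<omega> :: "'d path" and Q and \<tau> \<gamma> :: "'d path \<Rightarrow> real" and e :: real
    assume w: "\<omega> \<in> Omega T 0" and Q: "sets Q = sets (canon_filt T t T)" "integrable Q (dominator t \<omega>)"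
      and st: "\<tau> \<in> stops_from T t s" "\<gamma> \<in> stops T t" and e: "0 < e"
    have spQ: "space Q = Omega T t" using sets_eq_imp_space_eq[OF Q(1)] by simp
    have "0 < e / 2" using e by simp
    then obtain m where m: "(\<integral>x. payoff T g L U t \<omega> \<tau> \<gamma> x \<partial>Q) - e / 2
      < (\<integral>x. payoff T g L U t \<omega> (\<lambda>x. grid_above s ((T - s) / real (Suc m)) (\<tau> x)) \<gamma> x \<partial>Q)"
      by (rule grid_near_optimal[OF t s w Q st])
    define \<sigma> where "\<sigma> x = grid_above s ((T - s) / real (Suc m)) (\<tau> x)" for x
    have \<sigma>f: "\<sigma> \<in> stops_from T t s"
      unfolding \<sigma>_def using s by (intro grid_above_in_stops_from[OF _ _ st(1) refl]) auto
    then have \<sigma>: "\<sigma> \<in> stops T t" by (simp add: stops_from_def)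
    have \<sigma>r: "\<exists>i\<le>Suc m. \<sigma> x = r m i" if x: "x \<in> Omega T t" for x
    proof -
      have "\<tau> x \<in> {s..T}" using st(1) stops_range[of \<tau> T t x] x by (auto simp: stops_from_def)
      from grid_above_bounds(4)[OF this refl, of m] show ?thesis unfolding \<sigma>_def r_def .
    qed
    \<comment> \<open>Closeness of level sets is measured by Q weighted with the dominator, since
      two payoffs differ by at most twice the dominator where their stopping times disagree.\<close>
    define \<mu> where "\<mu> = density Q (\<lambda>x. ennreal (dominator t \<omega> x))"
    have dom0: "0 \<le> dominator t \<omega> x" if "x \<in> Omega T t" for x
      using payoff_abs_le[where \<tau>=\<sigma> and \<gamma>=\<gamma>, OF t w that stops_range[OF \<sigma> that] stops_range[OF st(2) that]] by linarith
    have dom_m[measurable]: "dominator t \<omega> \<in> borel_measurable Q" using Q(2) by simp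
    have fin: "(\<integral>\<^sup>+x. ennreal (dominator t \<omega> x) \<partial>Q) = ennreal (\<integral>x. dominator t \<omega> x \<partial>Q)"
      using dom0 spQ by (intro nn_integral_eq_integral Q(2) AE_I2) auto
    have s\<mu>: "sets \<mu> = sets (canon_filt T t T)" "space \<mu> = Omega T t" using Q spQ by (simp_all add: \<mu>_def)
    interpret \<mu>: finite_measure \<mu>
    proof
      have "emeasure \<mu> (space \<mu>) = (\<integral>\<^sup>+x. ennreal (dominator t \<omega> x) \<partial>Q)"
        by (simp add: \<mu>_def emeasure_density cong: nn_integral_cong)
      then show "emeasure \<mu> (space \<mu>) \<noteq> \<infinity>" using fin by simp
    qed
    have meas\<mu>: "measure \<mu> N = (\<integral>x. indicator N x * dominator t \<omega> x \<partial>Q)" if N[measurable]: "N \<in> sets Q" for N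
    proof -
      have "emeasure \<mu> N = (\<integral>\<^sup>+x. ennreal (indicator N x * dominator t \<omega> x) \<partial>Q)"
        unfolding \<mu>_def by (subst emeasure_density) (auto intro!: nn_integral_cong simp: indicator_def)
      also have "\<dots> = ennreal (\<integral>x. indicator N x * dominator t \<omega> x \<partial>Q)"
        using dom0 spQ integrable_real_mult_indicator[OF N Q(2)]
        by (intro nn_integral_eq_integral) (auto simp: mult.commute)
      finally have "emeasure \<mu> N = ennreal (\<integral>x. indicator N x * dominator t \<omega> x \<partial>Q)" .
      moreover have "0 \<le> (\<integral>x. indicator N x * dominator t \<omega> x \<partial>Q)"
        using dom0 spQ by (intro integral_nonneg_AE AE_I2) auto
      ultimately show ?thesis by (simp add: measure_def)
    qed
    define E where "E i = {x\<in>Omega T t. \<sigma> x = r m i}" for i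
    have E: "E i \<in> sets (canon_filt T t (r m i))" for i
    proof -
      have "E i = {x\<in>Omega T t. \<sigma> x \<le> r m i} - {x\<in>Omega T t. \<sigma> x < r m i}" by (auto simp: E_def)
      also have "\<dots> \<in> sets (canon_filt T t (r m i))" by (intro sets.Diff stops_sets stops_sets_less \<sigma>)
      finally show ?thesis .
    qed
    \<comment> \<open>There are m + 2 level sets, so the weight of the disagreement is at most e /
      4. Doubled, it uses up the half of e left over by the rounding.\<close>
    define d where "d = e / (4 * (real m + 3))"
    have d: "0 < d" using e by (simp add: d_def)
    have inR: "r m i \<in> R" if "i \<le> Suc m" for i using that by (auto simp: R_def)
    have "\<exists>A\<in>generated_algebra (Omega T t) (G (r m i)). measure \<mu> (sym_diff (E i) A) < d" if i: "i \<le> Suc m" for i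
      using \<mu>.generated_algebra_approx[of "G (r m i)" "E i" d] d E[of i] G(2,3)[OF inR[OF i]]
        sets_canon_filt_le_T[of T t "r m i"] unfolding s\<mu> by auto
    then obtain A where A: "\<And>i. i \<le> Suc m \<Longrightarrow> A i \<in> generated_algebra (Omega T t) (G (r m i))"
      "\<And>i. i \<le> Suc m \<Longrightarrow> measure \<mu> (sym_diff (E i) (A i)) < d" by metis
    define ps where "ps = map (\<lambda>i. (r m i, A i)) [0..<m+2]"
    have ps: "ps \<in> PS" using A(1) inR by (auto simp: PS_def ps_def in_lists_conv_set)
    have "{0..<m + 2} = {..Suc m}" by auto
    then have set_ps: "set ps = (\<lambda>i. (r m i, A i)) ` {..Suc m}" unfolding ps_def set_map set_upt by (simp only:)
    define \<sigma>' where "\<sigma>' = first_hit T ps"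
    have \<sigma>': "\<sigma>' \<in> stops T t" using PS_stops[OF ps] by (simp add: \<sigma>'_def stops_from_def)
    have AQ: "A i \<in> sets Q" "E i \<in> sets Q" if i: "i \<le> Suc m" for i
    proof -
      have "A i \<in> sets (canon_filt T t (r m i))"
        using generated_algebra_sets[OF G(2)[OF inR[OF i]], of "A i"] A(1)[OF i] by simp
      then show "A i \<in> sets Q" "E i \<in> sets Q" using E[of i] sets_canon_filt_le_T[of T t "r m i"] Q(1) by auto
    qed
    define N where "N = (\<Union>i\<in>{..Suc m}. sym_diff (E i) (A i))"
    have SD: "sym_diff (E i) (A i) \<in> sets Q" if "i \<in> {..Suc m}" for i
    proof -
      from that have i: "i \<le> Suc m" by simp
      show ?thesis by (rule sets.Un[OF sets.Diff[OF AQ(2)[OF i] AQ(1)[OF i]] sets.Diff[OF AQ(1)[OF i] AQ(2)[OF i]]])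
    qed
    have N: "N \<in> sets Q" unfolding N_def by (rule sets.finite_UN[OF _ SD]) simp
    have agree: "\<sigma>' x = \<sigma> x" if x: "x \<in> Omega T t" "x \<notin> N" for x
    proof -
      have iff: "x \<in> A i \<longleftrightarrow> \<sigma> x = r m i" if "i \<le> Suc m" for i
      proof -
        have "i \<in> {..Suc m}" using that by simp
        then have "x \<notin> sym_diff (E i) (A i)" using x(2) unfolding N_def by blast
        then show ?thesis using x(1) unfolding E_def by blast
      qed
      obtain i where i: "i \<le> Suc m" "\<sigma> x = r m i" using \<sigma>r[OF x(1)] by blast
      have "(\<sigma> x, A i) \<in> set ps" unfolding set_ps i(2) using i(1) by (intro imageI) simp
      moreover have "x \<in> A i" using iff[OF i(1)] i(2) by simp
      \<comment> \<open>Uniqueness is claimed for the time and not for the index: when s = T all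
        grid times coincide.\<close>
      moreover have "u = \<sigma> x" if mem: "(u, B) \<in> set ps" "x \<in> B" for u B
      proof -
        obtain j where j: "(u, B) = (r m j, A j)" "j \<in> {..Suc m}" using mem(1) unfolding set_ps by (rule imageE)
        then show ?thesis using iff[of j] mem(2) by simp
      qed
      ultimately have "{u. \<exists>B. (u, B) \<in> set ps \<and> x \<in> B} = {\<sigma> x}" by blast
      then show ?thesis using stops_range[OF \<sigma> x(1)] by (simp add: \<sigma>'_def first_hit_def)
    qed
    have int: "integrable Q (payoff T g L U t \<omega> \<sigma> \<gamma>)" "integrable Q (payoff T g L U t \<omega> \<sigma>' \<gamma>)"
      by (intro integrable_payoff_dominated[OF t w Q] \<sigma> \<sigma>' st(2))+
    have intN: "integrable Q (\<lambda>x. indicator N x * dominator t \<omega> x)"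
      using integrable_real_mult_indicator[OF N Q(2)] by (simp add: mult.commute)
    have "(\<integral>x. payoff T g L U t \<omega> \<sigma> \<gamma> x \<partial>Q) \<le> (\<integral>x. payoff T g L U t \<omega> \<sigma>' \<gamma> x + 2 * (indicator N x * dominator t \<omega> x) \<partial>Q)"
    proof (rule integral_mono)
      fix x assume "x \<in> space Q"
      then have x: "x \<in> Omega T t" by (simp add: spQ)
      show "payoff T g L U t \<omega> \<sigma> \<gamma> x \<le> payoff T g L U t \<omega> \<sigma>' \<gamma> x + 2 * (indicator N x * dominator t \<omega> x)"
      proof (cases "x \<in> N")
        case True
        then show ?thesis
          using payoff_abs_le[where \<tau>=\<sigma> and \<gamma>=\<gamma>, OF t w x stops_range[OF \<sigma> x] stops_range[OF st(2) x]]
            payoff_abs_le[where \<tau>=\<sigma>' and \<gamma>=\<gamma>, OF t w x stops_range[OF \<sigma>' x] stops_range[OF st(2) x]]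
          by (simp add: abs_le_iff)
      next
        case False
        then show ?thesis using agree[OF x] by (simp add: payoff_def)
      qed
    qed (use int intN in auto)
    also have "\<dots> = (\<integral>x. payoff T g L U t \<omega> \<sigma>' \<gamma> x \<partial>Q) + 2 * measure \<mu> N"
      using int intN by (simp add: meas\<mu>[OF N])
    also have "measure \<mu> N \<le> (\<Sum>i\<le>Suc m. measure \<mu> (sym_diff (E i) (A i)))"
      unfolding N_def
    proof (rule \<mu>.finite_measure_subadditive_finite)
      show "(\<lambda>i. sym_diff (E i) (A i)) ` {..Suc m} \<subseteq> sets \<mu>" unfolding s\<mu>(1) Q(1)[symmetric] using SD by blast
    qed simp
    also have "\<dots> \<le> (\<Sum>i\<le>Suc m. d)" using A(2) by (intro sum_mono less_imp_le) auto
    also have "\<dots> \<le> e / 4"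
    proof -
      have "(\<Sum>i\<le>Suc m. d) \<le> (real m + 3) * d" using d by (simp add: algebra_simps)
      also have "\<dots> = e / 4"
      proof -
        have "real m + 3 \<noteq> 0" by linarith
        then show ?thesis unfolding d_def by (simp add: divide_simps)
      qed
      finally show ?thesis .
    qed
    finally have "(\<integral>x. payoff T g L U t \<omega> \<tau> \<gamma> x \<partial>Q) - e < (\<integral>x. payoff T g L U t \<omega> \<sigma>' \<gamma> x \<partial>Q)"
      using m e unfolding \<sigma>_def[abs_def] by simp
    moreover obtain k where "from_nat_into PS k = ps" using from_nat_into_surj[OF cPS ps] by blast
    ultimately show "\<exists>k. (\<integral>x. payoff T g L U t \<omega> \<tau> \<gamma> x \<partial>Q) - e < (\<integral>x. payoff T g L U t \<omega> (C k) \<gamma> x \<partial>Q)"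
      unfolding C_def \<sigma>'_def by metis
  qed
qed

end

subsection \<open>Disintegration\<close>

context
  fixes T t s :: real and P :: "('d::finite) path measure" and Q :: "'d path \<Rightarrow> 'd path measure"
  assumes ts: "t \<le> s" "s \<le> T" and P: "prob_space P" "sets P = sets (canon_filt T t T)"
    and rcpd: "is_rcpd T t s P Q"
begin

private lemma space_P: "space P = Omega T t"
  using sets_eq_imp_space_eq[OF P(2)] by simp

private lemma Q_kernel: "Q \<in> canon_filt T t s \<rightarrow>\<^sub>M subprob_algebra (canon_filt T t T)"
  using rcpd by (auto simp: is_rcpd_def intro: measurable_prob_algebraD)

private lemma Q_kernel_P: "Q \<in> P \<rightarrow>\<^sub>M subprob_algebra (canon_filt T t T)"
  unfolding measurable_cong_sets[OF P(2) refl] by (rule measurable_canon_filt_T[OF Q_kernel])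

lemma rcpd_prob:
  assumes "x \<in> Omega T t"
  shows "prob_space (Q x)" "sets (Q x) = sets (canon_filt T t T)" "space (Q x) = Omega T t"
proof -
  have "Q x \<in> space (prob_algebra (canon_filt T t T))"
    using rcpd assms by (intro measurable_space[of Q "canon_filt T t s"]) (auto simp: is_rcpd_def)
  then show "prob_space (Q x)" and 1: "sets (Q x) = sets (canon_filt T t T)" by (auto simp: space_prob_algebra)
  show "space (Q x) = Omega T t" using sets_eq_imp_space_eq[OF 1] by simp
qed

text \<open>The defining property of the conditional law holds almost surely for each event
  separately. Integrated over P it shows that binding P with the kernel returns P, and the iterated
  integral follows.\<close>

lemma rcpd_nn_integral:
  assumes f: "f \<in> borel_measurable (canon_filt T t T)"
  shows "(\<integral>\<^sup>+x. f x \<partial>P) = (\<integral>\<^sup>+x. \<integral>\<^sup>+z. f z \<partial>Q x \<partial>P)"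
proof -
  interpret P: prob_space P by (rule P(1))
  have sub: "subalgebra P (canon_filt T t s)"
    using sets_canon_filt_le_T[of T t s] by (simp add: subalgebra_def space_P P(2))
  interpret finite_measure_subalgebra P "canon_filt T t s"
    by unfold_locales (rule sub)
  have "bind P Q = P"
  proof (rule measure_eqI)
    have ne: "space P \<noteq> {}" by (rule P.not_empty)
    show sets: "sets (bind P Q) = sets P"
      using sets_bind[OF subprob_measurableD(2)[OF Q_kernel_P] ne] P(2) by simp
    fix A assume "A \<in> sets (bind P Q)"
    then have A: "A \<in> sets (canon_filt T t T)" "A \<in> sets P" unfolding sets P(2) by simp_all
    have m: "(\<lambda>x. measure (Q x) A) \<in> borel_measurable P"
      by (rule measurable_compose[OF Q_kernel_P measurable_measure_subprob_algebra[OF A(1)]])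
    have AE: "AE x in P. measure (Q x) A = real_cond_exp P (canon_filt T t s) (indicator A) x"
      using rcpd A by (simp add: is_rcpd_def)
    have iA: "integrable P (indicat_real A)" using A(2) by (auto simp: less_top[symmetric])
    have emb: "emeasure (Q x) A = ennreal (measure (Q x) A)" if "x \<in> space P" for x
    proof -
      interpret prob_space "Q x" using that by (intro rcpd_prob) (simp add: space_P)
      show ?thesis by (rule emeasure_eq_measure)
    qed
    have bound: "integrable P (\<lambda>x. measure (Q x) A)"
    proof (rule P.integrable_const_bound[where B=1])
      have "measure (Q x) A \<le> 1" if "x \<in> space P" for x
        using that by (intro prob_space.prob_le_1 rcpd_prob) (simp add: space_P)
      then show "AE x in P. norm (measure (Q x) A) \<le> 1" by (intro AE_I2) simp
    qed (rule m)
    have "emeasure (bind P Q) A = (\<integral>\<^sup>+x. emeasure (Q x) A \<partial>P)"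
      by (rule emeasure_bind[OF ne Q_kernel_P A(1)])
    also have "\<dots> = (\<integral>\<^sup>+x. ennreal (measure (Q x) A) \<partial>P)" by (intro nn_integral_cong emb)
    also have "\<dots> = ennreal (\<integral>x. measure (Q x) A \<partial>P)" by (intro nn_integral_eq_integral bound) simp
    also have "(\<integral>x. measure (Q x) A \<partial>P) = (\<integral>x. real_cond_exp P (canon_filt T t s) (indicator A) x \<partial>P)"
      by (intro integral_cong_AE m AE borel_measurable_cond_exp2)
    also have "\<dots> = (\<integral>x. indicator A x \<partial>P)" by (rule real_cond_exp_int(2)[OF iA])
    also have "\<dots> = measure P A" using A(2) by simp
    finally show "emeasure (bind P Q) A = emeasure P A" by (simp add: P.emeasure_eq_measure)
  qed
  then show ?thesis using nn_integral_bind[OF f Q_kernel_P] by simp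
qed

private lemma rcpd_integral_nonneg:
  fixes f :: "'d path \<Rightarrow> real"
  assumes f: "integrable P f" and pos: "\<And>x. 0 \<le> f x"
  shows "(AE x in P. integrable (Q x) f) \<and> integrable P (\<lambda>x. \<integral>z. f z \<partial>Q x) \<and> (\<integral>x. f x \<partial>P) = (\<integral>x. \<integral>z. f z \<partial>Q x \<partial>P)"
proof -
  have fm: "f \<in> borel_measurable (canon_filt T t T)"
    using borel_measurable_integrable[OF f] unfolding measurable_cong_sets[OF P(2) refl] .
  then have fm': "(\<lambda>x. ennreal (f x)) \<in> borel_measurable (canon_filt T t T)" by measurable
  have m: "(\<lambda>x. \<integral>\<^sup>+z. ennreal (f z) \<partial>Q x) \<in> borel_measurable P"
    by (rule measurable_compose[OF Q_kernel_P nn_integral_measurable_subprob_algebra[OF fm']])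
  have m': "(\<lambda>x. \<integral>z. f z \<partial>Q x) \<in> borel_measurable P"
    by (rule measurable_compose[OF Q_kernel_P integral_measurable_subprob_algebra[OF fm]])
  have eq: "ennreal (\<integral>x. f x \<partial>P) = (\<integral>\<^sup>+x. \<integral>\<^sup>+z. ennreal (f z) \<partial>Q x \<partial>P)"
    using nn_integral_eq_integral[OF f] pos rcpd_nn_integral[OF fm'] by simp
  then have "AE x in P. (\<integral>\<^sup>+z. ennreal (f z) \<partial>Q x) \<noteq> \<infinity>"
    by (intro nn_integral_PInf_AE m) (metis ennreal_neq_top infinity_ennreal_def)
  then have int: "AE x in P. integrable (Q x) f"
  proof (rule AE_mp, intro AE_I2 impI)
    fix x assume x: "x \<in> space P" and fin: "(\<integral>\<^sup>+z. ennreal (f z) \<partial>Q x) \<noteq> \<infinity>"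
    have "f \<in> borel_measurable (Q x)"
      using fm x unfolding measurable_cong_sets[OF rcpd_prob(2) refl] by (simp add: space_P measurable_cong_sets[OF rcpd_prob(2) refl])
    then show "integrable (Q x) f"
      using fin pos by (intro integrableI_nonneg) (auto simp: top.not_eq_extremum less_top)
  qed
  have "AE x in P. (\<integral>\<^sup>+z. ennreal (f z) \<partial>Q x) = ennreal (\<integral>z. f z \<partial>Q x)"
    using int by eventually_elim (use pos in \<open>auto intro!: nn_integral_eq_integral\<close>)
  then have "(\<integral>\<^sup>+x. \<integral>\<^sup>+z. ennreal (f z) \<partial>Q x \<partial>P) = (\<integral>\<^sup>+x. ennreal (\<integral>z. f z \<partial>Q x) \<partial>P)"
    by (rule nn_integral_cong_AE)
  then have eq': "(\<integral>\<^sup>+x. ennreal (\<integral>z. f z \<partial>Q x) \<partial>P) = ennreal (\<integral>x. f x \<partial>P)" using eq by simp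
  have nn: "0 \<le> (\<integral>z. f z \<partial>Q x)" "0 \<le> (\<integral>x. f x \<partial>P)" for x
    using pos by (auto intro!: Bochner_Integration.integral_nonneg)
  have "integrable P (\<lambda>x. \<integral>z. f z \<partial>Q x)"
    by (rule integrableI_nn_integral_finite[OF m' _ eq']) (use nn in auto)
  moreover from this have "ennreal (\<integral>x. \<integral>z. f z \<partial>Q x \<partial>P) = ennreal (\<integral>x. f x \<partial>P)"
    using nn_integral_eq_integral[of P "\<lambda>x. \<integral>z. f z \<partial>Q x"] nn(1) eq' by simp
  ultimately show ?thesis using int nn by (simp add: Bochner_Integration.integral_nonneg)
qed

lemma rcpd_integral:
  fixes f :: "'d path \<Rightarrow> real"
  assumes f: "integrable P f"
  shows "AE x in P. integrable (Q x) f" "integrable P (\<lambda>x. \<integral>z. f z \<partial>Q x)" "(\<integral>x. f x \<partial>P) = (\<integral>x. \<integral>z. f z \<partial>Q x \<partial>P)"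
proof -
  \<comment> \<open>f is written as (f + |f|) - |f|, a difference of two nonnegative integrable
    functions.\<close>
  have i1: "integrable P (\<lambda>x. \<bar>f x\<bar>)" and i2: "integrable P (\<lambda>x. f x + \<bar>f x\<bar>)" using f by auto
  note 1 = rcpd_integral_nonneg[OF i1 abs_ge_zero]
  have "0 \<le> f x + \<bar>f x\<bar>" for x by linarith
  note 2 = rcpd_integral_nonneg[OF i2 this]
  have AE: "AE x in P. integrable (Q x) (\<lambda>x. \<bar>f x\<bar>) \<and> integrable (Q x) (\<lambda>x. f x + \<bar>f x\<bar>)"
    using 1 2 by (simp add: AE_conj_iff)
  have fm: "f \<in> borel_measurable (canon_filt T t T)"
    using borel_measurable_integrable[OF f] unfolding measurable_cong_sets[OF P(2) refl] .
  show int: "AE x in P. integrable (Q x) f"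
    using AE
  proof eventually_elim
    case (elim x)
    then have "integrable (Q x) (\<lambda>x. (f x + \<bar>f x\<bar>) - \<bar>f x\<bar>)" by (intro Bochner_Integration.integrable_diff) auto
    then show ?case by simp
  qed
  have m: "(\<lambda>x. \<integral>z. f z \<partial>Q x) \<in> borel_measurable P"
    by (rule measurable_compose[OF Q_kernel_P integral_measurable_subprob_algebra[OF fm]])
  have eq: "AE x in P. (\<integral>z. f z \<partial>Q x) = (\<integral>z. f z + \<bar>f z\<bar> \<partial>Q x) - (\<integral>z. \<bar>f z\<bar> \<partial>Q x)"
    using AE int by eventually_elim simp
  have d: "integrable P (\<lambda>x. (\<integral>z. f z + \<bar>f z\<bar> \<partial>Q x) - (\<integral>z. \<bar>f z\<bar> \<partial>Q x))"
    using 1 2 by (intro Bochner_Integration.integrable_diff) auto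
  show "integrable P (\<lambda>x. \<integral>z. f z \<partial>Q x)"
    by (rule integrable_cong_AE_imp[OF d m]) (use eq in auto)
  have "(\<integral>x. \<integral>z. f z \<partial>Q x \<partial>P) = (\<integral>x. (\<integral>z. f z + \<bar>f z\<bar> \<partial>Q x) - (\<integral>z. \<bar>f z\<bar> \<partial>Q x) \<partial>P)"
    by (rule integral_cong_AE[OF m _ eq]) (use d in auto)
  also have "\<dots> = (\<integral>x. f x + \<bar>f x\<bar> \<partial>P) - (\<integral>x. \<bar>f x\<bar> \<partial>P)"
    using 1 2 by (subst Bochner_Integration.integral_diff) auto
  also have "\<dots> = (\<integral>x. f x \<partial>P)" using f i1 by simp
  finally show "(\<integral>x. f x \<partial>P) = (\<integral>x. \<integral>z. f z \<partial>Q x \<partial>P)" by simp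
qed

private lemma rcpd_AE_image:
  assumes "x \<in> Omega T t"
  shows "paste T t s x ` Omega T s \<in> sets (Q x)" "AE z in Q x. z \<in> paste T t s x ` Omega T s"
proof -
  interpret prob_space "Q x" by (rule rcpd_prob[OF assms])
  have 1: "measure (Q x) (paste T t s x ` Omega T s) = 1" using rcpd assms by (simp add: is_rcpd_def)
  \<comment> \<open>The measure of a non-measurable set is 0 by convention, so measure 1 forces
    measurability.\<close>
  then show s: "paste T t s x ` Omega T s \<in> sets (Q x)" by (metis measure_notin_sets zero_neq_one)
  show "AE z in Q x. z \<in> paste T t s x ` Omega T s" using prob_eq_1[OF s] 1 by simp
qed

lemma rcpd_AE_agree:
  assumes "x \<in> Omega T t"
  shows "AE z in Q x. z \<in> Omega T t \<and> (\<forall>r\<in>{t..s}. z r = x r)"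
  using rcpd_AE_image(2)[OF assms] unfolding paste_image_eq[OF ts assms] by simp

text \<open>Q x is concentrated on the paths pasted onto x, where pasting and \<open>tail\<close>
  are inverse to each other, so images under pasting can be traded for preimages under
  \<open>tail\<close>. As a push-forward, the shifted law admits a change of variables in
  integrals.\<close>

lemma shift_prob_eq_distr:
  assumes x: "x \<in> Omega T t"
  shows "shift_prob T t s Q x = distr (Q x) (canon_filt T s T) (tail T s)"
proof -
  let ?D = "distr (Q x) (canon_filt T s T) (tail T s)"
  interpret prob_space "Q x" by (rule rcpd_prob[OF x])
  have tm: "tail T s \<in> Q x \<rightarrow>\<^sub>M canon_filt T s T"
    unfolding measurable_cong_sets[OF rcpd_prob(2)[OF x] refl] using ts by (intro measurable_tail) auto
  have sub: "sets (canon_filt T s T) \<subseteq> Pow (Omega T s)"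
    using sets.space_closed[of "canon_filt T s T"] by simp
  have "shift_prob T t s Q x = measure_of (Omega T s) (sets (canon_filt T s T)) (emeasure ?D)"
    unfolding shift_prob_def
  proof (rule measure_of_eq[OF sub])
    fix A :: "'d path set" assume "A \<in> sigma_sets (Omega T s) (sets (canon_filt T s T))"
    then have A: "A \<in> sets (canon_filt T s T)"
      using sets.sigma_sets_eq[of "canon_filt T s T :: 'd path measure"] by simp
    then have A': "A \<subseteq> Omega T s" using sub by blast
    have B: "tail T s -` A \<inter> space (Q x) \<in> sets (Q x)" by (rule measurable_sets[OF tm A])
    have eq: "paste T t s x ` A = (tail T s -` A \<inter> space (Q x)) \<inter> paste T t s x ` Omega T s"
    proof
      show "paste T t s x ` A \<subseteq> (tail T s -` A \<inter> space (Q x)) \<inter> paste T t s x ` Omega T s"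
      proof
        fix z assume "z \<in> paste T t s x ` A"
        then obtain y where y: "y \<in> A" "z = paste T t s x y" by blast
        then have "y \<in> Omega T s" using A' by blast
        then show "z \<in> (tail T s -` A \<inter> space (Q x)) \<inter> paste T t s x ` Omega T s"
          using y ts x by (auto simp: tail_paste rcpd_prob(3)[OF x] intro!: paste_in_Omega)
      qed
      show "(tail T s -` A \<inter> space (Q x)) \<inter> paste T t s x ` Omega T s \<subseteq> paste T t s x ` A"
        using ts by (auto simp: tail_paste)
    qed
    have "emeasure (Q x) (paste T t s x ` A) = emeasure (Q x) (tail T s -` A \<inter> space (Q x))"
    proof (rule emeasure_eq_AE)
      show "AE z in Q x. (z \<in> paste T t s x ` A) = (z \<in> tail T s -` A \<inter> space (Q x))"
        using rcpd_AE_image(2)[OF x] unfolding eq by eventually_elim blast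
      show "paste T t s x ` A \<in> sets (Q x)" unfolding eq by (rule sets.Int[OF B rcpd_AE_image(1)[OF x]])
    qed (rule B)
    also have "\<dots> = emeasure ?D A" by (rule emeasure_distr[OF tm A, symmetric])
    finally show "emeasure (Q x) (paste T t s x ` A) = emeasure ?D A" .
  qed
  also have "\<dots> = ?D" using measure_of_of_measure[of ?D] by simp
  finally show ?thesis .
qed

text \<open>Measurability at time s and not merely at T: the index of the reply, built from such
  integrals, must be known at s.\<close>

lemma rcpd_measurable_integral:
  fixes f :: "'d path \<Rightarrow> real"
  assumes "f \<in> borel_measurable (canon_filt T t T)"
  shows "(\<lambda>x. \<integral>z. f z \<partial>Q x) \<in> borel_measurable (canon_filt T t s)"
  by (rule measurable_compose[OF Q_kernel integral_measurable_subprob_algebra[OF assms]])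

end

subsection \<open>The lower estimate\<close>

context game_class
begin

text \<open>When neither player stops before s the payoff splits at s, and associativity of pasting
  identifies the rest with the game started at s from the pasted prefix. The cut-off
  \<open>max s\<close> turns the shifted \<gamma> into a stopping time of the later space even where
  \<gamma> falls before s.\<close>

lemma payoff_after:
  assumes ts: "0 \<le> t" "t \<le> s" "s \<le> T" and w: "\<omega> \<in> Omega T 0" and x: "x \<in> Omega T t" and y: "y \<in> Omega T s"
    and \<sigma>: "\<sigma> y \<in> {s..T}" and \<gamma>: "\<gamma> (paste T t s x y) \<in> {s..T}"
  shows "payoff T g L U t \<omega> (\<lambda>z. \<sigma> (tail T s z)) \<gamma> (paste T t s x y) =
    payoff T g L U s (paste T 0 t \<omega> x) \<sigma> (\<lambda>y. max s (\<gamma> (paste T t s x y))) y + (LBINT r:{t..s}. shift_proc T g t \<omega> r x)"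
proof -
  let ?z = "paste T t s x y" and ?m = "min (\<sigma> y) (\<gamma> (paste T t s x y))"
  have t: "t \<in> {0..T}" and s: "s \<in> {0..T}" using ts by auto
  have z: "?z \<in> Omega T t" using ts x y by (intro paste_in_Omega) auto
  have px: "paste T 0 t \<omega> x \<in> Omega T 0" using ts w x by (intro paste_in_Omega) auto
  have shift: "shift_proc T X t \<omega> r ?z = shift_proc T X s (paste T 0 t \<omega> x) r y" for X r
    unfolding shift_proc_def using paste_assoc[OF ts, of \<omega> x y] by simp
  have tl: "tail T s ?z = y" by (rule tail_paste[OF ts(2,3) y])
  have "(LBINT r:{t..?m}. shift_proc T g t \<omega> r ?z) = (LBINT r:{t..s}. shift_proc T g t \<omega> r ?z) + (LBINT r:{s..?m}. shift_proc T g t \<omega> r ?z)"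
    using ts \<sigma> \<gamma> by (intro set_integral_split_Icc shift_continuous[OF _ t w z]) auto
  also have "(LBINT r:{t..s}. shift_proc T g t \<omega> r ?z) = (LBINT r:{t..s}. shift_proc T g t \<omega> r x)"
  proof (rule set_lebesgue_integral_cong)
    show "\<forall>r. r \<in> {t..s} \<longrightarrow> shift_proc T g t \<omega> r ?z = shift_proc T g t \<omega> r x"
    proof (intro allI impI)
      fix r assume r: "r \<in> {t..s}"
      show "shift_proc T g t \<omega> r ?z = shift_proc T g t \<omega> r x"
        unfolding shift_proc_def
      proof (rule process_cong)
        show "paste T 0 t \<omega> ?z u = paste T 0 t \<omega> x u" if "u \<in> {0..r}" for u
          using that r ts paste_eq_left[OF ts(2,3) y, of u x] by (auto simp: paste_def)
      qed (use r ts w x z px in \<open>auto intro!: paste_in_Omega\<close>)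
    qed
  qed simp
  also have "(LBINT r:{s..?m}. shift_proc T g t \<omega> r ?z) = (LBINT r:{s..?m}. shift_proc T g s (paste T 0 t \<omega> x) r y)"
    by (simp only: shift)
  finally have "(LBINT r:{t..?m}. shift_proc T g t \<omega> r ?z) =
    (LBINT r:{t..s}. shift_proc T g t \<omega> r x) + (LBINT r:{s..?m}. shift_proc T g s (paste T 0 t \<omega> x) r y)" .
  moreover have "max s (\<gamma> ?z) = \<gamma> ?z" using \<gamma> by simp
  ultimately show ?thesis unfolding payoff_def tl by (simp add: shift)
qed

lemma stops_after_paste:
  assumes ts: "t \<le> s" "s \<le> T" and x: "x \<in> Omega T t" and \<gamma>: "\<gamma> \<in> stops T t"
  shows "(\<lambda>y. max s (\<gamma> (paste T t s x y))) \<in> stops T s"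
proof (rule stopsI)
  show "max s (\<gamma> (paste T t s x y)) \<in> {s..T}" if "y \<in> Omega T s" for y
    using stops_range[OF \<gamma> paste_in_Omega[OF ts x that]] ts by auto
  show "{y \<in> Omega T s. max s (\<gamma> (paste T t s x y)) \<le> u} \<in> sets (canon_filt T s u)" if u: "u \<in> {s..<T}" for u
  proof -
    have "paste T t s x -` {z\<in>Omega T t. \<gamma> z \<le> u} \<inter> space (canon_filt T s u) \<in> sets (canon_filt T s u)"
      by (rule measurable_sets[OF measurable_paste[OF ts x] stops_sets[OF \<gamma>]])
    moreover have "paste T t s x -` {z\<in>Omega T t. \<gamma> z \<le> u} \<inter> space (canon_filt T s u) = {y \<in> Omega T s. max s (\<gamma> (paste T t s x y)) \<le> u}"
      using u paste_in_Omega[OF ts x] by auto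
    ultimately show ?thesis by (simp only:)
  qed
qed

lemma stops_from_tail:
  assumes ts: "t \<le> s" "s \<le> T" and \<sigma>: "\<sigma> \<in> stops T s"
  shows "(\<lambda>z. \<sigma> (tail T s z)) \<in> stops_from T t s"
proof -
  have rng: "\<sigma> (tail T s z) \<in> {s..T}" if "z \<in> Omega T t" for z
    by (rule stops_range[OF \<sigma> tail_in_Omega[OF ts that]])
  have "(\<lambda>z. \<sigma> (tail T s z)) \<in> stops T t"
  proof (rule stopsI)
    show "\<sigma> (tail T s z) \<in> {t..T}" if "z \<in> Omega T t" for z using rng[OF that] ts by auto
    show "{z \<in> Omega T t. \<sigma> (tail T s z) \<le> u} \<in> sets (canon_filt T t u)" if u: "u \<in> {t..<T}" for u
    proof (cases "s \<le> u")
      case True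
      have "tail T s -` {y\<in>Omega T s. \<sigma> y \<le> u} \<inter> space (canon_filt T t u) \<in> sets (canon_filt T t u)"
        by (rule measurable_sets[OF measurable_tail[OF ts(1) True ts(2)] stops_sets[OF \<sigma>]])
      moreover have "tail T s -` {y\<in>Omega T s. \<sigma> y \<le> u} \<inter> space (canon_filt T t u) = {z \<in> Omega T t. \<sigma> (tail T s z) \<le> u}"
        using tail_in_Omega[OF ts] by auto
      ultimately show ?thesis by (simp only:)
    next
      case False
      then have "\<not> \<sigma> (tail T s z) \<le> u" if "z \<in> Omega T t" for z using rng[OF that] by auto
      then have "{z \<in> Omega T t. \<sigma> (tail T s z) \<le> u} = {}" by blast
      then show ?thesis by (simp only: sets.empty_sets)
    qed
  qed
  then show ?thesis using rng by (auto simp: stops_from_def)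
qed

text \<open>Galmarino's test: the event that \<gamma> equals its value at x is known at that value,
  hence before s, and so cannot separate x from z.\<close>

lemma stops_cong_before:
  assumes \<gamma>: "\<gamma> \<in> stops T t" and s: "s \<le> T" and x: "x \<in> Omega T t" "z \<in> Omega T t" "\<And>r. r \<in> {t..s} \<Longrightarrow> z r = x r" and lt: "\<gamma> x < s"
  shows "\<gamma> z = \<gamma> x"
proof -
  have "{y\<in>Omega T t. \<gamma> y \<le> \<gamma> x} - {y\<in>Omega T t. \<gamma> y < \<gamma> x} \<in> sets (canon_filt T t (\<gamma> x))"
    by (intro sets.Diff stops_sets stops_sets_less \<gamma>)
  from canon_filt_set_cong[OF this x(1,2)] x lt show ?thesis by auto
qed

text \<open>Concerns one path x and its conditional law Q x, under which all paths agree with x up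
  to s; whether \<gamma> stops before s is therefore already decided by x. The factor 1 + T again
  joins one terminal (or value) deviation to the running one.\<close>

lemma conditional_reply:
  fixes \<omega> :: "'d path"
  assumes ts: "0 \<le> t" "t < s" "s \<le> T" and w: "\<omega> \<in> Omega T 0"
    and osc: "\<And>u v. u \<in> {t..s} \<Longrightarrow> v \<in> {t..s} \<Longrightarrow> norm (\<omega> u - \<omega> v) \<le> \<eta>" and eta: "s - t \<le> \<eta>"
    and K: "\<And>X. X \<in> {g, L, U} \<Longrightarrow> \<bar>X s \<omega>\<bar> \<le> K"
    and \<rho>: "modulus \<rho>" "\<And>x. 0 \<le> x \<Longrightarrow> \<rho>\<^sub>0 x \<le> \<rho> x" and pc: "path_continuous_val T g L U \<P> \<rho>"
    and P: "prob_space P" "sets P = sets (canon_filt T t T)" and rcpd: "is_rcpd T t s P Q" and \<gamma>: "\<gamma> \<in> stops T t"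
    and x: "x \<in> Omega T t" and shift: "shift_prob T t s Q x \<in> \<P> s (paste T 0 t \<omega> x)"
    and dom: "integrable (Q x) (dominator t \<omega>)" and e: "0 < e"
  shows "\<exists>\<tau>\<in>stops_from T t s.
    val T g L U \<P> \<infinity> s \<omega> - \<eta> * K - (1 + T) * \<rho> (2 * \<eta> + supnorm t s x) - e < \<J> t \<omega> (Q x) \<tau> \<gamma>"
proof -
  let ?V = "val T g L U \<P> \<infinity> s \<omega>" and ?D = "\<rho> (2 * \<eta> + supnorm t s x)" and ?p = "paste T 0 t \<omega> x"
  have t: "t \<in> {0..T}" and s: "s \<in> {0..T}" "t \<le> s" using ts by auto
  have px: "?p \<in> Omega T 0" using ts w x by (intro paste_in_Omega) auto
  note Qx = rcpd_prob[OF s(2) ts(3) P rcpd x]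
  interpret Qx: prob_space "Q x" by (rule Qx(1))
  note agree = rcpd_AE_agree[OF s(2) ts(3) P rcpd x]
  have eta0: "0 \<le> \<eta>" using ts eta by simp
  have K0: "0 \<le> K" using K[of g] by auto
  have S0: "0 \<le> supnorm t s x" using ts by (intro supnorm_nonneg Omega_continuous_on[OF x]) auto
  have D0: "0 \<le> ?D" using S0 eta0 by (intro modulus_nonneg[OF \<rho>(1)]) auto
  have near: "\<bar>shift_proc T X t \<omega> r z - X s \<omega>\<bar> \<le> ?D"
    if "X \<in> {g, L, U, Psi L U}" "r \<in> {t..s}" "z \<in> Omega T t" "\<forall>r\<in>{t..s}. z r = x r" for X r z
  proof -
    have "supnorm t s z = supnorm t s x" using that(4) by (intro supnorm_cong) auto
    moreover have "\<bar>shift_proc T X t \<omega> r z - X s \<omega>\<bar> \<le> \<rho>\<^sub>0 (2 * \<eta> + supnorm t s z)"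
      using ts by (intro shift_near[OF w _ _ _ that(3) osc that(1,2) eta(1)]) auto
    moreover have "\<rho>\<^sub>0 (2 * \<eta> + supnorm t s x) \<le> ?D" using S0 eta0 by (intro \<rho>(2)) auto
    ultimately show ?thesis by simp
  qed
  have int_g: "\<bar>LBINT r:{t..u}. shift_proc T g t \<omega> r z\<bar> \<le> \<eta> * K + T * ?D"
    if u: "u \<in> {t..s}" and z: "z \<in> Omega T t" "\<forall>r\<in>{t..s}. z r = x r" for u z
    using near[OF _ _ z] K[of g] by (intro integral_g_near[OF ts(1,3) eta(1) u w z(1)]) auto
  show ?thesis
  proof (cases "\<gamma> x < s")
    \<comment> \<open>Replying with s lets the minimizer stop first and collects U at time \<gamma>
      x. This is close to U at (s, \<omega>), which is at least the value.\<close>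
    case True
    have st: "(\<lambda>_. s) \<in> stops_from T t s" using ts const_in_stops[of t s T] by (auto simp: stops_from_def)
    then have st': "(\<lambda>_. s) \<in> stops T t" by (simp add: stops_from_def)
    have int: "integrable (Q x) (payoff T g L U t \<omega> (\<lambda>_. s) \<gamma>)"
      by (rule integrable_payoff_dominated[OF t w Qx(2) dom st' \<gamma>])
    have "(\<integral>z. ?V - \<eta> * K - (1 + T) * ?D \<partial>Q x) \<le> \<J> t \<omega> (Q x) (\<lambda>_. s) \<gamma>"
    proof (rule integral_mono_AE[OF _ int])
      show "AE z in Q x. ?V - \<eta> * K - (1 + T) * ?D \<le> payoff T g L U t \<omega> (\<lambda>_. s) \<gamma> z"
        using agree
      proof eventually_elim
        case (elim z)
        then have z: "z \<in> Omega T t" "\<forall>r\<in>{t..s}. z r = x r" by auto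
        then have eq: "\<gamma> z = \<gamma> x" using stops_cong_before[OF \<gamma> ts(3) x z(1) _ True] by blast
        have r: "\<gamma> x \<in> {t..s}" using stops_range[OF \<gamma> x] True by auto
        have "payoff T g L U t \<omega> (\<lambda>_. s) \<gamma> z = (LBINT r:{t..\<gamma> x}. shift_proc T g t \<omega> r z) + shift_proc T U t \<omega> (\<gamma> x) z"
          using True by (simp add: payoff_def eq min_def)
        moreover have "?V \<le> U s \<omega>" by (rule val_le_U[OF s(1) w])
        ultimately show ?case
          using int_g[OF r z] near[OF _ r z, of U] by (simp add: abs_le_iff algebra_simps)
      qed
    qed simp
    then have "?V - \<eta> * K - (1 + T) * ?D - e < \<J> t \<omega> (Q x) (\<lambda>_. s) \<gamma>" using e by (simp add: Qx.prob_space)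
    then show ?thesis using st by blast
  next
    \<comment> \<open>The game restarts at s under the shifted law. A reply there is carried back by
      \<open>tail\<close>, and path continuity compares the value at the pasted prefix with the
      value at \<omega>.\<close>
    case False
    define \<gamma>s where "\<gamma>s y = max s (\<gamma> (paste T t s x y))" for y
    have \<gamma>s: "\<gamma>s \<in> stops T s" unfolding \<gamma>s_def[abs_def] by (rule stops_after_paste[OF s(2) ts(3) x \<gamma>])
    have "val T g L U \<P> \<infinity> s ?p - e < val T g L U \<P> \<infinity> s ?p" using e by simp
    then obtain \<sigma> where \<sigma>: "\<sigma> \<in> dyadic_stops T s \<infinity>"
      and gt: "val T g L U \<P> \<infinity> s ?p - e < \<J> s ?p (shift_prob T t s Q x) \<sigma> \<gamma>s"
      by (rule val_near_optimal_reply[OF s(1) px shift \<gamma>s])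
    have \<sigma>1: "\<sigma> \<in> stops T s" by (rule dyadic_stops_subset[OF \<sigma>])
    have \<tau>: "(\<lambda>z. \<sigma> (tail T s z)) \<in> stops_from T t s" by (rule stops_from_tail[OF s(2) ts(3) \<sigma>1])
    then have \<tau>': "(\<lambda>z. \<sigma> (tail T s z)) \<in> stops T t" by (simp add: stops_from_def)
    have tm: "tail T s \<in> Q x \<rightarrow>\<^sub>M canon_filt T s T"
      unfolding measurable_cong_sets[OF Qx(2) refl] using ts by (intro measurable_tail) auto
    have pm: "payoff T g L U s ?p \<sigma> \<gamma>s \<in> borel_measurable (canon_filt T s T)"
      by (rule payoff_measurable[OF s(1) px \<sigma>1 \<gamma>s])
    let ?G = "LBINT r:{t..s}. shift_proc T g t \<omega> r x"
    have int: "integrable (Q x) (payoff T g L U t \<omega> (\<lambda>z. \<sigma> (tail T s z)) \<gamma>)"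
      by (rule integrable_payoff_dominated[OF t w Qx(2) dom \<tau>' \<gamma>])
    have "\<J> s ?p (shift_prob T t s Q x) \<sigma> \<gamma>s = (\<integral>z. payoff T g L U s ?p \<sigma> \<gamma>s (tail T s z) \<partial>Q x)"
      unfolding shift_prob_eq_distr[OF s(2) ts(3) P rcpd x] by (rule integral_distr[OF tm pm])
    also have "\<dots> = (\<integral>z. payoff T g L U t \<omega> (\<lambda>z. \<sigma> (tail T s z)) \<gamma> z - ?G \<partial>Q x)"
    proof (rule integral_cong_AE)
      show "AE z in Q x. payoff T g L U s ?p \<sigma> \<gamma>s (tail T s z) = payoff T g L U t \<omega> (\<lambda>z. \<sigma> (tail T s z)) \<gamma> z - ?G"
        using agree
      proof eventually_elim
        case (elim z)
        then have z: "z \<in> Omega T t" "\<And>r. r \<in> {t..s} \<Longrightarrow> z r = x r" by auto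
        have zp: "paste T t s x (tail T s z) = z" by (rule paste_tail[OF s(2) ts(3) z])
        have y: "tail T s z \<in> Omega T s" by (rule tail_in_Omega[OF s(2) ts(3) z(1)])
        \<comment> \<open>Galmarino's test read from z: a stop before s along z would occur along x
          as well.\<close>
        have "s \<le> \<gamma> z"
        proof (rule ccontr)
          assume "\<not> s \<le> \<gamma> z"
          then have "\<gamma> x = \<gamma> z" using z(2) by (intro stops_cong_before[OF \<gamma> ts(3) z(1) x]) auto
          then show False using False \<open>\<not> s \<le> \<gamma> z\<close> by simp
        qed
        then have "\<gamma> (paste T t s x (tail T s z)) \<in> {s..T}" using stops_range[OF \<gamma> z(1)] by (simp add: zp)
        from payoff_after[where \<gamma>=\<gamma> and \<sigma>=\<sigma>, OF ts(1) s(2) ts(3) w x y stops_range[OF \<sigma>1 y] this]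
        show ?case unfolding zp \<gamma>s_def[abs_def, symmetric] by simp
      qed
      show "(\<lambda>z. payoff T g L U s ?p \<sigma> \<gamma>s (tail T s z)) \<in> borel_measurable (Q x)" by (rule measurable_compose[OF tm pm])
    qed (use int in auto)
    also have "\<dots> = \<J> t \<omega> (Q x) (\<lambda>z. \<sigma> (tail T s z)) \<gamma> - ?G" using int by (simp add: Qx.prob_space)
    finally have eq: "\<J> s ?p (shift_prob T t s Q x) \<sigma> \<gamma>s = \<J> t \<omega> (Q x) (\<lambda>z. \<sigma> (tail T s z)) \<gamma> - ?G" .
    have "\<bar>val T g L U \<P> \<infinity> s ?p - ?V\<bar> \<le> \<rho> (supnorm 0 s (\<lambda>r. ?p r - \<omega> r))"
      using pc s(1) px w unfolding path_continuous_val_def by simp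
    also have "\<dots> \<le> ?D"
    proof (rule modulus_mono[OF \<rho>(1)])
      show "0 \<le> supnorm 0 s (\<lambda>r. ?p r - \<omega> r)"
        using ts by (intro supnorm_nonneg continuous_on_diff Omega_continuous_on[OF px] Omega_continuous_on[OF w]) auto
      have "supnorm 0 s (\<lambda>r. ?p r - \<omega> r) \<le> \<eta> + supnorm t s x" using ts by (intro paste_near[OF w _ _ _ x osc]) auto
      then show "supnorm 0 s (\<lambda>r. ?p r - \<omega> r) \<le> 2 * \<eta> + supnorm t s x" using eta0 by simp
    qed
    finally have "?V - ?D \<le> val T g L U \<P> \<infinity> s ?p" by (simp add: abs_le_iff)
    moreover have "- (\<eta> * K + T * ?D) \<le> ?G" using int_g[of s x] ts x by (simp add: abs_le_iff)
    ultimately have "?V - \<eta> * K - (1 + T) * ?D - e < \<J> t \<omega> (Q x) (\<lambda>z. \<sigma> (tail T s z)) \<gamma>"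
      using gt unfolding eq by (simp add: algebra_simps)
    then show ?thesis using \<tau> by blast
  qed
qed

text \<open>The conditional replies exist separately for each x, with no measurable dependence on x,
  and only on a set known to an extension of P. Each x therefore takes the first member of the
  countable dense family that beats its target. The resulting time is a stopping time because the
  index is known at s and every member stops at s or later.\<close>

lemma lower_estimate_core:
  fixes \<omega> :: "'d path"
  assumes ts: "0 \<le> t" "t < s" "s \<le> T" and w: "\<omega> \<in> Omega T 0"
    and osc: "\<And>u v. u \<in> {t..s} \<Longrightarrow> v \<in> {t..s} \<Longrightarrow> norm (\<omega> u - \<omega> v) \<le> \<eta>" and eta: "s - t \<le> \<eta>"
    and K: "\<And>X. X \<in> {g, L, U} \<Longrightarrow> \<bar>X s \<omega>\<bar> \<le> K"
    and \<rho>: "modulus \<rho>" "\<And>x. 0 \<le> x \<Longrightarrow> \<rho>\<^sub>0 x \<le> \<rho> x" and pc: "path_continuous_val T g L U \<P> \<rho>"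
    and sc: "stable_conditioning T \<P>"
    and P: "P \<in> \<P> t \<omega>" and \<gamma>: "\<gamma> \<in> stops T t"
    and intD: "integrable P (\<lambda>x. \<rho> (2 * \<eta> + supnorm t s x))" "(\<integral>x. \<rho> (2 * \<eta> + supnorm t s x) \<partial>P) \<le> c"
    and e: "0 < e"
  shows "\<exists>\<tau>\<in>stops T t. val T g L U \<P> \<infinity> s \<omega> - \<eta> * K - (1 + T) * c - e \<le> \<J> t \<omega> P \<tau> \<gamma>"
proof -
  have t: "t \<in> {0..T}" and s: "s \<in> {t..T}" "t \<le> s" using ts by auto
  note hP = class_hat_probs[OF t w P]
  note PP = hat_probsD(1,2)[OF hP]
  interpret P: prob_space P by (rule PP)
  have eta0: "0 \<le> \<eta>" using ts eta by simp
  obtain Q P' \<Omega>' where rcpd: "is_rcpd T t s P Q" and P': "space P' = Omega T t" "sets (canon_filt T t T) \<subseteq> sets P'"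
      "\<forall>A\<in>sets (canon_filt T t T). emeasure P' A = emeasure P A"
    and \<Omega>': "\<Omega>' \<in> sets P'" "emeasure P' \<Omega>' = 1" "\<forall>\<omega>'\<in>\<Omega>'. shift_prob T t s Q \<omega>' \<in> \<P> s (paste T 0 t \<omega> \<omega>')"
    using sc ts w P unfolding stable_conditioning_def by blast
  note rc = s(2) ts(3) PP rcpd
  obtain C :: "nat \<Rightarrow> 'd path \<Rightarrow> real" where C: "\<And>k. C k \<in> stops_from T t s"
    and dense: "\<And>\<omega> Q \<tau> \<gamma> e. \<omega> \<in> Omega T 0 \<Longrightarrow> sets Q = sets (canon_filt T t T) \<Longrightarrow> integrable Q (dominator t \<omega>) \<Longrightarrow>
      \<tau> \<in> stops_from T t s \<Longrightarrow> \<gamma> \<in> stops T t \<Longrightarrow> 0 < e \<Longrightarrow>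
      \<exists>k. (\<integral>x. payoff T g L U t \<omega> \<tau> \<gamma> x \<partial>Q) - e < (\<integral>x. payoff T g L U t \<omega> (C k) \<gamma> x \<partial>Q)"
    by (rule countable_dense_stops[OF t s(1)]) blast
  have C': "C k \<in> stops T t" and Cs: "\<And>x. x \<in> Omega T t \<Longrightarrow> s \<le> C k x" for k
    using C[of k] by (auto simp: stops_from_def)
  define h where "h x = val T g L U \<P> \<infinity> s \<omega> - \<eta> * K - (1 + T) * \<rho> (2 * \<eta> + supnorm t s x) - e" for x :: "'d path"
  define f where "f k x = \<J> t \<omega> (Q x) (C k) \<gamma>" for k x
  have hm: "h \<in> borel_measurable (canon_filt T t s)"
  proof -
    have "(\<lambda>x. \<rho> (2 * \<eta> + supnorm t s x)) \<in> borel_measurable (canon_filt T t s :: 'd path measure)"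
      using ts eta0 by (intro measurable_modulus_supnorm \<rho>(1)) auto
    then show ?thesis unfolding h_def[abs_def]
      by (intro borel_measurable_diff borel_measurable_times borel_measurable_const)
  qed
  have fm: "f k \<in> borel_measurable (canon_filt T t s)" for k
    unfolding f_def[abs_def] by (rule rcpd_measurable_integral[OF rc payoff_measurable[OF t w C' \<gamma>]])
  have pred: "Measurable.pred (canon_filt T t s) (\<lambda>x. h x < f k x)" for k using hm fm[of k] by measurable
  \<comment> \<open>Where no index beats the target, LEAST is some fixed number, so the index and
    the glued stopping time are defined on every path.\<close>
  define \<kappa> where "\<kappa> x = (LEAST k. h x < f k x)" for x
  have \<kappa>m: "\<kappa> \<in> canon_filt T t s \<rightarrow>\<^sub>M count_space UNIV" unfolding \<kappa>_def[abs_def] by (rule measurable_Least[OF pred])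
  have \<kappa>s: "{x\<in>Omega T t. \<kappa> x = k} \<in> sets (canon_filt T t s)" for k
  proof -
    have "{x\<in>Omega T t. \<kappa> x = k} = \<kappa> -` {k} \<inter> space (canon_filt T t s)" by auto
    also have "\<dots> \<in> sets (canon_filt T t s)" by (rule measurable_sets[OF \<kappa>m]) simp
    finally show ?thesis .
  qed
  define \<tau> where "\<tau> x = C (\<kappa> x) x" for x
  have \<tau>: "\<tau> \<in> stops T t"
  proof (rule stopsI)
    show "\<tau> x \<in> {t..T}" if "x \<in> Omega T t" for x unfolding \<tau>_def by (rule stops_range[OF C' that])
    show "{x \<in> Omega T t. \<tau> x \<le> u} \<in> sets (canon_filt T t u)" if u: "u \<in> {t..<T}" for u
    proof (cases "s \<le> u")
      case True
      have "{x \<in> Omega T t. \<tau> x \<le> u} = (\<Union>k. {x\<in>Omega T t. \<kappa> x = k} \<inter> {x\<in>Omega T t. C k x \<le> u})"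
        by (auto simp: \<tau>_def)
      also have "\<dots> \<in> sets (canon_filt T t u)"
      proof (rule sets.countable_UN, rule subsetI, elim rangeE)
        fix A k assume "A = {x\<in>Omega T t. \<kappa> x = k} \<inter> {x\<in>Omega T t. C k x \<le> u}"
        then show "A \<in> sets (canon_filt T t u)"
          using sets.Int[OF subsetD[OF sets_canon_filt_mono[OF True] \<kappa>s[of k]] stops_sets[OF C'[of k], of u]] by simp
      qed
      finally show ?thesis .
    next
      case False
      then have "\<not> \<tau> x \<le> u" if "x \<in> Omega T t" for x using Cs[OF that, of "\<kappa> x"] by (simp add: \<tau>_def)
      then have "{x \<in> Omega T t. \<tau> x \<le> u} = {}" by blast
      then show ?thesis by (simp only: sets.empty_sets)
    qed
  qed
  have predE: "Measurable.pred (canon_filt T t s) (\<lambda>x. \<exists>k. h x < f k x)" by (rule pred_intros_countable(2)[OF pred])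
  define Gd where "Gd = {x\<in>Omega T t. \<exists>k. h x < f k x}"
  have "Gd = {x\<in>space (canon_filt T t s). \<exists>k. h x < f k x}" by (simp add: Gd_def)
  also have "\<dots> \<in> sets (canon_filt T t s)"
    using predE unfolding Measurable.pred_def .
  finally have Gd: "Gd \<in> sets (canon_filt T t T)" using sets_canon_filt_le_T[of T t s] by blast
  have "AE x in P. integrable (Q x) (dominator t \<omega>)"
    by (rule rcpd_integral(1)[OF rc integrable_dominator[OF t w hP]])
  then obtain N where N: "{x\<in>space P. \<not> integrable (Q x) (dominator t \<omega>)} \<subseteq> N" "emeasure P N = 0" "N \<in> sets P"
    by (rule AE_E)
  have NF: "N \<in> sets (canon_filt T t T)" using N(3) PP(2) by simp
  \<comment> \<open>\<open>\<Omega>'\<close> is measurable only in the extension, but it lies inside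
    this set of the original sigma-algebra, on which P' and P agree. N absorbs the x whose
    conditional law does not integrate the dominator.\<close>
  have cover: "\<Omega>' \<subseteq> Gd \<union> N"
  proof
    fix x assume x': "x \<in> \<Omega>'"
    then have x: "x \<in> Omega T t" using sets.sets_into_space[OF \<Omega>'(1)] P'(1) by blast
    show "x \<in> Gd \<union> N"
    proof (cases "integrable (Q x) (dominator t \<omega>)")
      case False
      then show ?thesis using N(1) x hat_probsD(3)[OF hP] by blast
    next
      case dom: True
      \<comment> \<open>One half of e pays for the reply to the conditional law, the other for
        replacing it by a member of the family.\<close>
      have "0 < e / 2" using e by simp
      have "shift_prob T t s Q x \<in> \<P> s (paste T 0 t \<omega> x)" using \<Omega>'(3) x' by blast
      from conditional_reply[where \<omega>=\<omega> and \<eta>=\<eta> and K=K and \<rho>=\<rho> and Q=Q and x=x and e="e / 2",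
          OF ts w _ eta _ \<rho>(1) _ pc PP rcpd \<gamma> x this dom \<open>0 < e / 2\<close>]
      obtain \<sigma> where \<sigma>: "\<sigma> \<in> stops_from T t s"
        and 1: "val T g L U \<P> \<infinity> s \<omega> - \<eta> * K - (1 + T) * \<rho> (2 * \<eta> + supnorm t s x) - e / 2 < \<J> t \<omega> (Q x) \<sigma> \<gamma>"
        using osc K \<rho>(2) by blast
      obtain k where "\<J> t \<omega> (Q x) \<sigma> \<gamma> - e / 2 < \<J> t \<omega> (Q x) (C k) \<gamma>"
        using dense[OF w rcpd_prob(2)[OF rc x] dom \<sigma> \<gamma> \<open>0 < e / 2\<close>] by blast
      then have "h x < f k x" using 1 unfolding h_def f_def by linarith
      then show ?thesis using x unfolding Gd_def by blast
    qed
  qed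
  have "1 \<le> emeasure P' (Gd \<union> N)"
    using emeasure_mono[OF cover, of P'] Gd NF P'(2) \<Omega>'(2) by auto
  also have "\<dots> = emeasure P (Gd \<union> N)" using P'(3) sets.Un[OF Gd NF] by blast
  also have "\<dots> \<le> emeasure P Gd + emeasure P N" by (rule emeasure_subadditive) (use Gd NF PP(2) in auto)
  finally have "1 \<le> emeasure P Gd" using N(2) by simp
  then have "P.prob Gd = 1" using P.prob_le_1[of Gd] by (simp add: P.emeasure_eq_measure)
  then have Gd_AE: "AE x in P. x \<in> Gd" using P.prob_eq_1[of Gd] Gd PP(2) by simp
  have int: "integrable P (payoff T g L U t \<omega> \<tau> \<gamma>)" by (rule integrable_payoff(1)[OF t w hP \<tau> \<gamma>])
  have best: "h x \<le> \<J> t \<omega> (Q x) \<tau> \<gamma>" if "x \<in> Gd" for x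
  proof -
    have x: "x \<in> Omega T t" using that by (simp add: Gd_def)
    have "\<exists>k. h x < f k x" using that by (simp add: Gd_def)
    then have "h x < f (\<kappa> x) x" unfolding \<kappa>_def by (rule LeastI_ex)
    also have "f (\<kappa> x) x = \<J> t \<omega> (Q x) \<tau> \<gamma>"
      unfolding f_def
    proof (rule integral_cong_AE)
      note mQ = measurable_cong_sets[OF rcpd_prob(2)[OF rc x] refl]
      show "payoff T g L U t \<omega> (C (\<kappa> x)) \<gamma> \<in> borel_measurable (Q x)" "payoff T g L U t \<omega> \<tau> \<gamma> \<in> borel_measurable (Q x)"
        unfolding mQ by (intro payoff_measurable[OF t w] C' \<tau> \<gamma>)+
      show "AE z in Q x. payoff T g L U t \<omega> (C (\<kappa> x)) \<gamma> z = payoff T g L U t \<omega> \<tau> \<gamma> z"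
        using rcpd_AE_agree[OF rc x]
      proof eventually_elim
        case (elim z)
        \<comment> \<open>The index is known at s, hence constant on the paths charged by Q x. Under
          Q x the glued time is thus a single member of the family.\<close>
        then have "z \<in> {y\<in>Omega T t. \<kappa> y = \<kappa> x}"
          using canon_filt_set_cong[OF \<kappa>s[of "\<kappa> x"] x, of z] x by auto
        then have "C (\<kappa> x) z = \<tau> z" by (simp add: \<tau>_def)
        then show ?case by (simp add: payoff_def)
      qed
    qed
    finally show ?thesis by simp
  qed
  have hi: "integrable P h" unfolding h_def[abs_def] using intD(1) by auto
  have "AE x in P. h x \<le> \<J> t \<omega> (Q x) \<tau> \<gamma>" using Gd_AE by eventually_elim (rule best)
  then have "(\<integral>x. h x \<partial>P) \<le> (\<integral>x. \<J> t \<omega> (Q x) \<tau> \<gamma> \<partial>P)"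
    by (rule integral_mono_AE[OF hi rcpd_integral(2)[OF rc int]])
  also have "\<dots> = \<J> t \<omega> P \<tau> \<gamma>" by (rule rcpd_integral(3)[OF rc int, symmetric])
  also have "(\<integral>x. h x \<partial>P) = val T g L U \<P> \<infinity> s \<omega> - \<eta> * K - (1 + T) * (\<integral>x. \<rho> (2 * \<eta> + supnorm t s x) \<partial>P) - e"
    unfolding h_def using intD(1) by (simp add: P.prob_space)
  finally have "val T g L U \<P> \<infinity> s \<omega> - \<eta> * K - (1 + T) * (\<integral>x. \<rho> (2 * \<eta> + supnorm t s x) \<partial>P) - e \<le> \<J> t \<omega> P \<tau> \<gamma>" .
  moreover have "(1 + T) * (\<integral>x. \<rho> (2 * \<eta> + supnorm t s x) \<partial>P) \<le> (1 + T) * c"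
    using intD(2) T_pos by (intro mult_left_mono) auto
  ultimately show ?thesis using \<tau> by (intro bexI[of _ \<tau>]) auto
qed

lemma val_lower:
  fixes \<omega> :: "'d path"
  assumes sc: "stable_conditioning T \<P>" and osc: "oscillation_bound T \<P> \<rho>" and pc: "path_continuous_val T g L U \<P> \<rho>"
    and \<rho>: "modulus \<rho>" "\<And>x. 0 \<le> x \<Longrightarrow> \<rho>\<^sub>0 x \<le> \<rho> x" and w: "\<omega> \<in> Omega T 0" and eps: "0 < \<epsilon>"
  obtains h where "0 < h" "\<And>t s. 0 \<le> t \<Longrightarrow> t < s \<Longrightarrow> s \<le> T \<Longrightarrow> s - t < h \<Longrightarrow>
    val T g L U \<P> \<infinity> s \<omega> \<le> val T g L U \<P> \<infinity> t \<omega> + \<epsilon>"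
proof -
  obtain K where K: "0 \<le> K" "\<And>X s. X \<in> {g, L, U} \<Longrightarrow> s \<in> {0..T} \<Longrightarrow> \<bar>X s \<omega>\<bar> \<le> K"
    using processes_bounded[OF w] by blast
  obtain \<rho>' where \<rho>': "modulus \<rho>'" and expect: "\<And>t s c P. 0 \<le> t \<Longrightarrow> t < s \<Longrightarrow> s \<le> T \<Longrightarrow> s - t \<le> c \<Longrightarrow> c \<le> T \<Longrightarrow> P \<in> \<P> t \<omega> \<Longrightarrow>
      integrable P (\<lambda>x. \<rho> (c + supnorm t s x)) \<and> (\<integral>x. \<rho> (c + supnorm t s x) \<partial>P) \<le> \<rho>' c"
    by (rule oscillation_expectation[OF osc \<rho>(1) w]) blast
  define e where "e = \<epsilon> / 3"
  have e: "0 < e" using eps by (simp add: e_def)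
  have "0 < e / (1 + T)" using e T_pos by simp
  then obtain d where d: "0 < d" "\<And>x. 0 \<le> x \<Longrightarrow> x \<le> d \<Longrightarrow> \<rho>' x < e / (1 + T)" using modulus_small[OF \<rho>'] by blast
  \<comment> \<open>The bounds serve the mean of the random error at 2 \<eta>, the range of the
    oscillation bound and the running payoff. No Markov threshold is divided by here, so a vanishing
    \<rho> does no harm.\<close>
  define \<eta> where "\<eta> = min (d / 2) (min (T / 2) (e / (K + 1)))"
  have "\<eta> \<le> d / 2" "\<eta> \<le> T / 2" "\<eta> \<le> e / (K + 1)" unfolding \<eta>_def by linarith+
  moreover have "0 < \<eta>" using d T_pos e K(1) by (simp add: \<eta>_def)
  ultimately have \<eta>: "0 < \<eta>" "2 * \<eta> \<le> d" "2 * \<eta> \<le> T" "\<eta> \<le> e / (K + 1)" by simp_all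
  obtain h where h: "0 < h" "\<And>t s u v. 0 \<le> t \<Longrightarrow> s \<le> T \<Longrightarrow> s - t < h \<Longrightarrow> u \<in> {t..s} \<Longrightarrow> v \<in> {t..s} \<Longrightarrow> norm (\<omega> u - \<omega> v) \<le> \<eta>"
    by (rule uniformly_small_oscillation[OF w \<eta>(1)]) blast
  have \<eta>K: "\<eta> * K \<le> e"
  proof -
    have "\<eta> * K \<le> e / (K + 1) * (K + 1)" using \<eta> K(1) by (intro mult_mono) auto
    then show ?thesis using K(1) by simp
  qed
  have \<rho>'e: "(1 + T) * \<rho>' (2 * \<eta>) \<le> e"
    using d(2)[of "2 * \<eta>"] \<eta> T_pos by (simp add: less_divide_eq mult.commute)
  show ?thesis
  proof (rule that[of "min h \<eta>"])
    show "0 < min h \<eta>" using h \<eta> by simp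
    fix t s :: real assume *: "0 \<le> t" "t < s" "s \<le> T" "s - t < min h \<eta>"
    have t: "t \<in> {0..T}" and s: "s \<in> {0..T}" using * by auto
    have "val T g L U \<P> \<infinity> s \<omega> - \<epsilon> \<le> val T g L U \<P> \<infinity> t \<omega>"
    proof (rule val_greatest[OF t w])
      fix P and \<gamma> :: "'d path \<Rightarrow> real" assume P: "P \<in> \<P> t \<omega>" and \<gamma>: "\<gamma> \<in> stops T t"
      have intD: "integrable P (\<lambda>x. \<rho> (2 * \<eta> + supnorm t s x)) \<and> (\<integral>x. \<rho> (2 * \<eta> + supnorm t s x) \<partial>P) \<le> \<rho>' (2 * \<eta>)"
        using *(4) \<eta> by (intro expect[OF *(1-3) _ _ P]) auto
      have "\<exists>\<tau>\<in>stops T t. val T g L U \<P> \<infinity> s \<omega> - \<eta> * K - (1 + T) * \<rho>' (2 * \<eta>) - e \<le> \<J> t \<omega> P \<tau> \<gamma>"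
        by (rule lower_estimate_core[OF *(1-3) w _ _ _ \<rho> pc sc P \<gamma> _ _ e])
          (use * h(2)[OF *(1,3)] K(2)[OF _ s] intD in auto)
      then obtain \<tau> where \<tau>: "\<tau> \<in> stops T t" "val T g L U \<P> \<infinity> s \<omega> - \<eta> * K - (1 + T) * \<rho>' (2 * \<eta>) - e \<le> \<J> t \<omega> P \<tau> \<gamma>"
        by blast
      have "val T g L U \<P> \<infinity> s \<omega> - \<epsilon> \<le> \<J> t \<omega> P \<tau> \<gamma>" using \<tau>(2) \<eta>K \<rho>'e by (simp add: e_def)
      then show "\<exists>\<tau>\<in>dyadic_stops T t \<infinity>. val T g L U \<P> \<infinity> s \<omega> - \<epsilon> \<le> \<J> t \<omega> P \<tau> \<gamma>"
        using \<tau>(1) by (intro bexI[of _ \<tau>]) (simp_all add: dyadic_stops_def)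
    qed
    then show "val T g L U \<P> \<infinity> s \<omega> \<le> val T g L U \<P> \<infinity> t \<omega> + \<epsilon>" by simp
  qed
qed

text \<open>Continuity is assumed along all paths, because the shifted process runs along pasted
  paths and not along \<omega>.\<close>

lemma shift_val_in_S_space:
  fixes \<omega> :: "'d path"
  assumes cont: "\<And>\<omega>. \<omega> \<in> Omega T 0 \<Longrightarrow> continuous_on {0..T} (\<lambda>s. val T g L U \<P> \<infinity> s \<omega>)"
    and pc: "path_continuous_val T g L U \<P> \<rho>" and \<rho>: "modulus \<rho>"
    and t: "t \<in> {0..T}" and w: "\<omega> \<in> Omega T 0" and P: "P \<in> \<P> t \<omega>"
  shows "shift_proc T (val T g L U \<P> \<infinity>) t \<omega> \<in> S_space T t P"
proof -
  let ?X = "shift_proc T (val T g L U \<P> \<infinity>) t \<omega>"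
  note hP = class_hat_probs[OF t w P]
  have pi: "paste T 0 t \<omega> x \<in> Omega T 0" if "x \<in> Omega T t" for x
    using t w that by (intro paste_in_Omega) auto
  have meas: "?X s \<in> borel_measurable (canon_filt T t s)" if s: "s \<in> {t..T}" for s
  proof (rule path_functional_measurable[OF _ _ \<rho>])
    fix x y :: "'d path" assume x: "x \<in> Omega T t" and y: "y \<in> Omega T t"
    have "\<bar>?X s x - ?X s y\<bar> \<le> \<rho> (supnorm 0 s (\<lambda>r. paste T 0 t \<omega> x r - paste T 0 t \<omega> y r))"
      using pc pi[OF x] pi[OF y] t s unfolding path_continuous_val_def shift_proc_def by simp
    also have "\<dots> \<le> \<rho> (supnorm t s (\<lambda>r. x r - y r))"
    proof (rule modulus_mono[OF \<rho>])
      show "0 \<le> supnorm 0 s (\<lambda>r. paste T 0 t \<omega> x r - paste T 0 t \<omega> y r)"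
        using t s by (intro supnorm_nonneg continuous_on_diff Omega_continuous_on[OF pi[OF x]] Omega_continuous_on[OF pi[OF y]]) auto
      show "supnorm 0 s (\<lambda>r. paste T 0 t \<omega> x r - paste T 0 t \<omega> y r) \<le> supnorm t s (\<lambda>r. x r - y r)"
        using t s by (intro supnorm_paste_diff x y) auto
    qed
    finally show "\<bar>?X s x - ?X s y\<bar> \<le> \<rho> (supnorm t s (\<lambda>r. x r - y r))" .
  qed (use s in auto)
  have contX: "continuous_on {t..T} (\<lambda>s. ?X s x)" if "x \<in> Omega T t" for x
    unfolding shift_proc_def using t by (intro continuous_on_subset[OF cont[OF pi[OF that]]]) auto
  have le: "\<bar>?X s x\<bar> \<le> \<bar>shift_proc T (Psi L U) t \<omega> s x\<bar>" if s: "s \<in> {t..T}" and x: "x \<in> Omega T t" for s x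
  proof -
    have "s \<in> {0..T}" using s t by auto
    from val_ge_L[OF this pi[OF x], of \<infinity>] val_le_U[OF this pi[OF x], of \<infinity>] show ?thesis
      unfolding shift_proc_def Psi_def by auto
  qed
  have "integrable P (\<lambda>x. SUP s\<in>{t..T}. \<bar>?X s x\<bar>)"
  proof (rule Bochner_Integration.integrable_bound[OF integrable_SUP_Psi[OF t w hP]])
    show "(\<lambda>x. SUP s\<in>{t..T}. \<bar>?X s x\<bar>) \<in> borel_measurable P"
      unfolding measurable_cong_sets[OF hat_probsD(2)[OF hP] refl]
    proof (rule measurable_process_SUP)
      show "(\<lambda>x. \<bar>?X s x\<bar>) \<in> borel_measurable (canon_filt T t T)" if "s \<in> {t..T}" for s
        by (intro borel_measurable_abs measurable_canon_filt_T[OF meas[OF that]])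
      show "continuous_on {t..T} (\<lambda>s. \<bar>?X s x\<bar>)" if "x \<in> space (canon_filt T t T)" for x
        using that by (intro continuous_on_rabs contX) simp
    qed (use t in auto)
    have "norm (SUP s\<in>{t..T}. \<bar>?X s x\<bar>) \<le> norm (SUP s\<in>{t..T}. \<bar>shift_proc T (Psi L U) t \<omega> s x\<bar>)" if x: "x \<in> Omega T t" for x
    proof -
      have bdd: "bdd_above ((\<lambda>s. \<bar>?X s x\<bar>) ` {t..T})" using bdd_above_norm_path[OF contX[OF x]] by simp
      have "0 \<le> (SUP s\<in>{t..T}. \<bar>?X s x\<bar>)" using cSUP_upper[OF _ bdd, of t] t by (auto intro: order_trans[OF abs_ge_zero])
      moreover have "(SUP s\<in>{t..T}. \<bar>?X s x\<bar>) \<le> (SUP s\<in>{t..T}. \<bar>shift_proc T (Psi L U) t \<omega> s x\<bar>)"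
        using t by (intro cSUP_least order_trans[OF le SUP_shift_Psi_upper[OF t w]] x) auto
      ultimately show ?thesis by simp
    qed
    then show "AE x in P. norm (SUP s\<in>{t..T}. \<bar>?X s x\<bar>) \<le> norm (SUP s\<in>{t..T}. \<bar>shift_proc T (Psi L U) t \<omega> s x\<bar>)"
      using hat_probsD(3)[OF hP] by (intro AE_I2) auto
  qed
  then show ?thesis using meas contX by (simp add: S_space_def)
qed

end

section \<open>Semicontinuity, continuity and integrability from the two estimates\<close>

theorem proposition3p4:
  fixes T :: real
    and g L U :: "('d::finite) process"
    and \<P> :: "real \<Rightarrow> 'd path \<Rightarrow> 'd path measure set"
    and \<rho>\<^sub>0 \<rho>\<^sub>1 :: "real \<Rightarrow> real"
  assumes "0 < T"
    and "payoff_regular T g L U \<rho>\<^sub>0"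
    and "integrability T g L U"
    and "adapted_class T g L U \<P>"
    and "stable_conditioning T \<P>"
    and "weakly_stable_pasting T g L U \<P>"
    and "modulus \<rho>\<^sub>1" and "\<forall>x\<ge>0. \<rho>\<^sub>0 x \<le> \<rho>\<^sub>1 x"
    and "path_continuous_val T g L U \<P> \<rho>\<^sub>1"
    and "oscillation_bound T \<P> \<rho>\<^sub>1"
  shows "(\<forall>n::enat. 1 \<le> n \<longrightarrow>
            (\<forall>s\<in>{0<..T}. \<forall>\<omega>\<in>Omega T 0.
               Limsup (at_left s) (\<lambda>r. ereal (val T g L U \<P> n r \<omega>)) \<le> ereal (val T g L U \<P> n s \<omega>)) \<and>
            (\<forall>t\<in>{0..<T}. \<forall>\<omega>\<in>Omega T 0.
               ereal (val T g L U \<P> n t \<omega>) \<le> Liminf (at_right t) (\<lambda>r. ereal (val T g L U \<P> n r \<omega>)))) \<and>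
         (\<forall>\<omega>\<in>Omega T 0. continuous_on {0..T} (\<lambda>t. val T g L U \<P> \<infinity> t \<omega>)) \<and>
         (\<forall>t\<in>{0..T}. \<forall>\<omega>\<in>Omega T 0. \<forall>P\<in>\<P> t \<omega>.
            shift_proc T (val T g L U \<P> \<infinity>) t \<omega> \<in> S_space T t P)"
proof -
  interpret game_class T g L U \<rho>\<^sub>0 \<P>
    by unfold_locales (use assms in auto)
  have \<rho>: "modulus \<rho>\<^sub>1" "\<And>x. 0 \<le> x \<Longrightarrow> \<rho>\<^sub>0 x \<le> \<rho>\<^sub>1 x" using assms by auto
  let ?V = "val T g L U \<P>"
  have upper: "\<exists>h>0. \<forall>t s n. 0 \<le> t \<longrightarrow> t < s \<longrightarrow> s \<le> T \<longrightarrow> s - t < h \<longrightarrow> 1 \<le> n \<longrightarrow> ?V n t \<omega> \<le> ?V n s \<omega> + e"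
    if "\<omega> \<in> Omega T 0" "0 < e" for \<omega> e
  proof (rule val_upper[OF assms(6,10) \<rho> that])
    fix h assume "0 < h" and "\<And>t s n. 0 \<le> t \<Longrightarrow> t < s \<Longrightarrow> s \<le> T \<Longrightarrow> s - t < h \<Longrightarrow> 1 \<le> n \<Longrightarrow> ?V n t \<omega> \<le> ?V n s \<omega> + e"
    then show ?thesis by (intro exI[of _ h] conjI allI impI)
  qed
  have lower: "\<exists>h>0. \<forall>t s. 0 \<le> t \<longrightarrow> t < s \<longrightarrow> s \<le> T \<longrightarrow> s - t < h \<longrightarrow> ?V \<infinity> s \<omega> \<le> ?V \<infinity> t \<omega> + e"
    if "\<omega> \<in> Omega T 0" "0 < e" for \<omega> e
  proof (rule val_lower[OF assms(5,10,9) \<rho> that])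
    fix h assume "0 < h" and "\<And>t s. 0 \<le> t \<Longrightarrow> t < s \<Longrightarrow> s \<le> T \<Longrightarrow> s - t < h \<Longrightarrow> ?V \<infinity> s \<omega> \<le> ?V \<infinity> t \<omega> + e"
    then show ?thesis by (intro exI[of _ h] conjI allI impI)
  qed
  have left: "Limsup (at_left s) (\<lambda>r. ereal (?V n r \<omega>)) \<le> ereal (?V n s \<omega>)"
    if n: "1 \<le> n" and s: "s \<in> {0<..T}" and w: "\<omega> \<in> Omega T 0" for n s \<omega>
  proof (rule ereal_le_epsilon2)
    fix e :: real assume e: "0 < e"
    obtain h where h: "0 < h" "\<And>t s n. 0 \<le> t \<Longrightarrow> t < s \<Longrightarrow> s \<le> T \<Longrightarrow> s - t < h \<Longrightarrow> 1 \<le> n \<Longrightarrow> ?V n t \<omega> \<le> ?V n s \<omega> + e"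
      using upper[OF w e] by blast
    have "\<forall>\<^sub>F r in at_left s. ereal (?V n r \<omega>) \<le> ereal (?V n s \<omega>) + ereal e"
    proof (rule eventually_at_leftI[of "max 0 (s - h)"])
      show "ereal (?V n r \<omega>) \<le> ereal (?V n s \<omega>) + ereal e" if "r \<in> {max 0 (s - h)<..<s}" for r
        using h(2)[of r s n] that s n by simp
    qed (use h s in auto)
    then show "Limsup (at_left s) (\<lambda>r. ereal (?V n r \<omega>)) \<le> ereal (?V n s \<omega>) + ereal e" by (rule Limsup_bounded)
  qed
  have right: "ereal (?V n t \<omega>) \<le> Liminf (at_right t) (\<lambda>r. ereal (?V n r \<omega>))"
    if n: "1 \<le> n" and t: "t \<in> {0..<T}" and w: "\<omega> \<in> Omega T 0" for n t \<omega>
  proof (rule ereal_le_epsilon2)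
    fix e :: real assume e: "0 < e"
    obtain h where h: "0 < h" "\<And>t s n. 0 \<le> t \<Longrightarrow> t < s \<Longrightarrow> s \<le> T \<Longrightarrow> s - t < h \<Longrightarrow> 1 \<le> n \<Longrightarrow> ?V n t \<omega> \<le> ?V n s \<omega> + e"
      using upper[OF w e] by blast
    have "\<forall>\<^sub>F r in at_right t. ereal (?V n t \<omega> - e) \<le> ereal (?V n r \<omega>)"
    proof (rule eventually_at_rightI[of _ "min T (t + h)"])
      show "ereal (?V n t \<omega> - e) \<le> ereal (?V n r \<omega>)" if "r \<in> {t<..<min T (t + h)}" for r
        using h(2)[of t r n] that t n by simp
    qed (use h t in auto)
    then have "ereal (?V n t \<omega> - e) \<le> Liminf (at_right t) (\<lambda>r. ereal (?V n r \<omega>))" by (rule Liminf_bounded)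
    then have "ereal (?V n t \<omega> - e) + ereal e \<le> Liminf (at_right t) (\<lambda>r. ereal (?V n r \<omega>)) + ereal e" by (rule add_right_mono)
    then show "ereal (?V n t \<omega>) \<le> Liminf (at_right t) (\<lambda>r. ereal (?V n r \<omega>)) + ereal e" by simp
  qed
  have cont: "continuous_on {0..T} (\<lambda>t. ?V \<infinity> t \<omega>)" if w: "\<omega> \<in> Omega T 0" for \<omega>
    unfolding continuous_on_iff
  proof (intro ballI allI impI)
    fix t e :: real assume t: "t \<in> {0..T}" and "0 < e"
    then have e: "0 < e / 2" by simp
    obtain h1 where h1: "0 < h1" "\<And>t s n. 0 \<le> t \<Longrightarrow> t < s \<Longrightarrow> s \<le> T \<Longrightarrow> s - t < h1 \<Longrightarrow> 1 \<le> n \<Longrightarrow> ?V n t \<omega> \<le> ?V n s \<omega> + e / 2"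
      using upper[OF w e] by blast
    obtain h2 where h2: "0 < h2" "\<And>t s. 0 \<le> t \<Longrightarrow> t < s \<Longrightarrow> s \<le> T \<Longrightarrow> s - t < h2 \<Longrightarrow> ?V \<infinity> s \<omega> \<le> ?V \<infinity> t \<omega> + e / 2"
      using lower[OF w e] by blast
    have close: "\<bar>?V \<infinity> s \<omega> - ?V \<infinity> t \<omega>\<bar> \<le> e / 2" if st: "0 \<le> t" "t < s" "s \<le> T" "s - t < min h1 h2" for t s
    proof -
      have 1: "?V \<infinity> t \<omega> \<le> ?V \<infinity> s \<omega> + e / 2" using st by (intro h1(2)) auto
      have 2: "?V \<infinity> s \<omega> \<le> ?V \<infinity> t \<omega> + e / 2" using st by (intro h2(2)) auto
      have half: "\<bar>b - a\<bar> \<le> c" if "a \<le> b + c" "b \<le> a + c" for a b c :: real using that by linarith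
      show ?thesis by (rule half[OF 1 2])
    qed
    have "dist (?V \<infinity> s \<omega>) (?V \<infinity> t \<omega>) < e" if s: "s \<in> {0..T}" "dist s t < min h1 h2" for s
    proof -
      have "\<bar>?V \<infinity> s \<omega> - ?V \<infinity> t \<omega>\<bar> \<le> e / 2"
      proof (cases s t rule: linorder_cases)
        case less
        then have "\<bar>?V \<infinity> t \<omega> - ?V \<infinity> s \<omega>\<bar> \<le> e / 2" using s t by (intro close) (auto simp: dist_real_def)
        then show ?thesis by (subst abs_minus_commute)
      next
        case greater
        then show ?thesis using s t by (intro close) (auto simp: dist_real_def)
      qed (use e in simp)
      then show ?thesis using e by (simp add: dist_real_def)
    qed
    then show "\<exists>d>0. \<forall>s\<in>{0..T}. dist s t < d \<longrightarrow> dist (?V \<infinity> s \<omega>) (?V \<infinity> t \<omega>) < e"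
      using h1(1) h2(1) by (intro exI[of _ "min h1 h2"]) auto
  qed
  show ?thesis
    using left right cont shift_val_in_S_space[OF cont assms(9) \<rho>(1)] by blast
qed

end
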